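(* Let $p$ be an odd prime and let $h$ be any integer in the range $1\le h\le (p+1)/2$. Then there exist arbitrarily large primes $q$ and $r$ such that $A(pqr)=h$; that is, for every $N$ there are primes $q,r$ with $q>N$ and $r>q>p$ such that $A(pqr)=h$.
   Context: For a positive integer $n$, $\Phi_n(x)=\sum_{0\le m\le \varphi(n)} a(m;n)x^m$ denotes the $n$th cyclotomic polynomial ($\varphi$ is Euler's totient function), and $A(n)=\max_m |a(m;n)|$ denotes its height, i.e. the largest absolute value of its coefficients. *)

theory Defs
  imports
    Complex_Main
    "HOL-Computational_Algebra.Computational_Algebra"
    "HOL-Number_Theory.Totient"
begin

text \<open>
  The product runs over the primitive complex \<open>n\<close>th roots of unity. The coefficients are
  integers, but they are kept here as complex numbers, so the height below is formed with
  the complex modulus.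
\<close>

definition cyclotomic_poly :: "nat \<Rightarrow> complex poly" where
  "cyclotomic_poly n =
     (\<Prod>k | k \<in> {1..n} \<and> coprime k n. [:- cis (2 * pi * real k / real n), 1:])"

lemma degree_cyclotomic_poly: "degree (cyclotomic_poly n) = totient n"
proof -
  have "{k. k \<in> {1..n} \<and> coprime k n} = totatives n"
    by (auto simp: totatives_def)
  then show ?thesis
    unfolding cyclotomic_poly_def
    by (simp add: degree_prod_eq_sum_degree totient_def)
qed

lemma lead_coeff_cyclotomic_poly: "lead_coeff (cyclotomic_poly n) = 1"
  unfolding cyclotomic_poly_def by (simp add: lead_coeff_prod)

definition cyclotomic_height :: "nat \<Rightarrow> real" where
  "cyclotomic_height n = Max ((\<lambda>m. cmod (poly.coeff (cyclotomic_poly n) m)) ` {0..totient n})"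

end

theory Submission
  imports
    Defs
    "HOL-Analysis.Analysis"
    "HOL-Real_Asymp.Real_Asymp"
    "HOL-Number_Theory.Number_Theory"
begin

text \<open>
  Let \<open>\<mu> p + \<nu> q = p q + 1\<close>. The coefficients of \<open>\<Phi>\<close> at \<open>p q r\<close> are signed sums of
  coefficients of \<open>\<Phi>\<close> at \<open>p q\<close>, truncated at \<open>J = n div r\<close>, taken over an arithmetic progression
  modulo \<open>p q\<close> with difference \<open>r\<inverse>\<close>. Write exponents as \<open>\<alpha> p + \<beta> q\<close>: the coefficient at \<open>p q\<close> is 1 for
  \<open>\<alpha> < \<mu>\<close>, \<open>\<beta> < \<nu>\<close>, it is -1 for \<open>\<alpha> \<ge> \<mu>\<close>, \<open>\<beta> \<ge> \<nu>\<close>, and 0 otherwise. For \<open>h = d + 1 \<ge> 2\<close> choose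
  \<open>q \<equiv> d\<close> modulo \<open>p\<close> and \<open>r (p - q) \<equiv> 1\<close> modulo \<open>p q\<close>. One step of the progression is then
  \<open>(\<alpha>, \<beta>) \<mapsto> (\<alpha> - 1, \<beta> + 1)\<close>, and a coefficient at \<open>p q r\<close> is the difference of the sums over \<open>p\<close> points of
  a diagonal and of the same diagonal moved by \<open>d\<close> columns. As \<open>q > p\<^sup>2\<close>, along such a diagonal the
  truncated region changes shape at most once and its border moves by at most one column; the
  first effect telescopes to at most \<open>d\<close>, the second contributes at most 1, and both bounds are attained
  together. For \<open>h = 1\<close> take \<open>r \<equiv> 1\<close> modulo \<open>p q\<close>. The primes \<open>q\<close> and \<open>r\<close> are supplied by Dirichlet's
  theorem.
\<close>

section \<open>Dirichlet characters\<close>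

text \<open>The shift by d columns comes from the factor 1 - x^q in Phi_pqr(x) (1 - x^(pq)) =
  Phi_pq(x^r) (1 + ... + x^(p-1)) (1 - x^q): raising an offset by q fixes \<alpha> modulo q and
  moves \<beta> by q, which is d modulo p. The residue of r says that r p is 1 modulo q and r q is
  -1 modulo p. The case h = 1 stands apart because d = 0 would make p divide q. The bound h \<le> (p
  + 1) / 2 is 2 d < p; it keeps the extremal diagonals, which extend up to 2 d, from wrapping around
  the p columns. Since r > p q, the truncation J and the diagonal can be prescribed independently.
  Dirichlet's theorem is applied to the moduli p and p q. They are squarefree, so a class other than
  1 is already visible modulo one prime, and characters built from a single primitive root give
  orthogonality. The analysis stays on the real half-line. Its obstacle is that L(1) is nonzero: a
  real character offers no second zero to outweigh the pole and needs a Lambert series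
  instead.\<close>

definition dirichlet_chars :: "nat \<Rightarrow> (nat \<Rightarrow> complex) set" where
  "dirichlet_chars n = {\<psi>. (\<forall>a. \<psi> a \<noteq> 0 \<longleftrightarrow> coprime a n) \<and>
     (\<forall>a b. \<psi> (a * b) = \<psi> a * \<psi> b) \<and> (\<forall>a. \<psi> (a mod n) = \<psi> a)}"

definition principal_char :: "nat \<Rightarrow> nat \<Rightarrow> complex" where
  "principal_char n a = of_bool (coprime a n)"

lemma dirichlet_chars_nonzero_iff: "\<psi> \<in> dirichlet_chars n \<Longrightarrow> \<psi> a \<noteq> 0 \<longleftrightarrow> coprime a n"
  and dirichlet_chars_mult: "\<psi> \<in> dirichlet_chars n \<Longrightarrow> \<psi> (a * b) = \<psi> a * \<psi> b"
  and dirichlet_chars_mod: "\<psi> \<in> dirichlet_chars n \<Longrightarrow> \<psi> (a mod n) = \<psi> a"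
  by (auto simp: dirichlet_chars_def)

lemma dirichlet_chars_cong: "\<psi> \<in> dirichlet_chars n \<Longrightarrow> [a = b] (mod n) \<Longrightarrow> \<psi> a = \<psi> b"
  using dirichlet_chars_mod[of \<psi> n a] dirichlet_chars_mod[of \<psi> n b] by (simp add: unique_euclidean_semiring_class.cong_def)

lemma dirichlet_chars_one: "\<psi> \<in> dirichlet_chars n \<Longrightarrow> \<psi> (Suc 0) = 1"
  using dirichlet_chars_mult[of \<psi> n 1 1] dirichlet_chars_nonzero_iff[of \<psi> n 1] by simp

lemma dirichlet_chars_power: "\<psi> \<in> dirichlet_chars n \<Longrightarrow> \<psi> (a ^ k) = \<psi> a ^ k"
  by (induction k) (auto simp: dirichlet_chars_one dirichlet_chars_mult)

lemma dirichlet_chars_power_totient: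
  assumes "\<psi> \<in> dirichlet_chars n" "coprime a n"
  shows "\<psi> a ^ totient n = 1"
  using dirichlet_chars_cong[OF assms(1) euler_theorem[OF assms(2)]] assms(1)
  by (simp add: dirichlet_chars_power dirichlet_chars_one)

lemma norm_dirichlet_chars:
  assumes "\<psi> \<in> dirichlet_chars n" "n > 0"
  shows "norm (\<psi> a) = of_bool (coprime a n)"
proof (cases "coprime a n")
  case True
  have "norm (\<psi> a) ^ totient n = 1"
    using dirichlet_chars_power_totient[OF assms(1) True] by (metis norm_one norm_power)
  moreover have "totient n > 0" using assms by simp
  ultimately have "norm (\<psi> a) = 1"
    using power_eq_1_iff[of "norm (\<psi> a)" "totient n"] by auto
  with True show ?thesis by simp
next
  case False
  then show ?thesis using dirichlet_chars_nonzero_iff[OF assms(1)] by auto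
qed

lemma norm_dirichlet_chars_le: "\<psi> \<in> dirichlet_chars n \<Longrightarrow> n > 0 \<Longrightarrow> norm (\<psi> a) \<le> 1"
  by (simp add: norm_dirichlet_chars)

text \<open>A character is determined by its values on the residues below \<open>n\<close>, and each
  value is 0 or a root of unity of order dividing \<open>totient n\<close>.\<close>

lemma finite_dirichlet_chars:
  assumes "n > 0"
  shows "finite (dirichlet_chars n)"
proof -
  have "(\<lambda>\<psi>. restrict \<psi> {..<n}) ` dirichlet_chars n
      \<subseteq> {..<n} \<rightarrow>\<^sub>E insert 0 {z. z ^ totient n = 1}"
  proof
    fix f assume "f \<in> (\<lambda>\<psi>. restrict \<psi> {..<n}) ` dirichlet_chars n"
    then obtain \<psi> where \<psi>: "\<psi> \<in> dirichlet_chars n" "f = restrict \<psi> {..<n}" by auto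
    have "\<psi> a \<in> insert 0 {z. z ^ totient n = 1}" for a
      using dirichlet_chars_power_totient[OF \<psi>(1), of a] dirichlet_chars_nonzero_iff[OF \<psi>(1), of a]
      by auto
    then show "f \<in> {..<n} \<rightarrow>\<^sub>E insert 0 {z. z ^ totient n = 1}"
      unfolding \<psi>(2) by (auto intro!: restrict_PiE_iff[THEN iffD2])
  qed
  moreover have "finite ({..<n} \<rightarrow>\<^sub>E insert (0::complex) {z. z ^ totient n = 1})"
    using assms by (intro finite_PiE) (use assms in \<open>auto intro!: finite_roots_unity simp: Suc_le_eq\<close>)
  moreover have "inj_on (\<lambda>\<psi>. restrict \<psi> {..<n}) (dirichlet_chars n)"
  proof (rule inj_onI)
    fix \<psi> \<eta> assume *: "\<psi> \<in> dirichlet_chars n" "\<eta> \<in> dirichlet_chars n"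
      "restrict \<psi> {..<n} = restrict \<eta> {..<n}"
    have "\<psi> (a mod n) = \<eta> (a mod n)" for a
      using fun_cong[OF *(3), of "a mod n"] assms by simp
    with * show "\<psi> = \<eta>" by (auto simp: dirichlet_chars_mod)
  qed
  ultimately show ?thesis by (meson finite_imageD finite_subset)
qed

lemma principal_char_in: "principal_char n \<in> dirichlet_chars n"
  by (cases "n = 0") (auto simp: dirichlet_chars_def principal_char_def)

lemma dirichlet_chars_times:
  "\<psi> \<in> dirichlet_chars n \<Longrightarrow> \<eta> \<in> dirichlet_chars n \<Longrightarrow> (\<lambda>a. \<psi> a * \<eta> a) \<in> dirichlet_chars n"
  unfolding dirichlet_chars_def by auto

lemma dirichlet_chars_cnj: "\<psi> \<in> dirichlet_chars n \<Longrightarrow> (\<lambda>a. cnj (\<psi> a)) \<in> dirichlet_chars n"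
  unfolding dirichlet_chars_def by auto

lemma cnj_dirichlet_chars_mult:
  assumes "\<psi> \<in> dirichlet_chars n" "n > 0" "coprime a n"
  shows "cnj (\<psi> a) * \<psi> a = 1"
  using norm_dirichlet_chars[OF assms(1,2), of a] assms(3)
  by (metis complex_norm_square mult.commute of_bool_eq(2) of_real_1 power_one)

text \<open>The discrete logarithm to a primitive root \<open>g\<close> modulo \<open>p\<close>,
  followed by a faithful character of the cyclic group of order \<open>p - 1\<close>. Value 1 at
  \<open>a\<close> would make \<open>p - 1\<close> divide the logarithm, hence \<open>a\<close>
  congruent to 1.\<close>

lemma exists_dirichlet_char_prime:
  assumes "prime p" "p dvd n" "coprime a n" "\<not> [a = 1] (mod p)"
  obtains \<psi> where "\<psi> \<in> dirichlet_chars n" "\<psi> a \<noteq> 1"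
proof -
  have "\<exists>g. residue_primroot p g"
    using assms(1) residue_primroot_iff_in_cyclic_moduli[of p]
    by (metis prime_primitive_root_exists prime_gt_1_nat)
  then obtain g where g: "residue_primroot p g" by blast
  have ordg: "ord p g = p - 1" "coprime p g"
    using g assms(1) by (auto simp: residue_primroot_def totient_prime)
  define N where "N = p - 1"
  have N: "N > 0" using prime_gt_1_nat[OF assms(1)] by (simp add: N_def)
  define \<zeta> where "\<zeta> k = cis (2 * pi * real k / real N)" for k
  have \<zeta>_add: "\<zeta> (k + l) = \<zeta> k * \<zeta> l" for k l
    unfolding \<zeta>_def by (simp add: cis_mult field_simps add_divide_distrib)
  have \<zeta>_N: "\<zeta> (N * k) = 1" for k
    using N unfolding \<zeta>_def by (simp add: field_simps) (metis cis_multiple_2pi Ints_of_nat mult.assoc mult.commute)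
  have \<zeta>_mod: "\<zeta> k = \<zeta> (k mod N)" for k
    by (metis \<zeta>_N \<zeta>_add mult.left_neutral mult_div_mod_eq)
  have \<zeta>_inj: "\<zeta> k = 1 \<Longrightarrow> N dvd k" for k
    using bij_betw_imp_inj_on[OF Complex.bij_betw_roots_unity[OF N], THEN inj_onD, of "k mod N" 0] N
    by (subst (asm) \<zeta>_mod) (auto simp: \<zeta>_def)
  \<comment> \<open>The condition on \<open>k\<close> sees only the class of \<open>a\<close> modulo
    \<open>p\<close>, so the same holds for \<open>ind\<close>; this yields the period
    \<open>n\<close>.\<close>
  define ind where "ind a = (LEAST k. [g ^ k = a] (mod p))" for a
  have gen: "\<exists>k. [g ^ k = a] (mod p)" if "coprime a p" for a
  proof -
    have "a mod p \<in> totatives p"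
      using that assms(1) prime_gt_1_nat[OF assms(1)]
      by (auto simp: totatives_def coprime_commute intro!: Nat.gr0I)
    then show ?thesis
      using residue_primroot_is_generator[OF _ g] prime_gt_1_nat[OF assms(1)]
      by (force simp: bij_betw_def unique_euclidean_semiring_class.cong_def)
  qed
  have ind: "[g ^ ind a = a] (mod p)" if "coprime a p" for a
    unfolding ind_def using LeastI_ex[OF gen[OF that]] .
  have cop: "coprime b p" if "coprime b n" for b
    using that assms(2) by (metis coprime_divisors dvd_refl)
  have \<zeta>_eq: "\<zeta> k = \<zeta> l" if "[g ^ k = g ^ l] (mod p)" for k l
  proof -
    have "[k = l] (mod N)" using order_divides_expdiff[of p g k l] ordg that
      by (simp add: N_def coprime_commute)
    then show ?thesis by (metis \<zeta>_mod unique_euclidean_semiring_class.cong_def)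
  qed
  \<comment> \<open>A character of modulus \<open>p\<close> is lifted to modulus \<open>n\<close>:
    every non-unit modulo \<open>n\<close> gets the value 0, not only the multiples of
    \<open>p\<close>.\<close>
  define \<psi> where "\<psi> b = (if coprime b n then \<zeta> (ind b) else 0)" for b
  have "\<psi> \<in> dirichlet_chars n"
  proof -
    have "\<psi> b \<noteq> 0 \<longleftrightarrow> coprime b n" for b by (simp add: \<psi>_def \<zeta>_def)
    moreover have "\<psi> (b * c) = \<psi> b * \<psi> c" for b c
    proof (cases "coprime b n \<and> coprime c n")
      case True
      have "[g ^ (ind b + ind c) = b * c] (mod p)"
        unfolding power_add using True by (intro cong_mult ind cop) auto
      moreover have "[g ^ ind (b * c) = b * c] (mod p)"
        using True by (intro ind cop) auto
      ultimately have "\<zeta> (ind (b * c)) = \<zeta> (ind b + ind c)"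
        by (intro \<zeta>_eq) (metis cong_sym cong_trans)
      then show ?thesis using True by (simp add: \<psi>_def \<zeta>_add)
    qed (auto simp: \<psi>_def)
    moreover have "\<psi> (b mod n) = \<psi> b" for b
    proof -
      have "ind (b mod n) = ind b"
        unfolding ind_def unique_euclidean_semiring_class.cong_def using assms(2) by (simp add: mod_mod_cancel)
      then show ?thesis
        by (cases "n = 0") (auto simp: \<psi>_def)
    qed
    ultimately show ?thesis unfolding dirichlet_chars_def by blast
  qed
  moreover have "\<psi> a \<noteq> 1"
  proof
    assume "\<psi> a = 1"
    then have "N dvd ind a" using assms(3) by (auto simp: \<psi>_def intro: \<zeta>_inj)
    then have "[g ^ ind a = 1] (mod p)"
      using ordg ord_divides[of g "ind a" p] by (simp add: N_def coprime_commute)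
    with ind[OF cop[OF assms(3)]] assms(4) show False by (metis cong_sym cong_trans)
  qed
  ultimately show ?thesis using that by blast
qed

text \<open>A squarefree \<open>n\<close> is the product of its prime factors, so a class different
  from 1 modulo \<open>n\<close> differs from 1 modulo one of them.\<close>

lemma exists_dirichlet_char:
  assumes "squarefree n" "coprime a n" "\<not> [a = 1] (mod n)"
  obtains \<psi> where "\<psi> \<in> dirichlet_chars n" "\<psi> a \<noteq> 1"
proof -
  have "n > 0" using assms(1) by (intro Nat.gr0I) auto
  have "\<exists>p\<in>prime_factors n. \<not> [a = 1] (mod p)"
  proof (rule ccontr)
    assume "\<not> ?thesis"
    then have "[a = 1] (mod (\<Prod>p\<in>prime_factors n. p))"
      by (intro coprime_cong_prod_nat) (auto intro: primes_coprime)
    moreover have "(\<Prod>p\<in>prime_factors n. p) = n"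
      using assms(1) \<open>n > 0\<close> prime_factorization_nat[of n] squarefree_factorial_semiring'[of n]
      by simp
    ultimately show False using assms(3) by simp
  qed
  then show ?thesis
    using exists_dirichlet_char_prime[of _ n a] assms(2) that by (auto simp: in_prime_factors_iff)
qed

text \<open>Multiplication by a character \<open>\<eta>\<close> with
  \<open>\<eta> a \<noteq> 1\<close> permutes the characters, its inverse being multiplication by
  the conjugate. So the factor \<open>\<eta> a\<close> leaves the sum unchanged.\<close>

lemma sum_dirichlet_chars:
  assumes "squarefree n"
  shows "(\<Sum>\<psi>\<in>dirichlet_chars n. \<psi> a) = of_nat (card (dirichlet_chars n)) * of_bool ([a = 1] (mod n))"
proof (cases "[a = 1] (mod n)")
  case True
  then have "(\<Sum>\<psi>\<in>dirichlet_chars n. \<psi> a) = (\<Sum>\<psi>\<in>dirichlet_chars n. 1)"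
    by (intro sum.cong) (metis dirichlet_chars_cong dirichlet_chars_one One_nat_def)+
  with True show ?thesis by simp
next
  case False
  have n: "n > 0" using assms by (intro Nat.gr0I) auto
  have "(\<Sum>\<psi>\<in>dirichlet_chars n. \<psi> a) = 0"
  proof (cases "coprime a n")
    case True
    obtain \<eta> where \<eta>: "\<eta> \<in> dirichlet_chars n" "\<eta> a \<noteq> 1"
      using exists_dirichlet_char[OF assms True False] by blast
    have inv: "cnj (\<eta> b) * (\<eta> b * \<psi> b) = \<psi> b" "\<eta> b * (cnj (\<eta> b) * \<psi> b) = \<psi> b"
      if "\<psi> \<in> dirichlet_chars n" for \<psi> b
      using cnj_dirichlet_chars_mult[OF \<eta>(1) n, of b] dirichlet_chars_nonzero_iff[OF that, of b]
      by (cases "coprime b n"; auto simp: algebra_simps)+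
    have "(\<Sum>\<psi>\<in>dirichlet_chars n. \<eta> a * \<psi> a) = (\<Sum>\<psi>\<in>dirichlet_chars n. \<psi> a)"
      by (rule sum.reindex_bij_witness[where i = "\<lambda>\<psi> b. cnj (\<eta> b) * \<psi> b" and j = "\<lambda>\<psi> b. \<eta> b * \<psi> b"])
         (auto simp: inv intro!: dirichlet_chars_times dirichlet_chars_cnj \<eta>)
    then show ?thesis using \<eta>(2) by (simp flip: sum_distrib_left)
  qed (auto intro!: sum.neutral dest: dirichlet_chars_nonzero_iff)
  with False show ?thesis by simp
qed

lemma sum_cnj_dirichlet_chars:
  assumes "squarefree n" "coprime b n"
  shows "(\<Sum>\<psi>\<in>dirichlet_chars n. cnj (\<psi> b) * \<psi> a)
       = of_nat (card (dirichlet_chars n)) * of_bool ([a = b] (mod n))"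
proof -
  have n: "n > 0" using assms by (intro Nat.gr0I) auto
  obtain c where c: "[b * c = 1] (mod n)"
    using cong_solve_coprime_nat[OF assms(2)] by auto
  \<comment> \<open>On units the conjugate is the inverse value, hence the value at the inverse
    residue \<open>c\<close>; the sum becomes the one for \<open>c * a\<close>.\<close>
  have "cnj (\<psi> b) = \<psi> c" if "\<psi> \<in> dirichlet_chars n" for \<psi>
  proof -
    have "\<psi> b * \<psi> c = 1"
      using dirichlet_chars_cong[OF that c] that by (simp add: dirichlet_chars_mult dirichlet_chars_one)
    then show ?thesis
      using cnj_dirichlet_chars_mult[OF that n assms(2)]
      by (metis mult.assoc mult.left_neutral mult.right_neutral)
  qed
  then have "(\<Sum>\<psi>\<in>dirichlet_chars n. cnj (\<psi> b) * \<psi> a) = (\<Sum>\<psi>\<in>dirichlet_chars n. \<psi> (c * a))"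
    by (intro sum.cong) (auto simp: dirichlet_chars_mult)
  also have "[c * a = 1] (mod n) \<longleftrightarrow> [a = b] (mod n)"
  proof
    assume "[c * a = 1] (mod n)"
    then have "[b * (c * a) = b * 1] (mod n)" by (rule cong_scalar_left)
    moreover have "[(b * c) * a = 1 * a] (mod n)" using c by (rule cong_scalar_right)
    ultimately show "[a = b] (mod n)" by (simp add: mult.assoc) (metis cong_sym cong_trans)
  next
    assume "[a = b] (mod n)"
    then have "[c * a = c * b] (mod n)" by (rule cong_scalar_left)
    then show "[c * a = 1] (mod n)" using c by (metis cong_trans mult.commute)
  qed
  then have "(\<Sum>\<psi>\<in>dirichlet_chars n. \<psi> (c * a))
       = of_nat (card (dirichlet_chars n)) * of_bool ([a = b] (mod n))"
    by (simp add: sum_dirichlet_chars[OF assms(1)])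
  finally show ?thesis .
qed

lemma sum_nonprincipal_char:
  assumes "\<psi> \<in> dirichlet_chars n" "n > 0" "\<psi> \<noteq> principal_char n"
  shows "(\<Sum>a<n. \<psi> a) = 0"
proof -
  obtain b where b: "\<psi> b \<noteq> 1" "coprime b n"
    using assms(3) dirichlet_chars_nonzero_iff[OF assms(1)]
    by (auto simp: principal_char_def fun_eq_iff of_bool_def split: if_splits)
  obtain c where c: "[b * c = 1] (mod n)"
    using cong_solve_coprime_nat[OF b(2)] by auto
  have inv: "c * (b * a mod n) mod n = a" "b * (c * a mod n) mod n = a" if "a < n" for a
    using cong_scalar_right[OF c, of a] that by (simp_all add: mod_mult_right_eq unique_euclidean_semiring_class.cong_def ac_simps)
  have "(\<Sum>a<n. \<psi> b * \<psi> a) = (\<Sum>a<n. \<psi> a)"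
    using assms(2)
    by (intro sum.reindex_bij_witness[where i = "\<lambda>a. (c * a) mod n" and j = "\<lambda>a. (b * a) mod n"])
       (auto simp: inv dirichlet_chars_mod[OF assms(1)] dirichlet_chars_mult[OF assms(1)])
  then show ?thesis using b(1) by (simp flip: sum_distrib_left)
qed

lemma sum_lessThan_add:
  fixes f :: "nat \<Rightarrow> 'a :: comm_monoid_add"
  shows "(\<Sum>a<m + k. f a) = (\<Sum>a<m. f a) + (\<Sum>a<k. f (m + a))"
  by (induction k) (auto simp: add_ac)

text \<open>Full periods cancel, and fewer than \<open>n\<close> terms of modulus at most 1 remain.
  This is the constant \<open>C\<close> in the Abel summations for nonprincipal characters.\<close>

lemma norm_sum_nonprincipal_char_le:
  assumes "\<psi> \<in> dirichlet_chars n" "n > 0" "\<psi> \<noteq> principal_char n"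
  shows "norm (\<Sum>a<M. \<psi> a) \<le> real n"
proof (induction M rule: less_induct)
  case (less M)
  show ?case
  proof (cases "M < n")
    case True
    have "norm (\<Sum>a<M. \<psi> a) \<le> (\<Sum>a<M. 1)"
      by (intro sum_norm_le norm_dirichlet_chars_le[OF assms(1,2)])
    with True show ?thesis by simp
  next
    case False
    then obtain K where K: "M = n + K" by (metis le_Suc_ex not_less)
    have "(\<Sum>a<n + K. \<psi> a) = (\<Sum>a<n. \<psi> a) + (\<Sum>a<K. \<psi> (n + a))"
      by (rule sum_lessThan_add)
    also have "(\<Sum>a<K. \<psi> (n + a)) = (\<Sum>a<K. \<psi> a)"
      by (metis dirichlet_chars_mod[OF assms(1)] mod_add_self1)
    finally show ?thesis
      using less[of K] assms(2) K by (simp add: sum_nonprincipal_char[OF assms])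
  qed
qed

section \<open>Dirichlet series on the real line\<close>

text \<open>Summation by parts with the partial sums taken from 0: the two boundary terms and the
  telescoping differences add up to \<open>2 * C * b A\<close>, uniformly in \<open>B\<close>.
  Monotonicity is asked only from \<open>A\<close> on because \<open>ln m * m powr - s\<close>
  increases at first.\<close>

lemma norm_abel_sum_le:
  fixes c :: "nat \<Rightarrow> 'a :: real_normed_vector" and b :: "nat \<Rightarrow> real"
  assumes C: "\<And>M. norm (\<Sum>m<M. c m) \<le> C"
    and dec: "\<And>m. m \<ge> A \<Longrightarrow> b (Suc m) \<le> b m" and nonneg: "\<And>m. m \<ge> A \<Longrightarrow> b m \<ge> 0"
  shows "norm (\<Sum>m=A..<B. b m *\<^sub>R c m) \<le> 2 * C * b A"
proof (cases "A \<le> B")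
  case True
  define S where "S M = (\<Sum>m<M. c m)" for M
  have "(\<Sum>m=A..<B. b m *\<^sub>R c m) =
      b B *\<^sub>R S B - b A *\<^sub>R S A + (\<Sum>m=A..<B. (b m - b (Suc m)) *\<^sub>R S (Suc m))"
    using True
  proof (induction B rule: dec_induct)
    case (step n)
    have "c n = S (Suc n) - S n" by (simp add: S_def)
    then have "b n *\<^sub>R c n = b n *\<^sub>R S (Suc n) - b n *\<^sub>R S n" by (simp add: scaleR_diff_right)
    then show ?case using step by (simp add: scaleR_diff_left)
  qed simp
  also have "norm \<dots> \<le> b B * C + b A * C + (\<Sum>m=A..<B. (b m - b (Suc m)) * C)"
  proof (intro order_trans[OF norm_triangle_ineq] order_trans[OF norm_triangle_ineq4] add_mono)
    show "norm (\<Sum>m=A..<B. (b m - b (Suc m)) *\<^sub>R S (Suc m)) \<le> (\<Sum>m=A..<B. (b m - b (Suc m)) * C)"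
      using dec C by (intro sum_norm_le) (auto simp: S_def simp del: sum.lessThan_Suc intro!: mult_left_mono)
  qed (use nonneg True C in \<open>auto simp: S_def intro!: mult_left_mono\<close>)
  also have "(\<Sum>m=A..<B. (b m - b (Suc m)) * C) = (b A - b B) * C"
    using True by (simp flip: sum_distrib_right) (simp add: sum_Suc_diff'[of A B "\<lambda>m. - b m", simplified])
  finally show ?thesis by (simp add: algebra_simps)
next
  case False
  then show ?thesis using C[of 0] nonneg[of A] by simp
qed

lemma abel_summable:
  fixes c :: "nat \<Rightarrow> 'a :: banach" and b :: "nat \<Rightarrow> real"
  assumes C: "\<And>M. norm (\<Sum>m<M. c m) \<le> C"
    and dec: "\<And>m. m \<ge> A \<Longrightarrow> b (Suc m) \<le> b m" and nonneg: "\<And>m. m \<ge> A \<Longrightarrow> b m \<ge> 0"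
    and lim: "b \<longlonglongrightarrow> 0"
  shows "summable (\<lambda>m. b m *\<^sub>R c m)"
    and "\<And>n. n \<ge> A \<Longrightarrow> norm ((\<Sum>m. b m *\<^sub>R c m) - (\<Sum>m<n. b m *\<^sub>R c m)) \<le> 2 * C * b n"
proof -
  have bd: "norm (\<Sum>m=n..<B. b m *\<^sub>R c m) \<le> 2 * C * b n" if "n \<ge> A" for n B
    using that by (intro norm_abel_sum_le C dec nonneg) auto
  have C0: "C \<ge> 0" using C[of 0] by simp
  show sm: "summable (\<lambda>m. b m *\<^sub>R c m)"
    unfolding summable_Cauchy
  proof safe
    fix e :: real assume "e > 0"
    have "(\<lambda>n. 2 * C * b n) \<longlonglongrightarrow> 2 * C * 0" by (intro tendsto_intros lim)
    then have "eventually (\<lambda>n. 2 * C * b n < e) sequentially"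
      using \<open>e > 0\<close> by (intro order_tendstoD) auto
    then obtain N where "\<And>n. n \<ge> N \<Longrightarrow> 2 * C * b n < e" by (auto simp: eventually_sequentially)
    then show "\<exists>N. \<forall>m\<ge>N. \<forall>n. norm (\<Sum>m=m..<n. b m *\<^sub>R c m) < e"
      using bd by (intro exI[of _ "max N A"]) (fastforce intro: le_less_trans)
  qed
  fix n assume n: "n \<ge> A"
  have "(\<lambda>B. (\<Sum>m<B. b m *\<^sub>R c m) - (\<Sum>m<n. b m *\<^sub>R c m))
      \<longlonglongrightarrow> (\<Sum>m. b m *\<^sub>R c m) - (\<Sum>m<n. b m *\<^sub>R c m)"
    by (intro tendsto_intros summable_LIMSEQ sm)
  then show "norm ((\<Sum>m. b m *\<^sub>R c m) - (\<Sum>m<n. b m *\<^sub>R c m)) \<le> 2 * C * b n"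
  proof (rule tendsto_upperbound[OF tendsto_norm])
    show "\<forall>\<^sub>F B in sequentially. norm ((\<Sum>m<B. b m *\<^sub>R c m) - (\<Sum>m<n. b m *\<^sub>R c m)) \<le> 2 * C * b n"
      using eventually_ge_at_top[of n]
    proof eventually_elim
      case (elim B)
      have "(\<Sum>m<B. b m *\<^sub>R c m) - (\<Sum>m<n. b m *\<^sub>R c m) = (\<Sum>m=n..<B. b m *\<^sub>R c m)"
        using elim by (simp add: sum_diff_nat_ivl flip: atLeast0LessThan)
      then show ?case using bd[OF n] by simp
    qed
  qed auto
qed

text \<open>The derivative of \<open>ln t * t powr - x\<close> has the sign of
  \<open>1 - x * ln t\<close>.\<close>

lemma ln_mult_powr_decreasing:
  fixes x :: real and m n :: nat
  assumes "x > 0" "ln (real m) \<ge> 1 / x" "m > 0" "m \<le> n"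
  shows "ln (real n) * real n powr - x \<le> ln (real m) * real m powr - x"
proof (rule DERIV_nonpos_imp_nonincreasing[where f = "\<lambda>t. ln t * t powr - x"])
  fix t assume t: "real m \<le> t" "t \<le> real n"
  then have t0: "t > 0" using assms by simp
  have "ln t \<ge> 1 / x" using t assms by (intro order_trans[OF assms(2)]) auto
  then have "1 - x * ln t \<le> 0" using assms(1) by (simp add: field_simps)
  moreover have "((\<lambda>t. ln t * t powr - x) has_real_derivative (t powr (- x - 1) * (1 - x * ln t))) (at t)"
    using t0 by (auto intro!: derivative_eq_intros simp: powr_diff field_simps)
  ultimately show "\<exists>y. ((\<lambda>t. ln t * t powr - x) has_real_derivative y) (at t) \<and> y \<le> 0"
    by (intro exI conjI) (auto simp: mult_le_0_iff)
qed (use assms in auto)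

lemma dirichlet_series_summable:
  fixes c :: "nat \<Rightarrow> 'a :: banach"
  assumes C: "\<And>M. norm (\<Sum>m<M. c m) \<le> C" and s: "s > (0::real)"
  shows "summable (\<lambda>m. real m powr - s *\<^sub>R c m)"
\<comment> \<open>Starting at 1 skips the index 0, where \<open>0 powr - s = 0\<close> would break
  monotonicity.\<close>
proof (rule abel_summable(1)[OF C, of 1])
  show "(\<lambda>m. real m powr - s) \<longlonglongrightarrow> 0" using s by real_asymp
qed (use s in \<open>auto intro!: powr_mono2'\<close>)

text \<open>Termwise differentiation on \<open>{d<..}\<close> with \<open>d = s / 2\<close>. From
  \<open>exp (1 / d)\<close> on the weights decrease for every \<open>x \<ge> d\<close>, so Abel
  summation bounds all tails of the derived series at once by
  \<open>2 * C * (ln n * n powr - d)\<close>, which tends to 0.\<close>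

lemma dirichlet_series_deriv:
  fixes c :: "nat \<Rightarrow> 'a :: banach"
  assumes C: "\<And>M. norm (\<Sum>m<M. c m) \<le> C" and s: "s > (0::real)"
  shows "summable (\<lambda>m. (ln (real m) * real m powr - s) *\<^sub>R c m)"
    and "((\<lambda>s. \<Sum>m. real m powr - s *\<^sub>R c m) has_vector_derivative
           - (\<Sum>m. (ln (real m) * real m powr - s) *\<^sub>R c m)) (at s)"
proof -
  define d where "d = s / 2"
  have d: "d > 0" "d < s" using s by (auto simp: d_def)
  define A where "A = nat \<lceil>exp (1 / d)\<rceil>"
  have A: "ln (real m) \<ge> 1 / x" "m > 0" if "m \<ge> A" "x \<ge> d" for m x
  proof -
    have m: "real m \<ge> exp (1 / d)" using that(1) by (simp add: A_def nat_le_iff ceiling_le_iff)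
    then show "m > 0" by (metis exp_gt_zero not_le of_nat_0_less_iff order.strict_trans2)
    have "1 / x \<le> 1 / d" using that(2) d by (simp add: frac_le)
    also have "\<dots> \<le> ln (real m)" using m by (metis exp_gt_zero ln_exp ln_le_cancel_iff order.strict_trans2)
    finally show "ln (real m) \<ge> 1 / x" .
  qed
  have dec: "ln (real (Suc m)) * real (Suc m) powr - x \<le> ln (real m) * real m powr - x"
    if "m \<ge> A" "x \<ge> d" for m x
    using that A d by (intro ln_mult_powr_decreasing) auto
  have lim: "(\<lambda>m. ln (real m) * real m powr - x) \<longlonglongrightarrow> 0" if "x \<ge> d" for x
    using that d(1) by real_asymp
  have nonneg: "0 \<le> ln (real m) * real m powr - x" for m x
    by (cases "m = 0") auto
  have sm: "summable (\<lambda>m. (ln (real m) * real m powr - x) *\<^sub>R c m)"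
    and tail: "\<And>n. n \<ge> A \<Longrightarrow> norm ((\<Sum>m. (ln (real m) * real m powr - x) *\<^sub>R c m)
        - (\<Sum>m<n. (ln (real m) * real m powr - x) *\<^sub>R c m)) \<le> 2 * C * (ln (real n) * real n powr - x)"
    if "x \<ge> d" for x
    by (rule abel_summable[OF C dec[OF _ that] nonneg lim[OF that]]; assumption)+
  show "summable (\<lambda>m. (ln (real m) * real m powr - s) *\<^sub>R c m)" using sm d by simp
  have "\<exists>g. \<forall>x\<in>{d<..}. (\<lambda>m. real m powr - x *\<^sub>R c m) sums g x \<and>
      (g has_derivative (\<lambda>h. h *\<^sub>R - (\<Sum>m. (ln (real m) * real m powr - x) *\<^sub>R c m))) (at x within {d<..})"
  proof (rule has_derivative_series[where f = "\<lambda>m x. real m powr - x *\<^sub>R c m" and x = s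
        and l = "\<Sum>m. real m powr - s *\<^sub>R c m"
        and f' = "\<lambda>m x h. h *\<^sub>R - ((ln (real m) * real m powr - x) *\<^sub>R c m)"])
    fix m :: nat and x :: real
    have "((\<lambda>x. real m powr - x) has_real_derivative - (ln (real m) * real m powr - x)) (at x within {d<..})"
      by (cases "m = 0") (auto simp: powr_def intro!: derivative_eq_intros)
    then have "((\<lambda>x. real m powr - x *\<^sub>R c m) has_vector_derivative
        - (ln (real m) * real m powr - x) *\<^sub>R c m) (at x within {d<..})"
      by (auto intro!: derivative_eq_intros)
    then show "((\<lambda>x. real m powr - x *\<^sub>R c m) has_derivative
        (\<lambda>h. h *\<^sub>R - ((ln (real m) * real m powr - x) *\<^sub>R c m))) (at x within {d<..})"
      by (simp add: has_vector_derivative_def)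
  next
    fix e :: real assume e: "e > 0"
    have "(\<lambda>n. 2 * C * (ln (real n) * real n powr - d)) \<longlonglongrightarrow> 2 * C * 0"
      by (intro tendsto_intros lim) auto
    then have "\<forall>\<^sub>F n in sequentially. 2 * C * (ln (real n) * real n powr - d) < e"
      using e by (intro order_tendstoD) auto
    then show "\<forall>\<^sub>F n in sequentially. \<forall>x\<in>{d<..}. \<forall>h.
        norm ((\<Sum>m<n. h *\<^sub>R - ((ln (real m) * real m powr - x) *\<^sub>R c m))
          - h *\<^sub>R - (\<Sum>m. (ln (real m) * real m powr - x) *\<^sub>R c m)) \<le> e * norm h"
      using eventually_ge_at_top[of A]
    proof eventually_elim
      case (elim n)
      show ?case
      proof (intro ballI allI)
        fix x h :: real assume x: "x \<in> {d<..}"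
        have "(\<Sum>m<n. h *\<^sub>R - ((ln (real m) * real m powr - x) *\<^sub>R c m))
          - h *\<^sub>R - (\<Sum>m. (ln (real m) * real m powr - x) *\<^sub>R c m)
          = h *\<^sub>R ((\<Sum>m. (ln (real m) * real m powr - x) *\<^sub>R c m)
              - (\<Sum>m<n. (ln (real m) * real m powr - x) *\<^sub>R c m))"
          by (simp add: scaleR_diff_right sum_negf scaleR_sum_right)
        moreover have "norm ((\<Sum>m. (ln (real m) * real m powr - x) *\<^sub>R c m)
              - (\<Sum>m<n. (ln (real m) * real m powr - x) *\<^sub>R c m)) \<le> e"
        proof -
          have n1: "real n \<ge> 1" using A(2)[OF elim(2) order_refl] by simp
          have "2 * C * (ln (real n) * real n powr - x) \<le> 2 * C * (ln (real n) * real n powr - d)"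
            using C[of 0] x n1 by (intro mult_left_mono powr_mono) auto
          with tail[of x n] elim x show ?thesis by simp
        qed
        ultimately show "norm ((\<Sum>m<n. h *\<^sub>R - ((ln (real m) * real m powr - x) *\<^sub>R c m))
          - h *\<^sub>R - (\<Sum>m. (ln (real m) * real m powr - x) *\<^sub>R c m)) \<le> e * norm h"
          by (simp only: norm_scaleR real_norm_def) (simp add: mult.commute[of e] mult_left_mono)
      qed
    qed
  next
    show "(\<lambda>m. real m powr - s *\<^sub>R c m) sums (\<Sum>m. real m powr - s *\<^sub>R c m)"
      using dirichlet_series_summable[OF C s] by (rule summable_sums)
  qed (use d in \<open>auto intro: convex_real_interval\<close>)
  then obtain g where g: "\<And>x. x \<in> {d<..} \<Longrightarrow> (\<lambda>m. real m powr - x *\<^sub>R c m) sums g x"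
    "\<And>x. x \<in> {d<..} \<Longrightarrow> (g has_derivative
      (\<lambda>h. h *\<^sub>R - (\<Sum>m. (ln (real m) * real m powr - x) *\<^sub>R c m))) (at x within {d<..})"
    by blast
  have "(g has_vector_derivative - (\<Sum>m. (ln (real m) * real m powr - s) *\<^sub>R c m)) (at s)"
    using g(2)[of s] d by (simp add: has_vector_derivative_def at_within_open[of s "{d<..}"])
  then show "((\<lambda>s. \<Sum>m. real m powr - s *\<^sub>R c m) has_vector_derivative
           - (\<Sum>m. (ln (real m) * real m powr - s) *\<^sub>R c m)) (at s)"
    by (rule has_vector_derivative_transform_within_open[where S = "{d<..}"])
       (use g(1) d in \<open>auto simp: sums_iff\<close>)
qed

section \<open>Regrouping double sums by products\<close>

lemma has_sum_positive_iff:
  fixes f :: "nat \<Rightarrow> 'a :: {comm_monoid_add, topological_space}"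
  assumes "f 0 = 0"
  shows "(f has_sum S) {0<..} \<longleftrightarrow> (f has_sum S) UNIV"
  by (rule has_sum_cong_neutral) (use assms in \<open>auto simp: not_less\<close>)

text \<open>The pairs \<open>(d, k)\<close> are grouped by \<open>N = d * k\<close>. This serves
  both the product of a Dirichlet series with the von Mangoldt series and the expansion of Lambert
  series. Indices are positive since every number divides 0.\<close>

lemma has_sum_divisors:
  fixes g :: "nat \<Rightarrow> nat \<Rightarrow> 'a :: {topological_comm_monoid_add,t3_space}"
  assumes summ: "(\<lambda>(d, k). g d k) summable_on {0<..} \<times> {0<..}"
    and rows: "\<And>d. d > 0 \<Longrightarrow> (g d has_sum r d) {0<..}"
    and total: "(r has_sum S) {0<..}"
  shows "((\<lambda>N. \<Sum>d | d dvd N. g d (N div d)) has_sum S) {0<..}"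
proof (rule has_sum_SigmaD)
  have "((\<lambda>(d, k). g d k) has_sum S) ({0<..} \<times> {0<..})"
    by (rule has_sum_SigmaI[where g = r]) (use assms in auto)
  also have "?this \<longleftrightarrow> ((\<lambda>(N, d). g d (N div d)) has_sum S) (SIGMA N:{0<..}. {d. d dvd N})"
    by (rule has_sum_reindex_bij_witness[where j = "\<lambda>(d, k). (d * k, d)" and i = "\<lambda>(N, d). (d, N div d)"])
       (auto dest: dvd_pos_nat elim!: dvdE)
  finally show "((\<lambda>(N, d). g d (N div d)) has_sum S) (SIGMA N:{0<..}. {d. d dvd N})" .
next
  fix N :: nat assume "N \<in> {0<..}"
  then show "((\<lambda>d. (\<lambda>(N, d). g d (N div d)) (N, d)) has_sum (\<Sum>d | d dvd N. g d (N div d))) {d. d dvd N}"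
    by (intro has_sum_finiteI) auto
qed

text \<open>The exponent is split at the midpoint \<open>t\<close> of 1 and \<open>s\<close>: the
  series of \<open>m powr - t\<close> converges and so has bounded partial sums, and the remaining
  exponent \<open>s - t > 0\<close> absorbs the logarithm.\<close>

lemma summable_ln_powr:
  fixes s :: real
  assumes "s > 1"
  shows "summable (\<lambda>m. ln (real m) * real m powr - s)"
proof -
  define t where "t = (1 + s) / 2"
  have t: "t > 1" "t < s" using assms by (auto simp: t_def)
  have sm: "summable (\<lambda>m. real m powr - t)" using t by (simp add: summable_real_powr_iff)
  have "summable (\<lambda>m. (ln (real m) * real m powr - (s - t)) *\<^sub>R (real m powr - t))"
  proof (rule dirichlet_series_deriv(1))
    show "norm (\<Sum>m<M. real m powr - t) \<le> (\<Sum>m. real m powr - t)" for M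
      using sum_le_suminf[OF sm, of "{..<M}"] by (simp add: sum_nonneg)
  qed (use t in auto)
  also have "(\<lambda>m. (ln (real m) * real m powr - (s - t)) *\<^sub>R (real m powr - t))
      = (\<lambda>m. ln (real m) * real m powr - s)"
    by (rule ext) (simp add: mult.assoc flip: powr_add)
  finally show ?thesis .
qed

section \<open>L-series and their logarithmic derivatives\<close>

definition dirichlet_L :: "(nat \<Rightarrow> complex) \<Rightarrow> real \<Rightarrow> complex" where
  "dirichlet_L c s = (\<Sum>m. real m powr - s *\<^sub>R c m)"

text \<open>The termwise derivative. It is the true derivative for \<open>s > 1\<close> by
  \<open>dirichlet_L_deriv_gt_1\<close>, and for nonprincipal characters and \<open>s > 0\<close> by
  \<open>nonprincipal_L_deriv\<close>.\<close>

definition dirichlet_L' :: "(nat \<Rightarrow> complex) \<Rightarrow> real \<Rightarrow> complex" where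
  "dirichlet_L' c s = - (\<Sum>m. (ln (real m) * real m powr - s) *\<^sub>R c m)"

definition dirichlet_mangoldt :: "(nat \<Rightarrow> complex) \<Rightarrow> real \<Rightarrow> complex" where
  "dirichlet_mangoldt c s = (\<Sum>m. (mangoldt m * real m powr - s) *\<^sub>R c m)"

lemma has_sum_dirichlet_L:
  assumes "\<And>m. norm (c m) \<le> 1" "s > 1"
  shows "summable (\<lambda>m. norm (real m powr - s *\<^sub>R c m))"
    and "((\<lambda>m. real m powr - s *\<^sub>R c m) has_sum dirichlet_L c s) UNIV"
proof -
  have "summable (\<lambda>m. real m powr - s)" using assms by (simp add: summable_real_powr_iff)
  then show sm: "summable (\<lambda>m. norm (real m powr - s *\<^sub>R c m))"
    by (rule summable_comparison_test'[where N = 0]) (use assms in \<open>auto intro: mult_left_le\<close>)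
  show "((\<lambda>m. real m powr - s *\<^sub>R c m) has_sum dirichlet_L c s) UNIV"
    unfolding dirichlet_L_def
    by (rule norm_summable_imp_has_sum[OF sm summable_sums[OF summable_norm_cancel[OF sm]]])
qed

lemma has_sum_dirichlet_mangoldt:
  assumes "\<And>m. norm (c m) \<le> 1" "s > 1"
  shows "summable (\<lambda>m. norm ((mangoldt m * real m powr - s) *\<^sub>R c m))"
    and "((\<lambda>m. (mangoldt m * real m powr - s) *\<^sub>R c m) has_sum dirichlet_mangoldt c s) UNIV"
proof -
  have "norm ((mangoldt m * real m powr - s) *\<^sub>R c m) \<le> ln (real m) * real m powr - s" for m
  proof (cases "m = 0")
    case False
    have "norm ((mangoldt m * real m powr - s) *\<^sub>R c m) = mangoldt m * real m powr - s * norm (c m)"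
      by (simp add: abs_mult)
    also have "\<dots> \<le> mangoldt m * real m powr - s * 1"
      using assms by (intro mult_left_mono) (auto simp: mangoldt_nonneg)
    also have "\<dots> \<le> ln (real m) * real m powr - s"
      using False mangoldt_le[of m] by (simp add: mult_right_mono)
    finally show ?thesis .
  qed auto
  then show sm: "summable (\<lambda>m. norm ((mangoldt m * real m powr - s) *\<^sub>R c m))"
    by (intro summable_comparison_test'[OF summable_ln_powr[OF assms(2)], of 0]) auto
  show "((\<lambda>m. (mangoldt m * real m powr - s) *\<^sub>R c m) has_sum dirichlet_mangoldt c s) UNIV"
    unfolding dirichlet_mangoldt_def
    by (rule norm_summable_imp_has_sum[OF sm summable_sums[OF summable_norm_cancel[OF sm]]])
qed

text \<open>The partial sums of \<open>c\<close> itself may be unbounded, as for the principal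
  character. Those of \<open>m powr - t *\<^sub>R c m\<close> with \<open>1 < t < s\<close> are
  bounded, so differentiation is done for this series at \<open>s - t\<close> and translated
  back.\<close>

lemma dirichlet_L_deriv_gt_1:
  assumes "\<And>m. norm (c m) \<le> 1" "s > 1"
  shows "(dirichlet_L c has_vector_derivative dirichlet_L' c s) (at s)"
proof -
  define t where "t = (1 + s) / 2"
  have t: "t > 1" "t < s" using assms by (auto simp: t_def)
  have sm: "summable (\<lambda>m. real m powr - t)" using t by (simp add: summable_real_powr_iff)
  have bd: "norm (\<Sum>m<M. real m powr - t *\<^sub>R c m) \<le> (\<Sum>m. real m powr - t)" for M
  proof -
    have "norm (\<Sum>m<M. real m powr - t *\<^sub>R c m) \<le> (\<Sum>m<M. real m powr - t)"
      by (intro sum_norm_le) (auto intro: mult_left_le assms)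
    also have "\<dots> \<le> (\<Sum>m. real m powr - t)" by (intro sum_le_suminf sm) auto
    finally show ?thesis .
  qed
  have e1: "real m powr - (x - t) *\<^sub>R (real m powr - t *\<^sub>R c m) = real m powr - x *\<^sub>R c m" for m x
    by (simp flip: powr_add)
  have e2: "(ln (real m) * real m powr - (x - t)) *\<^sub>R (real m powr - t *\<^sub>R c m)
      = (ln (real m) * real m powr - x) *\<^sub>R c m" for m x
    by (simp add: mult.assoc flip: powr_add)
  have "((\<lambda>s. \<Sum>m. real m powr - s *\<^sub>R (real m powr - t *\<^sub>R c m)) has_vector_derivative
      dirichlet_L' c s) (at (s - t))"
    using dirichlet_series_deriv(2)[OF bd, of "s - t"] t
    by (simp only: e2 dirichlet_L'_def)
  then have "((\<lambda>s. \<Sum>m. real m powr - s *\<^sub>R (real m powr - t *\<^sub>R c m)) \<circ> (\<lambda>x. x - t)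
      has_vector_derivative 1 *\<^sub>R dirichlet_L' c s) (at s)"
    by (intro vector_diff_chain_at) (auto intro!: derivative_eq_intros)
  then show ?thesis by (simp only: o_def e1 dirichlet_L_def[abs_def]) simp
qed

text \<open>The Dirichlet convolution identity \<open>1 * \<Lambda> = ln\<close>, twisted by a completely multiplicative
  function, is the formula for the logarithmic derivative of the L-function.\<close>

lemma dirichlet_L_log_deriv:
  assumes mult: "\<And>a b. c (a * b) = c a * c b" and "\<And>m. norm (c m) \<le> 1" "s > 1"
  shows "dirichlet_L' c s = - dirichlet_L c s * dirichlet_mangoldt c s"
proof -
  define f where "f m = real m powr - s *\<^sub>R c m" for m
  define g where "g m = (mangoldt m * real m powr - s) *\<^sub>R c m" for m
  have [simp]: "f 0 = 0" "g 0 = 0" by (simp_all add: f_def g_def)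
  have f: "summable (\<lambda>m. norm (f m))" "(f has_sum dirichlet_L c s) UNIV"
    using has_sum_dirichlet_L[of c s] assms by (auto simp: f_def[abs_def])
  have g: "summable (\<lambda>m. norm (g m))" "(g has_sum dirichlet_mangoldt c s) UNIV"
    using has_sum_dirichlet_mangoldt[of c s] assms by (auto simp: g_def[abs_def])
  have nf: "((\<lambda>m. norm (f m)) has_sum (\<Sum>m. norm (f m))) {0<..}"
    using f(1) by (subst has_sum_positive_iff) (auto intro: sums_nonneg_imp_has_sum summable_sums)
  have ng: "((\<lambda>m. norm (g m)) has_sum (\<Sum>m. norm (g m))) {0<..}"
    using g(1) by (subst has_sum_positive_iff) (auto intro: sums_nonneg_imp_has_sum summable_sums)
  have "((\<lambda>N. \<Sum>d | d dvd N. g d * f (N div d)) has_sum dirichlet_mangoldt c s * dirichlet_L c s) {0<..}"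
  proof (rule has_sum_divisors)
    have "(\<lambda>(d, k). norm (g d) * norm (f k)) summable_on {0<..} \<times> {0<..}"
    proof (rule summable_on_SigmaI)
      show "((\<lambda>y. (case (x, y) of (d, k) \<Rightarrow> norm (g d) * norm (f k))) has_sum
          norm (g x) * (\<Sum>m. norm (f m))) {0<..}" for x
        using has_sum_cmult_right[OF nf, of "norm (g x)"] by simp
      show "(\<lambda>x. norm (g x) * (\<Sum>m. norm (f m))) summable_on {0<..}"
        using ng by (intro summable_on_cmult_left) (auto simp: summable_on_def)
    qed auto
    then have "(\<lambda>x. norm (case x of (d, k) \<Rightarrow> g d * f k)) summable_on {0<..} \<times> {0<..}"
      by (simp add: case_prod_unfold norm_mult)
    then show "(\<lambda>(d, k). g d * f k) summable_on {0<..} \<times> {0<..}"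
      by (rule abs_summable_summable)
    show "((\<lambda>k. g d * f k) has_sum g d * dirichlet_L c s) {0<..}" for d
      using f(2) by (intro has_sum_cmult_right) (simp add: has_sum_positive_iff)
    show "((\<lambda>d. g d * dirichlet_L c s) has_sum dirichlet_mangoldt c s * dirichlet_L c s) {0<..}"
      using g(2) by (intro has_sum_cmult_left) (simp add: has_sum_positive_iff)
  qed
  also have "?this \<longleftrightarrow> ((\<lambda>N. (ln (real N) * real N powr - s) *\<^sub>R c N) has_sum
      dirichlet_mangoldt c s * dirichlet_L c s) {0<..}"
  proof (rule has_sum_cong)
    fix N :: nat assume N: "N \<in> {0<..}"
    have "(\<Sum>d | d dvd N. g d * f (N div d)) = (\<Sum>d | d dvd N. mangoldt d *\<^sub>R (real N powr - s *\<^sub>R c N))"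
    proof (rule sum.cong)
      fix d assume "d \<in> {d. d dvd N}"
      then obtain k where k: "N = d * k" by auto
      with N have "d > 0" "k > 0" by auto
      then show "g d * f (N div d) = mangoldt d *\<^sub>R (real N powr - s *\<^sub>R c N)"
        by (simp add: k f_def g_def mult powr_mult mult_ac)
    qed auto
    also have "\<dots> = ln (real N) *\<^sub>R (real N powr - s *\<^sub>R c N)"
      using N mangoldt_sum[of N, where ?'a = real] by (simp only: flip: scaleR_sum_left) simp
    finally show "(\<Sum>d | d dvd N. g d * f (N div d)) = (ln (real N) * real N powr - s) *\<^sub>R c N" by simp
  qed
  finally have "((\<lambda>N. (ln (real N) * real N powr - s) *\<^sub>R c N) has_sum
      dirichlet_mangoldt c s * dirichlet_L c s) UNIV"
    by (subst (asm) has_sum_positive_iff) auto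
  from has_sum_imp_sums[OF this] show ?thesis
    by (simp add: dirichlet_L'_def sums_iff)
qed

section \<open>Nonvanishing at 1\<close>

lemma sum_divisors_mult_coprime:
  fixes c :: "nat \<Rightarrow> 'a :: comm_semiring_1"
  assumes mult: "\<And>a b. c (a * b) = c a * c b" and "coprime a b" "a > 0" "b > 0"
  shows "(\<Sum>d | d dvd a * b. c d) = (\<Sum>d | d dvd a. c d) * (\<Sum>d | d dvd b. c d)"
proof -
  have gcds: "gcd (x * y) a = x" "gcd (x * y) b = y" if "x dvd a" "y dvd b" for x y
  proof -
    have "coprime a y" "coprime b x"
      using that assms(2) coprime_divisors[of x a b b] coprime_divisors[of a a y b]
      by (auto simp: coprime_commute)
    then show "gcd (x * y) a = x" "gcd (x * y) b = y"
      using that by (simp_all add: gcd_mult_left_right_cancel gcd_mult_left_left_cancel gcd_nat.absorb1)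
  qed
  have "(\<Sum>d | d dvd a. c d) * (\<Sum>d | d dvd b. c d)
      = (\<Sum>(x, y)\<in>{d. d dvd a} \<times> {d. d dvd b}. c (x * y))"
    by (simp add: sum_product sum.cartesian_product mult)
  also have "\<dots> = (\<Sum>d | d dvd a * b. c d)"
  proof (rule sum.reindex_bij_witness[where i = "\<lambda>d. (gcd d a, gcd d b)" and j = "\<lambda>(x, y). x * y"])
    fix d assume "d \<in> {d. d dvd a * b}"
    then obtain x y where "d = x * y" "x dvd a" "y dvd b" using division_decomp[of d a b] by auto
    then show "(case (gcd d a, gcd d b) of (x, y) \<Rightarrow> x * y) = d" using gcds[of x y] by simp
  qed (auto simp: gcds intro: mult_dvd_mono)
  finally show ?thesis by simp
qed

lemma prime_power_induct [consumes 1, case_names unit step]: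
  fixes N :: nat
  assumes "N > 0" and "P 1"
    and "\<And>p k M. prime p \<Longrightarrow> k > 0 \<Longrightarrow> M > 0 \<Longrightarrow> \<not> p dvd M \<Longrightarrow> P M \<Longrightarrow> P (p ^ k * M)"
  shows "P N"
  using assms(1)
proof (induction N rule: less_induct)
  case (less N)
  show ?case
  proof (cases "N = 1")
    case False
    then obtain p where p: "prime p" "p dvd N" using prime_factor_nat by blast
    obtain M where M: "N = p ^ multiplicity p N * M" "\<not> p dvd M"
      using multiplicity_decompose'[of N p] less.prems p(1) by (metis not_prime_unit neq0_conv)
    have k: "multiplicity p N > 0"
      using p less.prems by (simp add: prime_multiplicity_gt_zero_iff)
    have "M > 0" using M less.prems by (metis mult_0_right neq0_conv)
    moreover have "p ^ multiplicity p N > 1" by (rule one_less_power[OF prime_gt_1_nat[OF p(1)] k])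
    ultimately have "M < N" by (subst M(1)) simp
    then show ?thesis using assms(3)[OF p(1) k \<open>M > 0\<close> M(2)] less.IH \<open>M > 0\<close> M(1) by metis
  qed (use assms(2) in simp)
qed

text \<open>By multiplicativity only prime powers matter. There the divisor sum is
  \<open>\<Sum>i\<le>k. c p ^ i\<close>, which for \<open>c p\<close> in {-1, 0, 1} is nonnegative,
  and at least 1 if \<open>k\<close> is even.\<close>

lemma sum_real_char_divisors:
  fixes c :: "nat \<Rightarrow> real"
  assumes mult: "\<And>a b. c (a * b) = c a * c b" and one: "c 1 = 1" and vals: "\<And>a. c a \<in> {-1, 0, 1}"
    and "N > 0"
  shows "(\<Sum>d | d dvd N. c d) \<ge> 0" and "(\<Sum>d | d dvd N ^ 2. c d) \<ge> 1"
proof -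
  have cpow: "c (a ^ k) = c a ^ k" for a k
    by (induction k) (use one in \<open>auto simp: mult\<close>)
  have pp: "(\<Sum>d | d dvd p ^ k. c d) = (\<Sum>i\<le>k. c p ^ i)" if "prime p" for p k
  proof -
    have "{d. d dvd p ^ k} = (\<lambda>i. p ^ i) ` {..k}"
      using divides_primepow_nat[OF that] by auto
    moreover have "inj_on (\<lambda>i. p ^ i) {..k}"
      using prime_gt_1_nat[OF that] by (auto simp: inj_on_def)
    ultimately show ?thesis by (simp add: sum.reindex cpow)
  qed
  have geom: "(\<Sum>i\<le>k. x ^ i) \<ge> 0 \<and> (even k \<longrightarrow> (\<Sum>i\<le>k. x ^ i) \<ge> 1)" if "x \<in> {-1, 0, 1}" for x :: real and k
  proof -
    have "(\<Sum>i\<le>k. (-1) ^ i) = (of_bool (even k) :: real)" by (induction k) auto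
    moreover have "(\<Sum>i\<le>k. 0 ^ i) = (1 :: real)" by (induction k) auto
    ultimately show ?thesis using that by auto
  qed
  have cop: "coprime (p ^ k) M" if "prime p" "\<not> p dvd M" for p k M :: nat
    using that prime_imp_coprime by auto
  show "(\<Sum>d | d dvd N. c d) \<ge> 0"
    using \<open>N > 0\<close>
  proof (induction N rule: prime_power_induct)
    case unit
    then show ?case using one by simp
  next
    case (step p k M)
    then show ?case
      using geom[OF vals[of p], of k] prime_gt_0_nat[of p]
      by (simp add: sum_divisors_mult_coprime[OF mult cop] pp)
  qed
  show "(\<Sum>d | d dvd N ^ 2. c d) \<ge> 1"
    using \<open>N > 0\<close>
  proof (induction N rule: prime_power_induct)
    case unit
    then show ?case using one by simp
  next
    case (step p k M)
    have "\<not> p dvd M ^ 2" using step prime_dvd_power by blast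
    then have "(\<Sum>d | d dvd p ^ (2 * k) * M ^ 2. c d) = (\<Sum>i\<le>2 * k. c p ^ i) * (\<Sum>d | d dvd M ^ 2. c d)"
      using step prime_gt_0_nat[of p] by (simp add: sum_divisors_mult_coprime[OF mult cop] pp)
    moreover have "(\<Sum>i\<le>2 * k. c p ^ i) * (\<Sum>d | d dvd M ^ 2. c d) \<ge> 1 * 1"
      using geom[OF vals[of p], of "2 * k"] step by (intro mult_mono) auto
    ultimately show ?case by (simp add: power_mult_distrib power_mult mult.commute[of 2])
  qed
qed

text \<open>Pairing \<open>t ^ i\<close> with \<open>t ^ (k - 1 - i)\<close>, the inequality of
  arithmetic and geometric means bounds a sum of \<open>k\<close> powers below by
  \<open>k * u ^ m\<close> with \<open>u = sqrt t\<close>; the square root shares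
  \<open>t ^ m\<close> evenly between the two factors.\<close>

lemma sum_power_ge:
  fixes t :: real
  assumes "0 \<le> t" "t \<le> 1"
  shows "(\<Sum>i<m. t ^ i) * (\<Sum>i<Suc m. t ^ i) \<ge> real m * real (Suc m) * t ^ m"
proof -
  define u where "u = sqrt t"
  have u: "t = u ^ 2" "0 \<le> u" "u \<le> 1" using assms by (auto simp: u_def)
  have ge: "(\<Sum>i<k. t ^ i) \<ge> real k * u ^ m" if "k \<le> Suc m" for k
  proof -
    have "2 * (\<Sum>i<k. t ^ i) = (\<Sum>i<k. t ^ i + t ^ (k - Suc i))"
      by (simp add: sum.distrib sum.nat_diff_reindex[of "\<lambda>i. t ^ i" k])
    also have "\<dots> \<ge> (\<Sum>i<k. 2 * u ^ m)"
    proof (rule sum_mono)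
      fix i assume i: "i \<in> {..<k}"
      have "u ^ m \<le> u ^ (k - 1)" using that u by (intro power_decreasing) auto
      also have "2 * \<dots> = 2 * u ^ i * u ^ (k - Suc i)" using i by (simp flip: power_add)
      also have "\<dots> \<le> (u ^ i)\<^sup>2 + (u ^ (k - Suc i))\<^sup>2" by (rule sum_squares_bound)
      finally show "2 * u ^ m \<le> t ^ i + t ^ (k - Suc i)"
        by (simp add: u(1) mult.commute flip: power_mult)
    qed
    finally show ?thesis by simp
  qed
  have "real m * real (Suc m) * t ^ m = (real m * u ^ m) * (real (Suc m) * u ^ m)"
    by (simp add: u(1) power_mult power2_eq_square mult_ac flip: power_mult_distrib)
  also have "\<dots> \<le> (\<Sum>i<m. t ^ i) * (\<Sum>i<Suc m. t ^ i)"
    using ge u by (intro mult_mono) (auto intro!: sum_nonneg simp: power_mult simp del: sum.lessThan_Suc of_nat_Suc)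
  finally show ?thesis .
qed

context
  fixes t :: real
  assumes t: "0 < t" "t < 1"
begin

text \<open>With \<open>1 - t ^ m = (1 - t) * G m\<close>, the quotient
  \<open>t ^ m / (1 - t ^ m)\<close> drops by \<open>t ^ m / ((1 - t) * (G m * G (Suc m)))\<close>
  and \<open>1 / (m * (1 - t))\<close> drops by \<open>1 / ((1 - t) * (m * Suc m))\<close>. The
  inequality \<open>sum_power_ge\<close> compares the two.\<close>

lemma monsky_weight_decreasing:
  assumes "m > 0"
  shows "1 / (real (Suc m) * (1 - t)) - t ^ Suc m / (1 - t ^ Suc m)
       \<le> 1 / (real m * (1 - t)) - t ^ m / (1 - t ^ m)"
proof -
  define G where "G k = (\<Sum>i<k. t ^ i)" for k
  have G: "1 - t ^ k = (1 - t) * G k" for k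
    by (simp add: one_diff_power_eq G_def)
  have Gpos: "G k > 0" if "k > 0" for k
    using that t unfolding G_def by (intro sum_pos) auto
  have ge: "G m * G (Suc m) \<ge> real m * real (Suc m) * t ^ m"
    using sum_power_ge[of t m] t unfolding G_def by simp
  have "t ^ m / (1 - t ^ m) - t ^ Suc m / (1 - t ^ Suc m)
      = (t ^ m - t ^ Suc m) / ((1 - t ^ m) * (1 - t ^ Suc m))"
  proof -
    have "x / (1 - x) - y / (1 - y) = (x - y) / ((1 - x) * (1 - y))" if "x < 1" "y < 1" for x y :: real
      using that by (simp add: field_simps)
    moreover have "t ^ m < 1" "t ^ Suc m < 1"
      using t assms by (auto simp: power_less_one_iff simp del: power_Suc)
    ultimately show ?thesis by blast
  qed
  also have "t ^ m - t ^ Suc m = (1 - t) * t ^ m" by (simp add: algebra_simps)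
  also have "(1 - t) * t ^ m / ((1 - t ^ m) * (1 - t ^ Suc m)) = t ^ m / ((1 - t) * (G m * G (Suc m)))"
  proof -
    have "x * y / ((x * a) * (x * b)) = y / (x * (a * b))" if "x \<noteq> 0" for x y a b :: real
      using that by (simp add: mult.left_commute[of _ x])
    then show ?thesis using t unfolding G by simp
  qed
  also have "\<dots> \<le> 1 / ((1 - t) * (real m * real (Suc m)))"
  proof -
    have "x / ((1 - t) * y) \<le> 1 / ((1 - t) * z)" if "z * x \<le> y" "y > 0" "z > 0" for x y z
    proof -
      have "x / y \<le> 1 / z" using that by (simp add: field_simps)
      then have "(x / y) / (1 - t) \<le> (1 / z) / (1 - t)" using t by (intro divide_right_mono) auto
      then show ?thesis by (simp add: mult.commute)
    qed
    then show ?thesis using ge Gpos[of m] Gpos[of "Suc m"] assms by simp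
  qed
  also have "\<dots> = 1 / (real m * (1 - t)) - 1 / (real (Suc m) * (1 - t))"
  proof -
    have "1 / (real m * real (Suc m)) = 1 / real m - 1 / real (Suc m)"
      using assms by (simp add: field_simps)
    then have "(1 / (real m * real (Suc m))) / (1 - t) = (1 / real m - 1 / real (Suc m)) / (1 - t)"
      by (rule arg_cong)
    then show ?thesis by (simp only: diff_divide_distrib divide_divide_eq_left) (simp only: mult.commute)
  qed
  finally show ?thesis by simp
qed

lemma monsky_weight_nonneg:
  assumes "m > 0"
  shows "0 \<le> 1 / (real m * (1 - t)) - t ^ m / (1 - t ^ m)"
proof -
  define G where "G = (\<Sum>i<m. t ^ i)"
  have G: "1 - t ^ m = (1 - t) * G"
    by (simp add: one_diff_power_eq G_def)
  have "(\<Sum>i<m. t ^ m) \<le> G"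
    unfolding G_def using t by (intro sum_mono power_decreasing) auto
  then have "real m * t ^ m \<le> G" by simp
  moreover have "G > 0" using assms t unfolding G_def by (intro sum_pos) auto
  ultimately have "t ^ m / G \<le> 1 / real m" using assms by (simp add: field_simps)
  then have "(t ^ m / G) / (1 - t) \<le> (1 / real m) / (1 - t)" using t by (intro divide_right_mono) auto
  then show ?thesis unfolding G by (simp add: mult.commute)
qed

lemma lambert_term_le:
  "t ^ m / (1 - t ^ m) \<le> t ^ m / (1 - t)" "0 \<le> t ^ m / (1 - t ^ m)"
proof -
  have "t ^ m \<le> t" if "m > 0" using that t power_decreasing[of 1 m t] by simp
  \<comment> \<open>At \<open>m = 0\<close> the left side is a division by 0, hence 0.\<close>
  then show "t ^ m / (1 - t ^ m) \<le> t ^ m / (1 - t)"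
    using t by (cases "m = 0") (auto intro!: divide_left_mono mult_pos_pos simp: power_less_one_iff)
  show "0 \<le> t ^ m / (1 - t ^ m)"
    using t by (auto intro!: divide_nonneg_nonneg power_le_one)
qed

text \<open>Each \<open>t ^ d / (1 - t ^ d)\<close> is the geometric series of
  \<open>t ^ (d * k)\<close> over \<open>k > 0\<close>; collecting equal exponents leaves divisor
  sums as coefficients.\<close>

lemma has_sum_lambert:
  fixes c :: "nat \<Rightarrow> real"
  assumes c: "\<And>m. \<bar>c m\<bar> \<le> 1"
  shows "summable (\<lambda>m. c m * (t ^ m / (1 - t ^ m)))"
    and "((\<lambda>N. (\<Sum>d | d dvd N. c d) * t ^ N) has_sum (\<Sum>m. c m * (t ^ m / (1 - t ^ m)))) {0<..}"
proof -
  define g where "g m = c m * (t ^ m / (1 - t ^ m))" for m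
  have "summable (\<lambda>m. t ^ m / (1 - t))" using t by (intro summable_divide summable_geometric) auto
  then have sm1: "summable (\<lambda>m. t ^ m / (1 - t ^ m))"
    by (rule summable_comparison_test'[where N = 0])
       (simp only: real_norm_def abs_of_nonneg lambert_term_le)
  have gn: "summable (\<lambda>m. norm (g m))"
  proof (rule summable_comparison_test'[OF sm1, of 0])
    show "norm (norm (g m)) \<le> t ^ m / (1 - t ^ m)" for m
    proof -
      have "norm (norm (g m)) = \<bar>c m\<bar> * (t ^ m / (1 - t ^ m))"
        by (simp only: g_def real_norm_def abs_abs abs_mult abs_of_nonneg[OF lambert_term_le(2)])
      also have "\<dots> \<le> 1 * (t ^ m / (1 - t ^ m))"
        by (intro mult_right_mono c lambert_term_le)
      finally show ?thesis by simp
    qed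
  qed
  then show sg: "summable (\<lambda>m. c m * (t ^ m / (1 - t ^ m)))"
    unfolding g_def[symmetric] by (rule summable_norm_cancel)
  have geo: "((\<lambda>k. t ^ (d * k)) has_sum t ^ d / (1 - t ^ d)) {0<..}" if "d > 0" for d
  proof -
    have td: "0 < t ^ d" "t ^ d < 1" using t that by (auto simp: power_less_one_iff)
    have "(\<lambda>k. (t ^ d) ^ k) sums (1 / (1 - t ^ d))" using td by (intro geometric_sums) auto
    then have "((\<lambda>k. (t ^ d) ^ k) has_sum (1 / (1 - t ^ d))) UNIV"
      using td by (intro sums_nonneg_imp_has_sum) auto
    then have "((\<lambda>k. (t ^ d) ^ k) has_sum (1 / (1 - t ^ d) - (\<Sum>k\<in>{0}. (t ^ d) ^ k))) (UNIV - {0})"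
      by (intro has_sum_Diff has_sum_finite) auto
    moreover have "UNIV - {0 :: nat} = {0<..}" by auto
    moreover have "1 / (1 - t ^ d) - (\<Sum>k\<in>{0}. (t ^ d) ^ k) = t ^ d / (1 - t ^ d)"
      using td by (simp add: field_simps)
    ultimately show ?thesis by (simp add: power_mult)
  qed
  have "((\<lambda>N. \<Sum>d | d dvd N. c d * t ^ (d * (N div d))) has_sum (\<Sum>m. g m)) {0<..}"
  proof (rule has_sum_divisors)
    have "(\<lambda>(d, k). t ^ (d * k)) summable_on {0<..} \<times> {0<..}"
    proof (rule summable_on_SigmaI)
      show "((\<lambda>k. case (d, k) of (d, k) \<Rightarrow> t ^ (d * k)) has_sum t ^ d / (1 - t ^ d)) {0<..}"
        if "d \<in> {0<..}" for d using geo[of d] that by simp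
      have "((\<lambda>m. t ^ m / (1 - t ^ m)) has_sum (\<Sum>m. t ^ m / (1 - t ^ m))) {0<..}"
        using sm1 lambert_term_le(2)
        by (subst has_sum_positive_iff) (auto intro!: sums_nonneg_imp_has_sum summable_sums)
      then show "(\<lambda>d. t ^ d / (1 - t ^ d)) summable_on {0<..}" by (auto simp: summable_on_def)
    qed (use t in auto)
    then have "(\<lambda>x. norm (case x of (d, k) \<Rightarrow> c d * t ^ (d * k))) summable_on {0<..} \<times> {0<..}"
      by (rule Infinite_Sum.abs_summable_on_comparison_test')
         (use t c in \<open>auto simp: abs_mult intro!: mult_left_le_one_le\<close>)
    then show "(\<lambda>(d, k). c d * t ^ (d * k)) summable_on {0<..} \<times> {0<..}"
      by (rule abs_summable_summable)
    show "((\<lambda>k. c d * t ^ (d * k)) has_sum g d) {0<..}" if "d > 0" for d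
      unfolding g_def by (intro has_sum_cmult_right geo that)
    show "(g has_sum (\<Sum>m. g m)) {0<..}"
    proof (subst has_sum_positive_iff)
      show "g 0 = 0" by (simp add: g_def)
      show "(g has_sum (\<Sum>m. g m)) UNIV"
        by (rule norm_summable_imp_has_sum[OF gn summable_sums[OF summable_norm_cancel[OF gn]]])
    qed
  qed
  also have "?this \<longleftrightarrow> ((\<lambda>N. (\<Sum>d | d dvd N. c d) * t ^ N) has_sum (\<Sum>m. g m)) {0<..}"
    by (intro has_sum_cong) (auto simp: sum_distrib_right intro!: sum.cong)
  finally show "((\<lambda>N. (\<Sum>d | d dvd N. c d) * t ^ N) has_sum (\<Sum>m. c m * (t ^ m / (1 - t ^ m)))) {0<..}"
    by (simp add: g_def)
qed

end

text \<open>If the series \<open>\<Sum> c m / m\<close> vanished, the Lambert series \<open>\<Sum> c m t^m / (1 - t^m)\<close> would stay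
  bounded as \<open>t\<close> tends to 1 by Abel summation, although its power series coefficients are
  nonnegative and at least 1 at the squares (Monsky).\<close>

lemma real_char_sum_nonzero:
  fixes c :: "nat \<Rightarrow> real"
  assumes mult: "\<And>a b. c (a * b) = c a * c b" and one: "c 1 = 1" and vals: "\<And>a. c a \<in> {-1, 0, 1}"
    and C: "\<And>M. \<bar>\<Sum>m<M. c m\<bar> \<le> C"
  shows "(\<Sum>m. real m powr - 1 *\<^sub>R c m) \<noteq> 0"
proof
  assume zero: "(\<Sum>m. real m powr - 1 *\<^sub>R c m) = 0"
  have "summable (\<lambda>m. real m powr - 1 *\<^sub>R c m)"
    using dirichlet_series_summable[of c C 1] C by simp
  with zero have sums0: "(\<lambda>m. real m powr - 1 * c m) sums 0" by (simp add: sums_iff)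
  have c1: "\<bar>c m\<bar> \<le> 1" for m using vals[of m] by auto
  have le: "(\<Sum>k=1..K. t ^ (k ^ 2)) \<le> 2 * C" if t: "0 < t" "t < 1" for t :: real and K
  proof -
    define b where "b m = 1 / (real m * (1 - t)) - t ^ m / (1 - t ^ m)" for m
    define g where "g m = c m * (t ^ m / (1 - t ^ m))" for m
    have bd: "\<bar>\<Sum>m=1..<M. b m *\<^sub>R c m\<bar> \<le> 2 * C" for M
    proof -
      have "norm (\<Sum>m=1..<M. b m *\<^sub>R c m) \<le> 2 * C * b 1"
        unfolding b_def
        using C monsky_weight_decreasing[OF t] monsky_weight_nonneg[OF t] by (intro norm_abel_sum_le) auto
      \<comment> \<open>The first weight does not depend on \<open>t\<close>, so the bound
        \<open>2 * C\<close> survives the passage of \<open>t\<close> to 1.\<close>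
      also have "b 1 = 1" using t by (simp add: b_def field_simps)
      finally show ?thesis by simp
    qed
    \<comment> \<open>The first half of the weights reproduces the series assumed to vanish, so in
      the limit only the Lambert series is left.\<close>
    have b_sum: "(\<Sum>m=1..<M. b m *\<^sub>R c m)
        = inverse (1 - t) * (\<Sum>m<M. real m powr - 1 * c m) - (\<Sum>m<M. g m)" for M
    proof -
      have "(\<Sum>m=1..<M. b m *\<^sub>R c m) = (\<Sum>m<M. b m *\<^sub>R c m)"
        by (rule sum.mono_neutral_left) (auto simp: b_def not_le)
      also have "\<dots> = (\<Sum>m<M. inverse (1 - t) * (real m powr - 1 * c m) - g m)"
        by (intro sum.cong) (auto simp: b_def g_def powr_minus field_simps)
      finally show ?thesis by (simp add: sum_subtractf sum_distrib_left)
    qed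
    have sg: "summable g" unfolding g_def using c1 by (intro has_sum_lambert(1) t)
    have "(\<lambda>M. \<Sum>m=1..<M. b m *\<^sub>R c m) \<longlonglongrightarrow> inverse (1 - t) * 0 - suminf g"
      unfolding b_sum using sums0 summable_LIMSEQ[OF sg] by (intro tendsto_intros) (auto simp: sums_def)
    then have "\<bar>inverse (1 - t) * 0 - suminf g\<bar> \<le> 2 * C"
      by (intro tendsto_upperbound[OF tendsto_rabs]) (use bd in auto)
    then have "suminf g \<le> 2 * C" by simp
    moreover have "(\<Sum>k=1..K. t ^ (k ^ 2)) \<le> suminf g"
    proof -
      have "(\<Sum>k=1..K. t ^ (k ^ 2)) = (\<Sum>N\<in>(\<lambda>k. k ^ 2) ` {1..K}. t ^ N)"
        by (subst sum.reindex) (auto simp: inj_on_def)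
      also have "\<dots> \<le> (\<Sum>N\<in>(\<lambda>k. k ^ 2) ` {1..K}. (\<Sum>d | d dvd N. c d) * t ^ N)"
        using t sum_real_char_divisors(2)[OF mult one vals] by (intro sum_mono) auto
      also have "\<dots> \<le> suminf g"
        unfolding g_def
        by (rule finite_sum_le_has_sum[OF has_sum_lambert(2)[OF t c1]])
           (use t sum_real_char_divisors(1)[OF mult one vals] in auto)
      finally show ?thesis .
    qed
    ultimately show ?thesis by simp
  qed
  \<comment> \<open>As \<open>t\<close> tends to 1 from below, each of the \<open>K\<close> squares
    contributes 1.\<close>
  have "real K \<le> 2 * C" for K
  proof -
    have "((\<lambda>t. \<Sum>k=1..K. t ^ (k ^ 2)) \<longlongrightarrow> (\<Sum>k=1..K. 1 ^ (k ^ 2))) (at_left (1::real))"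
      by (intro tendsto_intros)
    moreover have "eventually (\<lambda>t::real. t \<in> {0<..<1}) (at_left 1)"
      by (rule eventually_at_left_real) auto
    then have "eventually (\<lambda>t::real. (\<Sum>k=1..K. t ^ (k ^ 2)) \<le> 2 * C) (at_left 1)"
      by eventually_elim (use le in auto)
    ultimately have "(\<Sum>k=1..K. 1 ^ (k ^ 2)) \<le> 2 * C"
      by (rule tendsto_upperbound) auto
    then show ?thesis by simp
  qed
  then show False using reals_Archimedean2[of "2 * C"] by (meson not_le)
qed

lemma dirichlet_L_one_nonzero_real:
  assumes \<psi>: "\<psi> \<in> dirichlet_chars n" "n > 0" "\<psi> \<noteq> principal_char n" and real: "\<And>a. cnj (\<psi> a) = \<psi> a"
  shows "dirichlet_L \<psi> 1 \<noteq> 0"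
proof -
  define c where "c m = Re (\<psi> m)" for m
  have c: "\<psi> m = of_real (c m)" for m
    using real[of m] by (auto simp: c_def complex_eq_iff)
  have "(\<Sum>m. real m powr - 1 *\<^sub>R c m) \<noteq> 0"
  proof (rule real_char_sum_nonzero)
    show "c (a * b) = c a * c b" for a b
      using dirichlet_chars_mult[OF \<psi>(1), of a b] by (simp add: c flip: of_real_mult)
    show "c 1 = 1" using dirichlet_chars_one[OF \<psi>(1)] by (simp add: c)
    show "c a \<in> {-1, 0, 1}" for a
      using norm_dirichlet_chars[OF \<psi>(1,2), of a] by (auto simp: c of_bool_def split: if_splits)
    show "\<bar>\<Sum>m<M. c m\<bar> \<le> real n" for M
      using norm_sum_nonprincipal_char_le[OF \<psi>, of M] by (simp add: c flip: of_real_sum)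
  qed
  moreover have "dirichlet_L \<psi> 1 = of_real (\<Sum>m. real m powr - 1 *\<^sub>R c m)"
  proof -
    have "summable (\<lambda>m. real m powr - 1 *\<^sub>R c m)"
      using norm_sum_nonprincipal_char_le[OF \<psi>]
      by (intro dirichlet_series_summable[of _ "real n"]) (auto simp: c simp flip: of_real_sum)
    then show ?thesis
      by (simp add: dirichlet_L_def c scaleR_conv_of_real suminf_of_real)
  qed
  ultimately show ?thesis by simp
qed

section \<open>Nonvanishing for nonreal characters\<close>

lemma norm_dirichlet_L_le:
  assumes c: "\<And>m. norm (c m) \<le> 1" and s: "s > 1"
  shows "norm (dirichlet_L c s) \<le> s / (s - 1)"
proof -
  have bd: "(\<Sum>m<M. norm (real m powr - s *\<^sub>R c m)) \<le> s / (s - 1)" for M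
  proof -
    have "(\<Sum>m<M. norm (real m powr - s *\<^sub>R c m)) \<le> (\<Sum>m<M + 2. real m powr - s)"
    proof (rule order_trans[OF sum_mono sum_mono2])
      show "norm (real m powr - s *\<^sub>R c m) \<le> real m powr - s" for m
        using c[of m] by (auto intro: mult_left_le)
    qed auto
    \<comment> \<open>Comparison with the integral of \<open>x powr - s\<close> from 1 to
      \<open>M + 1\<close>, one mean value step per term. Of the \<open>M + 2\<close> terms, index 0
      gives 0 and index 1 the leading 1. The final bound has the expected simple pole at 1.\<close>
    also have "(\<Sum>m<M + 2. real m powr - s) \<le> 1 + (1 - real (M + 1) powr (1 - s)) / (s - 1)"
    proof (induction M)
      case (Suc M)
      define x where "x = real (M + 1)"
      have x: "x > 0" by (simp add: x_def)
      have "\<exists>z>x. z < x + 1 \<and> - ((x + 1) powr (1 - s)) / (s - 1) - - (x powr (1 - s)) / (s - 1)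
          = (x + 1 - x) * z powr - s"
      proof (rule MVT2)
        show "((\<lambda>z. - (z powr (1 - s)) / (s - 1)) has_real_derivative z powr - s) (at z)"
          if "x \<le> z" "z \<le> x + 1" for z
        proof -
          from that have "((\<lambda>z. - (z powr (1 - s)) / (s - 1)) has_real_derivative
              - ((1 - s) * z powr (1 - s - 1)) / (s - 1)) (at z)"
            using x by (intro DERIV_cdivide DERIV_minus has_real_derivative_powr) auto
          also have "- ((1 - s) * z powr (1 - s - 1)) / (s - 1) = z powr - s"
            using s by (simp add: field_simps)
          finally show ?thesis .
        qed
      qed auto
      then obtain z where z: "x < z" "z < x + 1"
        "- ((x + 1) powr (1 - s)) / (s - 1) - - (x powr (1 - s)) / (s - 1) = z powr - s" by auto
      have "(x + 1) powr - s \<le> z powr - s" using z x s by (intro powr_mono2') auto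
      then have "(x + 1) powr - s \<le> (1 - (x + 1) powr (1 - s)) / (s - 1) - (1 - x powr (1 - s)) / (s - 1)"
        using z(3) by (simp add: diff_divide_distrib)
      then show ?case using Suc.IH by (simp add: x_def add_ac)
    qed auto
    also have "\<dots> \<le> 1 + 1 / (s - 1)" using s by (intro add_left_mono divide_right_mono) auto
    also have "\<dots> = s / (s - 1)" using s by (simp add: field_simps)
    finally show ?thesis .
  qed
  have sm: "summable (\<lambda>m. norm (real m powr - s *\<^sub>R c m))"
    by (rule has_sum_dirichlet_L(1)[OF c s])
  have "norm (dirichlet_L c s) \<le> (\<Sum>m. norm (real m powr - s *\<^sub>R c m))"
    unfolding dirichlet_L_def by (rule summable_norm[OF sm])
  also have "\<dots> \<le> s / (s - 1)" by (rule suminf_le_const[OF sm bd])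
  finally show ?thesis .
qed

text \<open>The starting point for the monotonicity of the product of all L-series. At 4 the first
  term outweighs the tail: \<open>m powr - 4\<close> is at most a quarter of
  \<open>1 / m ^ 2\<close> for \<open>m \<ge> 2\<close>, and \<open>(pi ^ 2 / 6 - 1) / 4 < 1\<close>
  follows already from \<open>pi < 4\<close>.\<close>

lemma dirichlet_L_4_nonzero:
  assumes c: "\<And>m. norm (c m) \<le> 1" and one: "c 1 = 1"
  shows "dirichlet_L c 4 \<noteq> 0"
proof
  assume zero: "dirichlet_L c 4 = 0"
  define f where "f m = real m powr - 4 *\<^sub>R c m" for m
  have sm: "summable (\<lambda>m. norm (f m))"
    unfolding f_def using has_sum_dirichlet_L(1)[OF c, of 4] by simp
  have "suminf f = 0" using zero by (simp add: dirichlet_L_def f_def[abs_def])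
  then have "(\<Sum>m. f (m + 2)) = - (\<Sum>m<2. f m)"
    using suminf_split_initial_segment[OF summable_norm_cancel[OF sm], of 2] by (simp add: eq_neg_iff_add_eq_0)
  also have "(\<Sum>m<2. f m) = 1" using one by (simp add: f_def numeral_2_eq_2)
  finally have "norm (\<Sum>m. f (m + 2)) = 1" by simp
  moreover have "norm (\<Sum>m. f (m + 2)) \<le> (\<Sum>m. norm (f (m + 2)))"
    by (rule summable_norm) (subst summable_iff_shift, rule sm)
  moreover have "(\<Sum>m. norm (f (m + 2))) \<le> (\<Sum>m. 1 / 4 * (1 / real (m + 2) ^ 2))"
  proof (rule suminf_le)
    fix m
    have "norm (f (m + 2)) \<le> real (m + 2) powr - 4"
      using c[of "m + 2"] unfolding f_def by (auto intro: mult_left_le)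
    also have "\<dots> = 1 / real (m + 2) ^ 2 * (1 / real (m + 2) ^ 2)"
      by (simp add: powr_minus powr_numeral field_simps del: of_nat_add flip: power_add)
    also have "\<dots> \<le> 1 / 4 * (1 / real (m + 2) ^ 2)"
    proof (rule mult_right_mono)
      have "(2::real) ^ 2 \<le> real (m + 2) ^ 2" by (intro power_mono) auto
      then show "1 / real (m + 2) ^ 2 \<le> 1 / 4" by (intro divide_left_mono) auto
    qed auto
    finally show "norm (f (m + 2)) \<le> 1 / 4 * (1 / real (m + 2) ^ 2)" .
  next
    show "summable (\<lambda>m. norm (f (m + 2)))" using sm by (subst summable_iff_shift)
    have "summable (\<lambda>m. 1 / real (m + 1) ^ 2)"
      using inverse_squares_sums by (simp add: sums_iff)
    then have "summable (\<lambda>m. 1 / real ((m + 1) + 1) ^ 2)" by (subst summable_iff_shift)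
    then show "summable (\<lambda>m. 1 / 4 * (1 / real (m + 2) ^ 2))" by (intro summable_mult) (simp add: add_ac)
  qed
  moreover have "(\<Sum>m. 1 / 4 * (1 / real (m + 2) ^ 2)) = 1 / 4 * (pi ^ 2 / 6 - 1)"
  proof -
    have "(\<lambda>m. 1 / real (m + 1 + 1) ^ 2) sums (pi ^ 2 / 6 - (\<Sum>i<1. 1 / real (i + 1) ^ 2))"
      by (rule sums_split_initial_segment) (use inverse_squares_sums in simp)
    then have "(\<lambda>m. 1 / 4 * (1 / real (m + 2) ^ 2)) sums (1 / 4 * (pi ^ 2 / 6 - 1))"
      by (intro sums_mult) (simp add: add_ac)
    then show ?thesis by (simp add: sums_iff)
  qed
  moreover have "pi ^ 2 \<le> 4 ^ 2" using pi_less_4 by (intro power_mono) auto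
  ultimately show False by simp
qed

lemma nonprincipal_L_deriv:
  assumes "\<psi> \<in> dirichlet_chars n" "n > 0" "\<psi> \<noteq> principal_char n" "s > 0"
  shows "(dirichlet_L \<psi> has_vector_derivative dirichlet_L' \<psi> s) (at s)"
  unfolding dirichlet_L_def[abs_def] dirichlet_L'_def
  using norm_sum_nonprincipal_char_le[OF assms(1-3)] assms(4) by (rule dirichlet_series_deriv(2))

text \<open>Orthogonality applied to each term singles out the class of \<open>a\<close>. The class
  of 1 gives the positivity behind nonvanishing, a general class the theorem on primes.\<close>

lemma sum_cnj_dirichlet_mangoldt:
  assumes n: "squarefree n" "coprime a n" and s: "s > 1"
  shows "((\<lambda>m. mangoldt m * real m powr - s * of_bool ([m = a] (mod n)) * real (card (dirichlet_chars n)))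
           has_sum (\<Sum>\<psi>\<in>dirichlet_chars n. Re (cnj (\<psi> a) * dirichlet_mangoldt \<psi> s))) UNIV"
proof -
  have n0: "n > 0" using n by (intro Nat.gr0I) auto
  have has_sum_sum: "((\<lambda>x. \<Sum>i\<in>I. f i x) has_sum (\<Sum>i\<in>I. S i)) UNIV"
    if "\<And>i. i \<in> I \<Longrightarrow> (f i has_sum S i) UNIV"
    for I :: "(nat \<Rightarrow> complex) set" and f :: "_ \<Rightarrow> nat \<Rightarrow> real" and S
    using that by (induction I rule: infinite_finite_induct) (auto intro!: has_sum_add)
  have "((\<lambda>m. \<Sum>\<psi>\<in>dirichlet_chars n. Re (cnj (\<psi> a) * ((mangoldt m * real m powr - s) *\<^sub>R \<psi> m)))
      has_sum (\<Sum>\<psi>\<in>dirichlet_chars n. Re (cnj (\<psi> a) * dirichlet_mangoldt \<psi> s))) UNIV"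
    by (intro has_sum_sum has_sum_Re has_sum_cmult_right has_sum_dirichlet_mangoldt
          norm_dirichlet_chars_le[OF _ n0] s)
  also have "(\<lambda>m. \<Sum>\<psi>\<in>dirichlet_chars n. Re (cnj (\<psi> a) * ((mangoldt m * real m powr - s) *\<^sub>R \<psi> m)))
      = (\<lambda>m. mangoldt m * real m powr - s * of_bool ([m = a] (mod n)) * real (card (dirichlet_chars n)))"
  proof
    fix m
    have "(\<Sum>\<psi>\<in>dirichlet_chars n. Re (cnj (\<psi> a) * ((mangoldt m * real m powr - s) *\<^sub>R \<psi> m)))
        = mangoldt m * real m powr - s * Re (\<Sum>\<psi>\<in>dirichlet_chars n. cnj (\<psi> a) * \<psi> m)"
      by (simp add: sum_distrib_left)
    then show "(\<Sum>\<psi>\<in>dirichlet_chars n. Re (cnj (\<psi> a) * ((mangoldt m * real m powr - s) *\<^sub>R \<psi> m)))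
        = mangoldt m * real m powr - s * of_bool ([m = a] (mod n)) * real (card (dirichlet_chars n))"
      by (simp only: sum_cnj_dirichlet_chars[OF n]) simp
  qed
  finally show ?thesis .
qed

text \<open>Logarithmic differentiation without quotients, so that factors may vanish.\<close>

lemma has_real_derivative_prod_logarithmic:
  fixes f :: "'i \<Rightarrow> real \<Rightarrow> real"
  assumes "\<And>i. i \<in> I \<Longrightarrow> (f i has_real_derivative f i x * g i) (at x)"
  shows "((\<lambda>x. \<Prod>i\<in>I. f i x) has_real_derivative (\<Prod>i\<in>I. f i x) * (\<Sum>i\<in>I. g i)) (at x)"
  using assms
proof (induction I rule: infinite_finite_induct)
  case (insert i I)
  have "((\<lambda>x. f i x * (\<Prod>i\<in>I. f i x)) has_real_derivative
      f i x * g i * (\<Prod>i\<in>I. f i x) + (\<Prod>i\<in>I. f i x) * (\<Sum>i\<in>I. g i) * f i x) (at x)"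
    by (intro DERIV_mult insert) (use insert.prems in auto)
  then show ?case using insert.hyps by (simp add: algebra_simps)
qed auto

text \<open>The squared modulus is differentiable even at zeros, and inserting
  \<open>dirichlet_L_log_deriv\<close> into the derivative of the inner product turns the complex
  relation into a real linear differential equation.\<close>

lemma dirichlet_L_norm_deriv:
  assumes "\<And>a b. c (a * b) = c a * c b" "\<And>m. norm (c m) \<le> 1" "s > 1"
  shows "((\<lambda>s. (norm (dirichlet_L c s))\<^sup>2) has_real_derivative
           (norm (dirichlet_L c s))\<^sup>2 * (- 2 * Re (dirichlet_mangoldt c s))) (at s)"
proof -
  have "((\<lambda>s. dirichlet_L c s \<bullet> dirichlet_L c s) has_vector_derivative
      dirichlet_L c s \<bullet> dirichlet_L' c s + dirichlet_L' c s \<bullet> dirichlet_L c s) (at s)"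
    using dirichlet_L_deriv_gt_1[of c s] assms(2,3)
    by (intro bounded_bilinear.has_vector_derivative[OF bounded_bilinear_inner]) auto
  moreover have "dirichlet_L c s \<bullet> dirichlet_L' c s + dirichlet_L' c s \<bullet> dirichlet_L c s
      = (norm (dirichlet_L c s))\<^sup>2 * (- 2 * Re (dirichlet_mangoldt c s))"
    unfolding dirichlet_L_log_deriv[OF assms] inner_complex_def cmod_power2
    by (simp add: power2_eq_square algebra_simps)
  ultimately show ?thesis
    by (simp add: has_real_derivative_iff_has_vector_derivative power2_norm_eq_inner)
qed

lemma has_vector_derivative_zero_bound:
  fixes f :: "real \<Rightarrow> 'a :: real_normed_vector"
  assumes "(f has_vector_derivative D) (at x)" "f x = 0"
  shows "\<forall>\<^sub>F y in at x. norm (f y) \<le> (1 + norm D) * \<bar>y - x\<bar>"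
proof -
  have "((\<lambda>y. norm (f y - f x - (y - x) *\<^sub>R D) / norm (y - x)) \<longlongrightarrow> 0) (at x)"
    using assms(1) by (simp add: has_vector_derivative_def has_derivative_iff_norm)
  then have "\<forall>\<^sub>F y in at x. norm (f y - f x - (y - x) *\<^sub>R D) / norm (y - x) < 1"
    by (rule order_tendstoD) auto
  then show ?thesis
    using eventually_neq_at_within[of x x UNIV]
  proof eventually_elim
    case (elim y)
    then have "norm (f y - (y - x) *\<^sub>R D) \<le> \<bar>y - x\<bar>" using assms(2) by (simp add: field_simps)
    then have "norm (f y) \<le> norm ((y - x) *\<^sub>R D) + \<bar>y - x\<bar>"
      by (rule order_trans[OF norm_triangle_sub add_left_mono])
    also have "\<dots> = (1 + norm D) * \<bar>y - x\<bar>" by (simp add: distrib_right)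
    finally show ?case .
  qed
qed

lemma dirichlet_L_cnj:
  assumes "\<And>m. norm (c m) \<le> 1" "s > 1"
  shows "dirichlet_L (\<lambda>m. cnj (c m)) s = cnj (dirichlet_L c s)"
proof -
  have "(\<lambda>m. real m powr - s *\<^sub>R c m) sums dirichlet_L c s"
    using has_sum_dirichlet_L(2)[OF assms] by (rule has_sum_imp_sums)
  then have "(\<lambda>m. cnj (real m powr - s *\<^sub>R c m)) sums cnj (dirichlet_L c s)"
    by (simp only: sums_cnj)
  then show ?thesis by (simp add: dirichlet_L_def sums_iff)
qed

lemma sum_Re_dirichlet_mangoldt_nonneg:
  assumes "squarefree n" "s > 1"
  shows "(\<Sum>\<psi>\<in>dirichlet_chars n. Re (dirichlet_mangoldt \<psi> s)) \<ge> 0"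
proof -
  have "(\<Sum>\<psi>\<in>dirichlet_chars n. Re (cnj (\<psi> 1) * dirichlet_mangoldt \<psi> s)) \<ge> 0"
    using sum_cnj_dirichlet_mangoldt[OF assms(1) coprime_1_left assms(2)]
    by (rule has_sum_nonneg) (simp add: mangoldt_nonneg)
  then show ?thesis by (simp add: dirichlet_chars_one)
qed

text \<open>By the positivity of the sum of the logarithmic derivatives, the product of all
  \<open>|L(s)|\<^sup>2\<close> decreases for \<open>s > 1\<close>, so it cannot tend to 0 as \<open>s\<close> tends to 1. Two zeros at 1, from a
  nonreal character and its conjugate, would outweigh the simple pole of the principal factor.\<close>

lemma dirichlet_L_one_nonzero:
  assumes sq: "squarefree n" and \<psi>: "\<psi> \<in> dirichlet_chars n" "\<psi> \<noteq> principal_char n"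
  shows "dirichlet_L \<psi> 1 \<noteq> 0"
proof (cases "\<forall>a. cnj (\<psi> a) = \<psi> a")
  case True
  have "n > 0" using sq by (intro Nat.gr0I) auto
  with True \<psi> show ?thesis by (intro dirichlet_L_one_nonzero_real[of \<psi> n]) auto
next
  case False
  have n: "n > 0" using sq by (intro Nat.gr0I) auto
  define X where "X = dirichlet_chars n"
  define \<eta> where "\<eta> = (\<lambda>a. cnj (\<psi> a))"
  define \<tau> where "\<tau> = principal_char n"
  have finX: "finite X" by (simp add: X_def finite_dirichlet_chars n)
  have inX: "\<psi> \<in> X" "\<eta> \<in> X" "\<tau> \<in> X"
    using \<psi> by (auto simp: X_def \<eta>_def \<tau>_def dirichlet_chars_cnj principal_char_in)
  have neq: "\<eta> \<noteq> \<psi>" "\<psi> \<noteq> \<tau>" "\<eta> \<noteq> \<tau>"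
  proof -
    show "\<eta> \<noteq> \<psi>" using False by (auto simp: \<eta>_def fun_eq_iff)
    show "\<psi> \<noteq> \<tau>" using \<psi> by (simp add: \<tau>_def)
    show "\<eta> \<noteq> \<tau>"
    proof
      assume "\<eta> = \<tau>"
      then have "cnj (\<psi> a) = \<tau> a" for a by (metis \<eta>_def)
      then have "\<psi> a = cnj (\<tau> a)" for a by (metis complex_cnj_cnj)
      then have "\<psi> = \<tau>" by (auto simp: \<tau>_def principal_char_def fun_eq_iff)
      with \<psi> show False by (simp add: \<tau>_def)
    qed
  qed
  have le1: "norm (\<psi> m) \<le> 1" if "\<psi> \<in> X" for \<psi> m
    using that norm_dirichlet_chars_le n by (auto simp: X_def)
  show ?thesis
  proof
    assume zero: "dirichlet_L \<psi> 1 = 0"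
    define u where "u \<psi> s = (norm (dirichlet_L \<psi> s))\<^sup>2" for \<psi> s
    define Q where "Q s = (\<Prod>\<psi>\<in>X. u \<psi> s)" for s
    have dQ: "(Q has_real_derivative Q s * (\<Sum>\<psi>\<in>X. - 2 * Re (dirichlet_mangoldt \<psi> s))) (at s)"
      if "s > 1" for s
      unfolding Q_def[abs_def] u_def
      using that le1 dirichlet_chars_mult
      by (intro has_real_derivative_prod_logarithmic dirichlet_L_norm_deriv) (auto simp: X_def)
    have Q_ge: "Q 4 \<le> Q s" if "1 < s" "s \<le> 4" for s
    proof (rule DERIV_nonpos_imp_nonincreasing[OF that(2)])
      fix x assume x: "s \<le> x" "x \<le> 4"
      have "(\<Sum>\<psi>\<in>X. - 2 * Re (dirichlet_mangoldt \<psi> x)) \<le> 0"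
        using sum_Re_dirichlet_mangoldt_nonneg[OF sq, of x] x that
        by (simp add: X_def sum_negf flip: sum_distrib_left)
      moreover have "Q x \<ge> 0" by (auto simp: Q_def u_def intro: prod_nonneg)
      ultimately have "Q x * (\<Sum>\<psi>\<in>X. - 2 * Re (dirichlet_mangoldt \<psi> x)) \<le> 0"
        by (rule mult_nonneg_nonpos[rotated])
      then show "\<exists>y. (Q has_real_derivative y) (at x) \<and> y \<le> 0"
        using dQ[of x] x that by (intro exI conjI) auto
    qed
    have Q4: "Q 4 > 0"
      unfolding Q_def
    proof (rule prod_pos)
      fix \<psi> assume "\<psi> \<in> X"
      then have "dirichlet_L \<psi> 4 \<noteq> 0"
        using le1 dirichlet_chars_one by (intro dirichlet_L_4_nonzero) (auto simp: X_def)
      then show "u \<psi> 4 > 0" by (simp add: u_def)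
    qed
    define Y where "Y = X - {\<tau>, \<psi>, \<eta>}"
    have Q_eq: "Q s = u \<tau> s * u \<psi> s * u \<eta> s * (\<Prod>\<psi>\<in>Y. u \<psi> s)" for s
    proof -
      have "Q s = (\<Prod>\<psi>\<in>{\<tau>, \<psi>, \<eta>}. u \<psi> s) * (\<Prod>\<psi>\<in>Y. u \<psi> s)"
        unfolding Q_def Y_def using inX finX by (subst mult.commute, intro prod.subset_diff) auto
      then show ?thesis using neq by (simp add: mult.assoc)
    qed
    obtain K where K: "\<forall>\<^sub>F s in at 1. norm (dirichlet_L \<psi> s) \<le> K * \<bar>s - 1\<bar>"
      using has_vector_derivative_zero_bound[OF nonprincipal_L_deriv[OF \<psi>(1) n \<psi>(2)] zero] by auto
    have contY: "((\<lambda>s. u \<phi> s) \<longlongrightarrow> u \<phi> 1) (at_right 1)" if "\<phi> \<in> Y" for \<phi>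
    proof -
      have "(dirichlet_L \<phi> has_vector_derivative dirichlet_L' \<phi> 1) (at 1)"
        using that by (intro nonprincipal_L_deriv[OF _ n]) (auto simp: Y_def X_def \<tau>_def)
      then have "isCont (dirichlet_L \<phi>) 1" by (rule has_vector_derivative_continuous)
      then have "(dirichlet_L \<phi> \<longlongrightarrow> dirichlet_L \<phi> 1) (at_right 1)"
        unfolding isCont_def by (rule filterlim_at_split[THEN iffD1, THEN conjunct2])
      then show ?thesis unfolding u_def by (intro tendsto_intros)
    qed
    \<comment> \<open>For the squared moduli the pole costs at most
      \<open>(s / (s - 1))\<^sup>2\<close>, while each of the two zeros gains
      \<open>(K * (s - 1))\<^sup>2\<close>; a factor \<open>(s - 1)\<^sup>2\<close> is left
      over.\<close>
    have lim: "((\<lambda>s. s\<^sup>2 * K ^ 4 * (s - 1)\<^sup>2 * (\<Prod>\<psi>\<in>Y. u \<psi> s))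
        \<longlongrightarrow> 1\<^sup>2 * K ^ 4 * (1 - 1)\<^sup>2 * (\<Prod>\<psi>\<in>Y. u \<psi> 1)) (at_right 1)"
      using contY by (intro tendsto_intros) auto
    have "\<forall>\<^sub>F s in at_right 1. norm (dirichlet_L \<psi> s) \<le> K * \<bar>s - 1\<bar>"
      using K by (simp add: eventually_at_split)
    moreover have "eventually (\<lambda>s::real. s \<in> {1<..<4}) (at_right 1)"
      by (rule eventually_at_right_real) auto
    ultimately have "\<forall>\<^sub>F s in at_right 1. Q 4 \<le> s\<^sup>2 * K ^ 4 * (s - 1)\<^sup>2 * (\<Prod>\<psi>\<in>Y. u \<psi> s)"
    proof eventually_elim
      case (elim s)
      then have s: "1 < s" "s \<le> 4" by auto
      have a: "u \<psi> s \<le> (K * (s - 1))\<^sup>2"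
        unfolding u_def using elim s by (intro power_mono) auto
      moreover have "u \<eta> s = u \<psi> s"
        unfolding u_def \<eta>_def using dirichlet_L_cnj[of \<psi> s] le1[OF inX(1)] s by simp
      moreover have b: "u \<tau> s \<le> (s / (s - 1))\<^sup>2"
        unfolding u_def using norm_dirichlet_L_le[of \<tau> s] le1[OF inX(3)] s by (intro power_mono) auto
      ultimately have "Q s \<le> (s / (s - 1))\<^sup>2 * (K * (s - 1))\<^sup>2 * (K * (s - 1))\<^sup>2 * (\<Prod>\<psi>\<in>Y. u \<psi> s)"
        unfolding Q_eq by (intro mult_mono mult_nonneg_nonneg prod_nonneg) (auto simp: u_def)
      also have "(s / (s - 1))\<^sup>2 * (K * (s - 1))\<^sup>2 * (K * (s - 1))\<^sup>2 = s\<^sup>2 * K ^ 4 * (s - 1)\<^sup>2"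
      proof -
        have "(x / d)\<^sup>2 * (K * d)\<^sup>2 * (K * d)\<^sup>2 = x\<^sup>2 * K ^ 4 * d\<^sup>2" if "d \<noteq> 0" for x d :: real
          using that by (simp add: field_simps power2_eq_square power4_eq_xxxx)
        then show ?thesis using s by simp
      qed
      finally show ?case using Q_ge[OF s] by simp
    qed
    then have "Q 4 \<le> 1\<^sup>2 * K ^ 4 * (1 - 1)\<^sup>2 * (\<Prod>\<psi>\<in>Y. u \<psi> 1)"
      by (rule tendsto_lowerbound[OF lim]) simp
    with Q4 show False by simp
  qed
qed

section \<open>Primes in arithmetic progressions\<close>

text \<open>Since \<open>ln 3 \<ge> 1\<close>, the weights decrease from 3 on for every
  \<open>s \<ge> 1\<close>, which makes the Abel bound uniform in \<open>s\<close>; the three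
  earlier terms are at most \<open>ln 3\<close> each.\<close>

lemma nonprincipal_L'_bound:
  assumes "\<psi> \<in> dirichlet_chars n" "n > 0" "\<psi> \<noteq> principal_char n"
  obtains K where "\<And>s. s \<ge> 1 \<Longrightarrow> norm (dirichlet_L' \<psi> s) \<le> K"
proof -
  have ln3: "ln 3 \<ge> (1::real)" using exp_le by (simp add: ln_ge_iff)
  have "norm (dirichlet_L' \<psi> s) \<le> 2 * real n * ln 3 + 3 * ln 3" if s: "s \<ge> 1" for s
  proof -
    define b where "b m = ln (real m) * real m powr - s" for m :: nat
    have p1: "real m powr - s \<le> 1" for m
      using powr_mono2'[of "-s" 1 "real m"] s by (cases "m = 0") (auto simp: not_less)
    have "norm ((\<Sum>m. b m *\<^sub>R \<psi> m) - (\<Sum>m<3. b m *\<^sub>R \<psi> m)) \<le> 2 * real n * b 3"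
    proof (rule abel_summable(2)[OF norm_sum_nonprincipal_char_le[OF assms], of 3])
      fix m :: nat assume m: "m \<ge> 3"
      have "1 / s \<le> 1" using s by simp
      also have "1 \<le> ln (real m)" using ln3 m by (rule_tac order_trans[OF ln3]) auto
      finally show "b (Suc m) \<le> b m" "b m \<ge> 0"
        using m s unfolding b_def by (auto intro!: ln_mult_powr_decreasing mult_nonneg_nonneg simp del: of_nat_Suc)
    next
      show "b \<longlonglongrightarrow> 0" unfolding b_def using s by real_asymp
    qed auto
    also have "\<dots> \<le> 2 * real n * ln 3"
    proof (intro mult_left_mono)
      show "b 3 \<le> ln 3" unfolding b_def using p1[of 3] ln3 mult_left_mono[of "3 powr - s" 1 "ln (3::real)"] by simp
    qed auto
    finally have "norm (\<Sum>m. b m *\<^sub>R \<psi> m) \<le> 2 * real n * ln 3 + norm (\<Sum>m<3. b m *\<^sub>R \<psi> m)"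
      using norm_triangle_sub[of "\<Sum>m. b m *\<^sub>R \<psi> m" "\<Sum>m<3. b m *\<^sub>R \<psi> m"] by linarith
    also have "norm (\<Sum>m<3. b m *\<^sub>R \<psi> m) \<le> (\<Sum>m<(3::nat). ln 3)"
    proof (rule sum_norm_le)
      fix m :: nat assume m: "m \<in> {..<3}"
      have "\<bar>b m\<bar> \<le> ln 3"
      proof (cases "m = 0")
        case False
        have "ln (real m) * real m powr - s \<le> ln 3 * 1"
          using m False p1 by (intro mult_mono) auto
        with False show ?thesis by (simp add: b_def abs_mult)
      qed (simp add: b_def)
      then have "\<bar>b m\<bar> * norm (\<psi> m) \<le> ln 3 * 1"
        using norm_dirichlet_chars_le[OF assms(1,2), of m] by (intro mult_mono) auto
      then show "norm (b m *\<^sub>R \<psi> m) \<le> ln 3" by simp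
    qed
    finally show ?thesis by (simp add: dirichlet_L'_def b_def)
  qed
  then show ?thesis using that by blast
qed

text \<open>Here nonvanishing pays off: near 1 the L-series stays away from 0 while its derivative
  stays bounded, so their quotient is bounded.\<close>

lemma nonprincipal_mangoldt_bound:
  assumes sq: "squarefree n" and \<psi>: "\<psi> \<in> dirichlet_chars n" "\<psi> \<noteq> principal_char n"
  obtains K where "\<forall>\<^sub>F s in at_right 1. norm (dirichlet_mangoldt \<psi> s) \<le> K"
proof -
  have n: "n > 0" using sq by (intro Nat.gr0I) auto
  obtain K where K: "\<And>s. s \<ge> 1 \<Longrightarrow> norm (dirichlet_L' \<psi> s) \<le> K"
    using nonprincipal_L'_bound[OF \<psi>(1) n \<psi>(2)] by blast
  define e where "e = norm (dirichlet_L \<psi> 1) / 2"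
  have e: "e > 0" "e < norm (dirichlet_L \<psi> 1)"
    using dirichlet_L_one_nonzero[OF sq \<psi>] by (auto simp: e_def)
  have "isCont (dirichlet_L \<psi>) 1"
    using nonprincipal_L_deriv[OF \<psi>(1) n \<psi>(2), of 1] by (intro has_vector_derivative_continuous) auto
  then have "((\<lambda>s. norm (dirichlet_L \<psi> s)) \<longlongrightarrow> norm (dirichlet_L \<psi> 1)) (at_right 1)"
    unfolding isCont_def by (intro tendsto_norm) (simp add: filterlim_at_split)
  then have "\<forall>\<^sub>F s in at_right 1. norm (dirichlet_L \<psi> s) > e"
    using e(2) by (rule order_tendstoD)
  moreover have "eventually (\<lambda>s::real. s \<in> {1<..<2}) (at_right 1)"
    by (rule eventually_at_right_real) auto
  ultimately have "\<forall>\<^sub>F s in at_right 1. norm (dirichlet_mangoldt \<psi> s) \<le> K / e"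
  proof eventually_elim
    case (elim s)
    have "norm (dirichlet_L \<psi> s) * norm (dirichlet_mangoldt \<psi> s) = norm (dirichlet_L' \<psi> s)"
      using dirichlet_L_log_deriv[of \<psi> s] elim dirichlet_chars_mult[OF \<psi>(1)]
        norm_dirichlet_chars_le[OF \<psi>(1) n] by (simp add: norm_mult)
    also have "\<dots> \<le> K" using K elim by simp
    finally have "norm (dirichlet_L \<psi> s) * norm (dirichlet_mangoldt \<psi> s) \<le> K" .
    moreover have "e * norm (dirichlet_mangoldt \<psi> s) \<le> norm (dirichlet_L \<psi> s) * norm (dirichlet_mangoldt \<psi> s)"
      using elim by (intro mult_right_mono) auto
    ultimately show ?case using e by (simp add: field_simps)
  qed
  then show ?thesis using that by blast
qed

text \<open>Only proper prime powers \<open>p ^ Suc k\<close> with \<open>k \<ge> 1\<close> count.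
  Their terms \<open>ln p / p ^ Suc k\<close> are at most \<open>ln p / p ^ 2\<close> times
  \<open>(1 / 2) ^ (k - 1)\<close>; the factor 2 in \<open>v\<close> turns this into
  \<open>(1 / 2) ^ k\<close>.\<close>

lemma summable_on_mangoldt_nonprime:
  "(\<lambda>m. (if prime m then 0 else mangoldt m / real m)) summable_on (UNIV :: nat set)"
proof -
  define w :: "nat \<Rightarrow> real" where "w m = (if prime m then 0 else mangoldt m / real m)" for m
  define v :: "nat \<Rightarrow> real" where "v p = 2 * (ln (real p) * real p powr - 2)" for p
  have v0: "v p \<ge> 0" for p by (cases "p = 0") (auto simp: v_def)
  have "(\<lambda>(p, k). v p * (1 / 2) ^ k) summable_on UNIV \<times> (UNIV :: nat set)"
  proof (rule summable_on_SigmaI)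
    have "((\<lambda>k. (1 / 2 :: real) ^ k) has_sum 1 / (1 - 1 / 2)) UNIV"
      by (intro sums_nonneg_imp_has_sum geometric_sums) auto
    then show "((\<lambda>k. case (p, k) of (p, k) \<Rightarrow> v p * (1 / 2) ^ k) has_sum v p * 2) UNIV" for p
      using has_sum_cmult_right[of "\<lambda>k. (1 / 2 :: real) ^ k" UNIV 2 "v p"] by simp
    have "summable (\<lambda>p. v p * 2)"
      unfolding v_def by (intro summable_mult2 summable_mult summable_ln_powr) auto
    then show "(\<lambda>p. v p * 2) summable_on UNIV"
      using v0 by (subst summable_on_UNIV_nonneg_real_iff) auto
  qed (use v0 in auto)
  then have "(\<lambda>(p, k). v p * (1 / 2) ^ k) summable_on Collect prime \<times> UNIV"
    by (rule summable_on_subset_banach) auto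
  then have "(\<lambda>x. norm (w ((\<lambda>(p, k). p ^ Suc k) x))) summable_on Collect prime \<times> UNIV"
  proof (rule Infinite_Sum.abs_summable_on_comparison_test')
    fix x :: "nat \<times> nat" assume "x \<in> Collect prime \<times> UNIV"
    then obtain p k where x: "x = (p, k)" and p: "prime p" by auto
    have p2: "p \<ge> 2" using prime_ge_2_nat[OF p] .
    show "norm (w ((\<lambda>(p, k). p ^ Suc k) x)) \<le> (case x of (p, k) \<Rightarrow> v p * (1 / 2) ^ k)"
    proof (cases k)
      case 0
      then show ?thesis using p v0 by (simp add: x w_def)
    next
      case (Suc j)
      have "\<not> prime (p ^ Suc k)" using Suc by (simp add: prime_power_iff del: power_Suc)
      moreover have "mangoldt (p ^ Suc k) = ln (real p)"
        using mangoldt_primepow'[OF p, of "Suc k", where ?'a = real] by simp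
      ultimately have "w (p ^ Suc k) = ln (real p) / real p ^ Suc k" by (simp add: w_def)
      also have "\<dots> = ln (real p) * (1 / real p ^ 2) * (1 / real p) ^ j"
        using p2 by (simp add: Suc power2_eq_square power_divide)
      also have "\<dots> \<le> ln (real p) * (1 / real p ^ 2) * (1 / 2) ^ j"
        using p2 by (intro mult_left_mono power_mono) (auto intro!: divide_left_mono)
      also have "\<dots> = v p * (1 / 2) ^ k"
      proof -
        have "real p powr - 2 = 1 / real p ^ 2" using p2 by (simp add: powr_neg_numeral)
        then show ?thesis by (simp add: v_def Suc)
      qed
      finally show ?thesis using p2 by (simp add: x w_def mangoldt_nonneg)
    qed
  qed
  then have "(\<lambda>x. w ((\<lambda>(p, k). p ^ Suc k) x)) summable_on Collect prime \<times> UNIV"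
    by (rule abs_summable_summable)
  then have "w summable_on Collect primepow"
    using summable_on_reindex_bij_betw[OF bij_betw_primepows[where ?'a = nat], of w] by simp
  also have "?this \<longleftrightarrow> w summable_on UNIV"
    by (rule summable_on_cong_neutral) (auto simp: w_def mangoldt_def)
  finally show ?thesis by (simp add: w_def[abs_def])
qed

text \<open>Finitely many primes in the class of \<open>a\<close> would keep \<open>-L'/L\<close> of the principal character
  bounded near 1, hence also its L-function, contrary to the divergence of the harmonic series.\<close>

theorem infinite_primes_cong:
  fixes a n :: nat
  assumes sq: "squarefree n" and a: "coprime a n"
  shows "infinite {p. prime p \<and> [p = a] (mod n)}"
proof
  assume fin: "finite {p. prime p \<and> [p = a] (mod n)}"
  define P where "P = {p. prime p \<and> [p = a] (mod n)}"
  define X where "X = dirichlet_chars n"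
  define \<tau> where "\<tau> = principal_char n"
  have n: "n > 0" using sq by (intro Nat.gr0I) auto
  have finX: "finite X" by (simp add: X_def finite_dirichlet_chars n)
  have \<tau>: "\<tau> \<in> X" by (simp add: X_def \<tau>_def principal_char_in)
  have le1: "norm (\<psi> m) \<le> 1" if "\<psi> \<in> X" for \<psi> m
    using that norm_dirichlet_chars_le n by (auto simp: X_def)
  define w :: "nat \<Rightarrow> real" where "w m = (if prime m then 0 else mangoldt m / real m)" for m
  \<comment> \<open>Under the assumption of finitely many primes, \<open>v\<close> is a summable
    majorant of the von Mangoldt terms in the class of \<open>a\<close>, the same for all
    \<open>s > 1\<close>.\<close>
  define v where "v m = w m + (if m \<in> P then mangoldt m else 0)" for m
  have "(\<lambda>m. if m \<in> P then mangoldt m else 0 :: real) summable_on UNIV"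
    by (rule finite_nonzero_values_imp_summable_on) (rule finite_subset[OF _ fin], auto simp: P_def)
  then have "v summable_on UNIV"
    unfolding v_def w_def by (intro summable_on_add summable_on_mangoldt_nonprime)
  then obtain B where B: "(v has_sum B) UNIV" by (auto simp: summable_on_def)
  have G: "(\<Sum>\<psi>\<in>X. Re (cnj (\<psi> a) * dirichlet_mangoldt \<psi> s)) \<le> B * real (card X)" if s: "s > 1" for s
  proof (rule has_sum_mono)
    show "((\<lambda>m. mangoldt m * real m powr - s * of_bool ([m = a] (mod n)) * real (card X)) has_sum
        (\<Sum>\<psi>\<in>X. Re (cnj (\<psi> a) * dirichlet_mangoldt \<psi> s))) UNIV"
      unfolding X_def by (rule sum_cnj_dirichlet_mangoldt[OF sq a s])
    show "((\<lambda>m. v m * real (card X)) has_sum B * real (card X)) UNIV"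
      using B by (rule has_sum_cmult_left)
    fix m :: nat
    have "mangoldt m * real m powr - s * of_bool ([m = a] (mod n)) \<le> v m"
    proof (cases "m = 0 \<or> \<not> [m = a] (mod n)")
      case True
      then show ?thesis by (auto simp: v_def w_def P_def mangoldt_nonneg)
    next
      case False
      have "real m powr - s \<le> real m powr - 1" using False s by (intro powr_mono) auto
      also have "\<dots> = 1 / real m" using False by (simp add: powr_minus divide_inverse)
      finally have le: "mangoldt m * real m powr - s \<le> mangoldt m / real m"
        using mult_left_mono[OF _ mangoldt_nonneg] by fastforce
      also have "\<dots> \<le> v m"
      proof (cases "prime m")
        case True
        then have "m \<in> P" using False by (simp add: P_def)
        moreover have "mangoldt m / real m \<le> (mangoldt m :: real)"
          using False mult_right_mono[of 1 "real m" "mangoldt m"] by (simp add: field_simps mangoldt_nonneg)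
        ultimately show ?thesis using True by (simp add: v_def w_def)
      qed (simp add: v_def w_def mangoldt_nonneg)
      finally show ?thesis using False by simp
    qed
    then show "mangoldt m * real m powr - s * of_bool ([m = a] (mod n)) * real (card X) \<le> v m * real (card X)"
      by (rule mult_right_mono) simp
  qed
  have "\<exists>K. \<forall>\<^sub>F s in at_right 1. norm (dirichlet_mangoldt \<psi> s) \<le> K" if "\<psi> \<in> X - {\<tau>}" for \<psi>
    using nonprincipal_mangoldt_bound[OF sq, of \<psi>] that by (auto simp: X_def \<tau>_def)
  then obtain K where K: "\<And>\<psi>. \<psi> \<in> X - {\<tau>} \<Longrightarrow> \<forall>\<^sub>F s in at_right 1. norm (dirichlet_mangoldt \<psi> s) \<le> K \<psi>"
    by metis
  define D where "D = B * real (card X) + (\<Sum>\<psi>\<in>X - {\<tau>}. K \<psi>)"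
  have "\<forall>\<^sub>F s in at_right 1. \<forall>\<psi>\<in>X - {\<tau>}. norm (dirichlet_mangoldt \<psi> s) \<le> K \<psi>"
    using finX K by (intro eventually_ball_finite) auto
  moreover have "eventually (\<lambda>s::real. s \<in> {1<..<2}) (at_right 1)"
    by (rule eventually_at_right_real) auto
  ultimately have "\<forall>\<^sub>F s in at_right 1. 1 < s \<and> Re (dirichlet_mangoldt \<tau> s) \<le> D"
  proof eventually_elim
    case (elim s)
    have "Re (dirichlet_mangoldt \<tau> s) = Re (cnj (\<tau> a) * dirichlet_mangoldt \<tau> s)"
      using a by (simp add: \<tau>_def principal_char_def)
    also have "\<dots> = (\<Sum>\<psi>\<in>X. Re (cnj (\<psi> a) * dirichlet_mangoldt \<psi> s))
        - (\<Sum>\<psi>\<in>X - {\<tau>}. Re (cnj (\<psi> a) * dirichlet_mangoldt \<psi> s))"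
      using finX \<tau> by (simp add: sum_diff1)
    also have "\<dots> \<le> B * real (card X) + (\<Sum>\<psi>\<in>X - {\<tau>}. K \<psi>)"
    proof -
      have "- (\<Sum>\<psi>\<in>X - {\<tau>}. Re (cnj (\<psi> a) * dirichlet_mangoldt \<psi> s)) \<le> (\<Sum>\<psi>\<in>X - {\<tau>}. K \<psi>)"
        unfolding sum_negf[symmetric]
      proof (rule sum_mono)
        fix \<psi> assume \<psi>: "\<psi> \<in> X - {\<tau>}"
        have "- Re (cnj (\<psi> a) * dirichlet_mangoldt \<psi> s) \<le> norm (cnj (\<psi> a) * dirichlet_mangoldt \<psi> s)"
          using abs_Re_le_cmod[of "cnj (\<psi> a) * dirichlet_mangoldt \<psi> s"] by linarith
        also have "\<dots> \<le> norm (dirichlet_mangoldt \<psi> s)"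
          using le1[of \<psi> a] \<psi> by (auto simp: norm_mult intro: mult_left_le_one_le)
        finally show "- Re (cnj (\<psi> a) * dirichlet_mangoldt \<psi> s) \<le> K \<psi>" using elim \<psi> by force
      qed
      then show ?thesis using G[of s] elim by simp
    qed
    finally show ?case using elim by (simp add: D_def)
  qed
  then obtain b where b: "b > 1" "\<And>s. 1 < s \<Longrightarrow> s < b \<Longrightarrow> Re (dirichlet_mangoldt \<tau> s) \<le> D"
    unfolding eventually_at_right_field by auto
  define c where "c = (1 + b) / 2"
  have c: "1 < c" "c < b" using b by (auto simp: c_def)
  define u where "u s = (norm (dirichlet_L \<tau> s))\<^sup>2" for s
  define E where "E = u c * exp (2 * \<bar>D\<bar> * c)"
  have u_le: "u s \<le> E" if s: "1 < s" "s \<le> c" for s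
  proof -
    \<comment> \<open>Integrating factor: the logarithmic derivative of \<open>u\<close> is at least
      \<open>- 2 * D\<close>, so this product is nondecreasing and \<open>u\<close> cannot blow up
      on the way from \<open>c\<close> down to 1.\<close>
    have "u s * exp (2 * D * s) \<le> u c * exp (2 * D * c)"
    proof (rule DERIV_nonneg_imp_nondecreasing[OF s(2)])
      fix x assume x: "s \<le> x" "x \<le> c"
      have "(u has_real_derivative u x * (- 2 * Re (dirichlet_mangoldt \<tau> x))) (at x)"
        unfolding u_def using x s le1[OF \<tau>] dirichlet_chars_mult \<tau>
        by (intro dirichlet_L_norm_deriv) (auto simp: X_def)
      then have "((\<lambda>s. u s * exp (2 * D * s)) has_real_derivative
          2 * (D - Re (dirichlet_mangoldt \<tau> x)) * (u x * exp (2 * D * x))) (at x)"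
        by (auto intro!: derivative_eq_intros simp: algebra_simps)
      moreover have "0 \<le> 2 * (D - Re (dirichlet_mangoldt \<tau> x)) * (u x * exp (2 * D * x))"
        using b(2)[of x] x s c by (intro mult_nonneg_nonneg) (auto simp: u_def)
      ultimately show "\<exists>y. ((\<lambda>s. u s * exp (2 * D * s)) has_real_derivative y) (at x) \<and> 0 \<le> y" by blast
    qed
    then have "u s \<le> u c * exp (2 * D * c) / exp (2 * D * s)" by (simp add: field_simps)
    also have "\<dots> = u c * exp (2 * D * (c - s))" by (simp add: exp_diff algebra_simps)
    also have "\<dots> \<le> u c * exp (2 * \<bar>D\<bar> * c)"
    proof -
      have "2 * D * (c - s) \<le> 2 * \<bar>D\<bar> * (c - s)" using s by (intro mult_right_mono) auto
      also have "\<dots> \<le> 2 * \<bar>D\<bar> * c" using s by (intro mult_left_mono) auto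
      finally show ?thesis by (intro mult_left_mono) (auto simp: u_def)
    qed
    finally show ?thesis by (simp add: E_def)
  qed
  have sum_le: "(\<Sum>m\<in>{m. m < M \<and> coprime m n}. real m powr - s) \<le> sqrt E" if s: "1 < s" "s \<le> c" for s M
  proof -
    have "((\<lambda>m. Re (real m powr - s *\<^sub>R \<tau> m)) has_sum Re (dirichlet_L \<tau> s)) UNIV"
      using has_sum_dirichlet_L(2)[OF le1[OF \<tau>] s(1)] by (rule has_sum_Re)
    then have "(\<Sum>m<M. Re (real m powr - s *\<^sub>R \<tau> m)) \<le> Re (dirichlet_L \<tau> s)"
      by (rule finite_sum_le_has_sum) (auto simp: \<tau>_def principal_char_def)
    also have "\<dots> \<le> norm (dirichlet_L \<tau> s)" by (rule complex_Re_le_cmod)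
    also have "\<dots> \<le> sqrt E" using u_le[OF s] by (simp add: u_def real_le_rsqrt)
    also have "(\<Sum>m<M. Re (real m powr - s *\<^sub>R \<tau> m)) = (\<Sum>m\<in>{m. m < M \<and> coprime m n}. real m powr - s)"
      by (rule sum.mono_neutral_cong_right) (auto simp: \<tau>_def principal_char_def)
    finally show ?thesis .
  qed
  have sum_le1: "(\<Sum>m\<in>{m. m < M \<and> coprime m n}. real m powr - 1) \<le> sqrt E" for M
  proof (rule tendsto_upperbound)
    show "((\<lambda>s. \<Sum>m\<in>{m. m < M \<and> coprime m n}. real m powr - s) \<longlongrightarrow>
        (\<Sum>m\<in>{m. m < M \<and> coprime m n}. real m powr - 1)) (at_right 1)"
    proof (intro tendsto_sum)
      fix m
      show "((\<lambda>s. real m powr - s) \<longlongrightarrow> real m powr - 1) (at_right 1)"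
      proof (cases "m = 0")
        case False
        then show ?thesis by (intro tendsto_powr tendsto_intros) auto
      qed simp
    qed
    have "eventually (\<lambda>s::real. s \<in> {1<..<c}) (at_right 1)"
      using c by (intro eventually_at_right_real) auto
    then show "\<forall>\<^sub>F s in at_right 1. (\<Sum>m\<in>{m. m < M \<and> coprime m n}. real m powr - s) \<le> sqrt E"
      by eventually_elim (use sum_le in auto)
  qed auto
  have "summable (\<lambda>k. 1 / real (Suc k))"
  proof (rule summableI_nonneg_bounded)
    fix k
    \<comment> \<open>The numbers \<open>i * n + 1\<close> are coprime to \<open>n\<close> and at
      most \<open>n * Suc i\<close>, so sums over numbers coprime to \<open>n\<close> dominate the
      harmonic series up to the factor \<open>n\<close>.\<close>
    have "(\<Sum>i<k. 1 / real (Suc i)) \<le> (\<Sum>i<k. real n * real (i * n + 1) powr - 1)"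
    proof (rule sum_mono)
      fix i
      have "real (i * n + 1) \<le> real n * real (Suc i)"
        using n by (simp add: algebra_simps flip: of_nat_mult of_nat_add)
      then have "1 / real (Suc i) \<le> real n / real (i * n + 1)"
        using n by (simp add: field_simps del: of_nat_Suc)
      also have "\<dots> = real n * real (i * n + 1) powr - 1"
        by (simp add: powr_minus divide_inverse)
      finally show "1 / real (Suc i) \<le> real n * real (i * n + 1) powr - 1" .
    qed
    also have "\<dots> = real n * (\<Sum>m\<in>(\<lambda>i. i * n + 1) ` {..<k}. real m powr - 1)"
      using n by (subst sum.reindex) (auto simp: inj_on_def sum_distrib_left)
    also have "(\<Sum>m\<in>(\<lambda>i. i * n + 1) ` {..<k}. real m powr - 1)
        \<le> (\<Sum>m\<in>{m. m < k * n + 2 \<and> coprime m n}. real m powr - 1)"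
    proof (rule sum_mono2)
      have "i * n + 1 < k * n + 2" if "i < k" for i
        using mult_le_mono1[OF less_imp_le[OF that], of n] by linarith
      moreover have "coprime (i * n + 1) n" for i
        by (rule coprimeI) (metis dvd_add_right_iff dvd_mult)
      ultimately show "(\<lambda>i. i * n + 1) ` {..<k} \<subseteq> {m. m < k * n + 2 \<and> coprime m n}" by auto
    qed auto
    also have "\<dots> \<le> sqrt E" by (rule sum_le1)
    finally show "(\<Sum>i<k. 1 / real (Suc i)) \<le> real n * sqrt E" using n by simp
  qed simp
  then have "summable (\<lambda>k. inverse (real k))"
    by (subst (asm) summable_Suc_iff[of "\<lambda>k. 1 / real k"]) (simp add: inverse_eq_divide)
  then show False using not_summable_harmonic[where ?'a = real] by simp
qed

section \<open>Coefficients of ternary cyclotomic polynomials\<close>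

abbreviation X_pow :: "nat \<Rightarrow> complex poly" where
  "X_pow \<equiv> Polynomial.monom 1"

abbreviation unity_poly :: "nat \<Rightarrow> complex poly" where
  "unity_poly m \<equiv> X_pow m - 1"

lemma pcompose_X_pow: "pcompose (X_pow m) (X_pow k) = X_pow (k * m)"
proof (induction m)
  case (Suc m)
  then show ?case by (simp add: monom_Suc pcompose_pCons mult_monom)
qed (simp add: one_pCons)

lemma pcompose_unity_poly: "pcompose (unity_poly m) (X_pow k) = unity_poly (k * m)"
  by (simp add: pcompose_diff pcompose_X_pow one_pCons)

lemma degree_unity_poly: "m > 0 \<Longrightarrow> degree (unity_poly m) = m"
  using degree_add_eq_left[of "-1" "X_pow m"] by (simp add: degree_monom_eq)

lemma unity_poly_nonzero: "m > 0 \<Longrightarrow> unity_poly m \<noteq> 0"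
  using degree_unity_poly[of m] by auto

lemma prod_roots_of_unity:
  assumes "m > 0"
  shows "(\<Prod>k\<in>{1..m}. [:- cis (2 * pi * real k / real m), 1:]) = unity_poly m"
proof (rule poly_eqI_degree_lead_coeff[where A = "{z. z ^ m = 1}" and n = m])
  define \<zeta> where "\<zeta> k = cis (2 * pi * real k / real m)" for k
  have bij: "bij_betw \<zeta> {..<m} {z. z ^ m = 1}"
    using Complex.bij_betw_roots_unity[OF assms] unfolding \<zeta>_def .
  show "m \<le> card {z::complex. z ^ m = 1}"
    using bij_betw_same_card[OF bij] by simp
  show "poly (\<Prod>k\<in>{1..m}. [:- cis (2 * pi * real k / real m), 1:]) z = poly (unity_poly m) z"
    if "z \<in> {z. z ^ m = 1}" for z
  proof -
    have "z \<in> \<zeta> ` {..<m}" using bij_betw_imp_surj_on[OF bij] that by simp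
    then obtain k where k: "k < m" "z = \<zeta> k" by auto
    define k' where "k' = (if k = 0 then m else k)"
    have "k' \<in> {1..m}" "z = \<zeta> k'" using k assms by (auto simp: k'_def \<zeta>_def)
    then have "(\<Prod>k\<in>{1..m}. poly [:- \<zeta> k, 1:] z) = 0" by (intro prod_zero) auto
    then show ?thesis using that by (simp add: poly_prod poly_monom \<zeta>_def)
  qed
  show "degree (\<Prod>k\<in>{1..m}. [:- cis (2 * pi * real k / real m), 1:]) \<le> m"
    by (simp add: degree_prod_eq_sum_degree)
  have "poly.coeff (\<Prod>k\<in>{1..m}. [:- cis (2 * pi * real k / real m), 1:]) m
      = lead_coeff (\<Prod>k\<in>{1..m}. [:- cis (2 * pi * real k / real m), 1:])"
    by (simp add: degree_prod_eq_sum_degree)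
  then show "poly.coeff (\<Prod>k\<in>{1..m}. [:- cis (2 * pi * real k / real m), 1:]) m = poly.coeff (unity_poly m) m"
    using assms by (simp add: lead_coeff_prod)
qed (use assms degree_unity_poly in auto)

text \<open>Every fraction \<open>k / m\<close> has one reduced form, whose denominator divides
  \<open>m\<close>; this sorts the roots of unity by their exact order.\<close>

lemma prod_cyclotomic_poly:
  assumes "m > 0"
  shows "(\<Prod>d | d dvd m. cyclotomic_poly d) = unity_poly m"
proof -
  have fin: "finite {d. d dvd m}" using assms by simp
  have "(\<Prod>d | d dvd m. cyclotomic_poly d)
      = (\<Prod>(d, k)\<in>(SIGMA d:{d. d dvd m}. {k. k \<in> {1..d} \<and> coprime k d}). [:- cis (2 * pi * real k / real d), 1:])"
    unfolding cyclotomic_poly_def using fin by (subst prod.Sigma) auto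
  also have "\<dots> = (\<Prod>k\<in>{1..m}. [:- cis (2 * pi * real k / real m), 1:])"
  proof (rule prod.reindex_bij_witness[where j = "\<lambda>(d, k). k * (m div d)"
        and i = "\<lambda>k. (m div gcd k m, k div gcd k m)"])
    fix x assume "x \<in> (SIGMA d:{d. d dvd m}. {k. k \<in> {1..d} \<and> coprime k d})"
    then obtain d k where x: "x = (d, k)" "d dvd m" "1 \<le> k" "k \<le> d" "coprime k d" by auto
    obtain e where e: "m = d * e" using x by auto
    have pos: "d > 0" "e > 0" using assms e by auto
    have "gcd (k * e) (d * e) = e" using x(5) by (simp add: gcd_mult_distrib_nat[symmetric] mult.commute[of _ e])
    then show "(m div gcd (case x of (d, k) \<Rightarrow> k * (m div d)) m, (case x of (d, k) \<Rightarrow> k * (m div d)) div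
        gcd (case x of (d, k) \<Rightarrow> k * (m div d)) m) = x"
      using pos by (simp add: x e)
    show "(case x of (d, k) \<Rightarrow> k * (m div d)) \<in> {1..m}"
      using pos x by (simp add: e)
    show "[:- cis (2 * pi * real (case x of (d, k) \<Rightarrow> k * (m div d)) / real m), 1:]
        = (case x of (d, k) \<Rightarrow> [:- cis (2 * pi * real k / real d), 1:])"
      using pos by (simp add: x e mult.assoc)
  next
    fix k assume k: "k \<in> {1..m}"
    define g where "g = gcd k m"
    have g: "g > 0" using assms by (simp add: g_def)
    obtain a b where ab: "k = g * a" "m = g * b" unfolding g_def by (meson dvdE gcd_dvd1 gcd_dvd2)
    have "a > 0" "b > 0" "a \<le> b" using k g assms by (auto simp: ab)
    then have da: "k div g = a" "m div g = b" "m div b = g" "a * g = k" "b dvd m"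
      using g ab by simp_all
    have "coprime a b" using div_gcd_coprime[of k m] assms unfolding g_def[symmetric] da by simp
    then show "(case (m div gcd k m, k div gcd k m) of (d, k) \<Rightarrow> k * (m div d)) = k"
      "(m div gcd k m, k div gcd k m) \<in> (SIGMA d:{d. d dvd m}. {k. k \<in> {1..d} \<and> coprime k d})"
      using \<open>a > 0\<close> \<open>a \<le> b\<close> unfolding g_def[symmetric] da by (simp_all add: da)
  qed
  also have "\<dots> = unity_poly m" by (rule prod_roots_of_unity[OF assms])
  finally show ?thesis .
qed

lemma prod_divisors_prime_mult:
  fixes f :: "nat \<Rightarrow> 'a :: comm_monoid_mult"
  assumes "prime p" "\<not> p dvd n" "n > 0"
  shows "(\<Prod>d | d dvd p * n. f d) = (\<Prod>d | d dvd n. f d * f (p * d))"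
proof -
  have p0: "p > 0" using prime_gt_0_nat[OF assms(1)] .
  have "{d. d dvd p * n} = {d. d dvd n} \<union> (*) p ` {d. d dvd n}"
  proof safe
    fix d assume d: "d dvd p * n" "d \<notin> (*) p ` {d. d dvd n}"
    show "d dvd n"
    proof (cases "p dvd d")
      case True
      then obtain e where e: "d = p * e" by auto
      with d(1) p0 have "e dvd n" by simp
      with e d(2) show ?thesis by auto
    next
      case False
      then have "coprime d p" using assms(1) by (metis coprime_commute prime_imp_coprime)
      with d(1) show ?thesis by (simp add: coprime_dvd_mult_right_iff)
    qed
  qed auto
  moreover have "{d. d dvd n} \<inter> (*) p ` {d. d dvd n} = {}"
    using assms(2) by (auto dest: dvd_mult_left)
  ultimately have "(\<Prod>d | d dvd p * n. f d) = (\<Prod>d | d dvd n. f d) * (\<Prod>d\<in>(*) p ` {d. d dvd n}. f d)"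
    using assms(3) by (simp add: prod.union_disjoint)
  also have "(\<Prod>d\<in>(*) p ` {d. d dvd n}. f d) = (\<Prod>d | d dvd n. f (p * d))"
    using p0 by (subst prod.reindex) (auto simp: inj_on_def)
  finally show ?thesis by (simp add: prod.distrib)
qed

section \<open>Product identities for two and three primes\<close>

locale three_primes =
  fixes p q r :: nat
  assumes p: "prime p" and q: "prime q" and r: "prime r" and lt: "p < q" "q < r"
begin

lemma pos: "p > 0" "q > 0" "r > 0"
  using p q r by (auto dest: prime_gt_0_nat)

lemma p2: "p \<ge> 2"
  using p by (rule prime_ge_2_nat)

lemma coprimes: "coprime p q" "coprime p r" "coprime q r"
  using p q r lt by (auto intro: primes_coprime)

lemma cyclotomic_poly_two_primes:
  "cyclotomic_poly (p * q) * (unity_poly p * unity_poly q) = unity_poly 1 * unity_poly (p * q)"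
proof -
  have 1: "\<not> q dvd 1" "\<not> p dvd 1" "\<not> p dvd q"
    using p q lt by (auto simp: primes_dvd_imp_eq dest: primes_dvd_imp_eq)
  show ?thesis
    using pos prod_cyclotomic_poly[of 1] prod_cyclotomic_poly[of p] prod_cyclotomic_poly[of q]
      prod_cyclotomic_poly[of "p * q"] prod_divisors_prime_mult[OF p 1(2), of cyclotomic_poly]
      prod_divisors_prime_mult[OF q 1(1), of cyclotomic_poly]
      prod_divisors_prime_mult[OF p 1(3), of cyclotomic_poly]
      prod_divisors_prime_mult[OF q 1(1), of "\<lambda>d. cyclotomic_poly d * cyclotomic_poly (p * d)"]
    by (simp add: mult_ac)
qed

text \<open>Moebius inversion written without division: both sides contain the factor for 1 four
  times, those for \<open>p\<close>, \<open>q\<close>, \<open>r\<close> twice, and the other four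
  once.\<close>

lemma cyclotomic_poly_three_primes:
  "cyclotomic_poly (p * q * r) * (unity_poly (p * q) * unity_poly (p * r) * unity_poly (q * r) * unity_poly 1)
   = unity_poly (p * q * r) * unity_poly p * unity_poly q * unity_poly r"
proof -
  have 1: "\<not> r dvd 1" "\<not> q dvd 1" "\<not> p dvd 1" "\<not> p dvd q" "\<not> p dvd r" "\<not> q dvd r" "\<not> p dvd q * r"
    using p q r lt by (auto simp: prime_dvd_mult_iff dest: primes_dvd_imp_eq)
  note d = prod_divisors_prime_mult
  have e: "(\<Prod>d | d dvd 1. f d) = f 1" for f :: "nat \<Rightarrow> complex poly" by simp
  define \<Phi> where "\<Phi> = cyclotomic_poly"
  have "unity_poly 1 = \<Phi> 1" "unity_poly p = \<Phi> 1 * \<Phi> p" "unity_poly q = \<Phi> 1 * \<Phi> q"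
    "unity_poly r = \<Phi> 1 * \<Phi> r"
    using prod_cyclotomic_poly[of 1] prod_cyclotomic_poly[of p] prod_cyclotomic_poly[of q]
      prod_cyclotomic_poly[of r] d[OF p 1(3), of \<Phi>] d[OF q 1(2), of \<Phi>] d[OF r 1(1), of \<Phi>] pos
    by (simp_all add: \<Phi>_def)
  moreover have "unity_poly (p * q) = \<Phi> 1 * \<Phi> p * (\<Phi> q * \<Phi> (p * q))"
    using prod_cyclotomic_poly[of "p * q"] d[OF p 1(4), of \<Phi>] d[OF q 1(2), of "\<lambda>d. \<Phi> d * \<Phi> (p * d)"] pos
    by (simp add: \<Phi>_def)
  moreover have "unity_poly (p * r) = \<Phi> 1 * \<Phi> p * (\<Phi> r * \<Phi> (p * r))"
    using prod_cyclotomic_poly[of "p * r"] d[OF p 1(5), of \<Phi>] d[OF r 1(1), of "\<lambda>d. \<Phi> d * \<Phi> (p * d)"] pos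
    by (simp add: \<Phi>_def)
  moreover have "unity_poly (q * r) = \<Phi> 1 * \<Phi> q * (\<Phi> r * \<Phi> (q * r))"
    using prod_cyclotomic_poly[of "q * r"] d[OF q 1(6), of \<Phi>] d[OF r 1(1), of "\<lambda>d. \<Phi> d * \<Phi> (q * d)"] pos
    by (simp add: \<Phi>_def)
  moreover have "unity_poly (p * q * r) = \<Phi> 1 * \<Phi> p * (\<Phi> q * \<Phi> (p * q)) * (\<Phi> r * \<Phi> (p * r) * (\<Phi> (q * r) * \<Phi> (p * q * r)))"
    using prod_cyclotomic_poly[of "p * (q * r)"] d[OF p 1(7), of \<Phi>]
      d[OF q 1(6), of "\<lambda>d. \<Phi> d * \<Phi> (p * d)"]
      d[OF r 1(1), of "\<lambda>d. \<Phi> d * \<Phi> (p * d) * (\<Phi> (q * d) * \<Phi> (p * (q * d)))"] pos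
    by (simp add: \<Phi>_def mult_ac)
  ultimately show ?thesis unfolding \<Phi>_def[symmetric] by (simp only: mult_ac)
qed

text \<open>This is Phi_pqr(x) = Phi_pq(x^r) / Phi_pq(x) with the denominator written out by
  \<open>cyclotomic_poly_two_primes\<close>. The sum over \<open>m < p\<close> will give the
  \<open>p\<close> points of a diagonal and the factor \<open>1 - X_pow q\<close> the shifted
  copy.\<close>

lemma cyclotomic_poly_quotient:
  "cyclotomic_poly (p * q * r) * (1 - X_pow (p * q))
   = pcompose (cyclotomic_poly (p * q)) (X_pow r) * (\<Sum>m<p. X_pow m) * (1 - X_pow q)"
proof -
  define F where "F = pcompose (cyclotomic_poly (p * q)) (X_pow r)"
  have F: "F * (unity_poly (p * r) * unity_poly (q * r)) = unity_poly r * unity_poly (p * q * r)"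
    using arg_cong[OF cyclotomic_poly_two_primes, of "\<lambda>f. pcompose f (X_pow r)"]
    by (simp add: pcompose_mult pcompose_unity_poly F_def mult_ac)
  have geo: "unity_poly p = unity_poly 1 * (\<Sum>m<p. X_pow m)"
    using power_diff_1_eq[of "X_pow 1" p] by (simp add: monom_power)
  have "cyclotomic_poly (p * q * r) * unity_poly (p * q) * (unity_poly (p * r) * unity_poly (q * r) * unity_poly 1)
     = (unity_poly r * unity_poly (p * q * r)) * unity_poly p * unity_poly q"
    using cyclotomic_poly_three_primes by (simp only: mult_ac)
  also have "\<dots> = F * (\<Sum>m<p. X_pow m) * unity_poly q * (unity_poly (p * r) * unity_poly (q * r) * unity_poly 1)"
    unfolding F[symmetric] geo by (simp only: mult_ac)
  finally have "cyclotomic_poly (p * q * r) * unity_poly (p * q) = F * (\<Sum>m<p. X_pow m) * unity_poly q"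
    using pos unity_poly_nonzero by (simp del: mult.assoc)
  then have "cyclotomic_poly (p * q * r) * (- unity_poly (p * q)) = F * (\<Sum>m<p. X_pow m) * (- unity_poly q)"
    by (simp only: mult_minus_right)
  then show ?thesis by (simp add: F_def)
qed

end

text \<open>The coefficient at \<open>n\<close> of the power series f(x) / (1 - x^N).\<close>

definition res_sum :: "nat \<Rightarrow> nat \<Rightarrow> complex poly \<Rightarrow> complex" where
  "res_sum N n f = (\<Sum>e | e \<le> n \<and> [e = n] (mod N). poly.coeff f e)"

lemma finite_res: "finite {e. e \<le> n \<and> [e = n] (mod N)}" for n N :: nat
  by (rule finite_subset[of _ "{..n}"]) auto

lemma res_sum_diff: "res_sum N n (f - g) = res_sum N n f - res_sum N n g"
  by (simp add: res_sum_def sum_subtractf)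

lemma res_sum_smult: "res_sum N n (Polynomial.smult a f) = a * res_sum N n f"
  by (simp add: res_sum_def sum_distrib_left)

lemma res_sum_sum: "res_sum N n (\<Sum>i\<in>I. f i) = (\<Sum>i\<in>I. res_sum N n (f i))"
  unfolding res_sum_def Polynomial.coeff_sum by (rule sum.swap)

lemma res_sum_X_pow: "res_sum N n (X_pow k) = of_bool (k \<le> n \<and> [k = n] (mod N))"
  unfolding res_sum_def Polynomial.coeff_monom using finite_res[of n N] by (simp add: sum.delta)

lemma res_sum_rec:
  assumes "N > 0"
  shows "res_sum N n f = poly.coeff f n + (if N \<le> n then res_sum N (n - N) f else 0)"
proof (cases "N \<le> n")
  case True
  have "{e. e \<le> n \<and> [e = n] (mod N)} = insert n {e. e \<le> n - N \<and> [e = n - N] (mod N)}"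
  proof safe
    fix e assume e: "e \<le> n" "[e = n] (mod N)" "e \<noteq> n"
    then obtain k where k: "n = e + k * N" using cong_le_nat[OF e(1), of N] cong_sym[OF e(2)] by (auto simp: add.commute)
    with e obtain j where "k = Suc j" by (cases k) auto
    with k show "e \<le> n - N" "[e = n - N] (mod N)" by (auto simp: unique_euclidean_semiring_class.cong_def)
  next
    fix e assume e: "e \<le> n - N" "[e = n - N] (mod N)"
    then show "e \<le> n" by simp
    have "[e + 0 = n - N + N] (mod N)" using e(2) by (intro cong_add) (auto simp: unique_euclidean_semiring_class.cong_def)
    then show "[e = n] (mod N)" using True by simp
  qed auto
  moreover have "n \<notin> {e. e \<le> n - N \<and> [e = n - N] (mod N)}" using True assms by auto
  ultimately show ?thesis using True finite_res[of "n - N" N] by (simp add: res_sum_def)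
next
  case False
  then have "{e. e \<le> n \<and> [e = n] (mod N)} = {n}" by (auto simp: unique_euclidean_semiring_class.cong_def)
  then show ?thesis using False by (simp add: res_sum_def)
qed

lemma coeff_eq_res_sum:
  assumes "N > 0"
  shows "poly.coeff g n = res_sum N n (g * (1 - X_pow N))"
proof (induction n rule: less_induct)
  case (less n)
  have "poly.coeff (g * (1 - X_pow N)) n = poly.coeff g n - (if N \<le> n then poly.coeff g (n - N) else 0)"
    using Polynomial.coeff_monom_mult[of 1 N g n] by (simp add: algebra_simps)
  then show ?case
    using less[of "n - N"] assms by (subst res_sum_rec[OF assms]) auto
qed

context three_primes
begin

text \<open>The weight with which the coefficient of Phi_pq at \<open>v\<close>, if
  \<open>v \<le> n div r\<close>, enters the coefficient of Phi_pqr at \<open>n\<close>.\<close>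

definition tally :: "nat \<Rightarrow> nat \<Rightarrow> int" where
  "tally n v = (\<Sum>m<p. of_bool ([r * v + m = n] (mod p * q)) - of_bool ([r * v + (m + q) = n] (mod p * q)))"

text \<open>The expansion of Phi_pq into monomials is left open: the diagonal argument indexes it by
  pairs \<alpha>, \<beta>, the flat case by the exponents.\<close>

lemma cyclotomic_coeff_tally:
  assumes "finite I" and f: "cyclotomic_poly (p * q) = (\<Sum>i\<in>I. Polynomial.smult (of_int (c i)) (X_pow (v i)))"
  shows "poly.coeff (cyclotomic_poly (p * q * r)) n
       = of_int (\<Sum>i\<in>I. c i * (of_bool (v i \<le> n div r) * tally n (v i)))"
proof -
  have pq: "p * q > 0" using pos by simp
  have lt: "m + q < p * q" if "m < p" for m
  proof -
    have "1 * 1 \<le> (p - 1) * (q - 1)" using p2 local.lt by (intro mult_le_mono) auto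
    then show ?thesis using that p2 local.lt by (simp add: algebra_simps)
  qed
  \<comment> \<open>This turns the truncation at \<open>n\<close> into one at
    \<open>n div r\<close>: if \<open>r * x \<le> n\<close>, an exponent congruent to
    \<open>n\<close> cannot exceed \<open>n\<close>, as it would do so by less than
    \<open>p * q\<close>.\<close>
  have le_iff: "r * x + e \<le> n \<and> [r * x + e = n] (mod p * q) \<longleftrightarrow>
      x \<le> n div r \<and> [r * x + e = n] (mod p * q)" if "e < p * q" for x e
  proof (intro iffI conjI; elim conjE; assumption?)
    assume "r * x + e \<le> n"
    then show "x \<le> n div r" using pos by (simp add: less_eq_div_iff_mult_less_eq mult.commute)
  next
    assume x: "x \<le> n div r" and c: "[r * x + e = n] (mod p * q)"
    have "r * x \<le> n" using x pos by (simp add: less_eq_div_iff_mult_less_eq mult.commute)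
    show "r * x + e \<le> n"
    proof (rule ccontr)
      assume "\<not> ?thesis"
      moreover have "p * q dvd r * x + e - n" using c calculation by (simp add: cong_altdef_nat)
      ultimately show False using dvd_imp_le[of "p * q" "r * x + e - n"] \<open>r * x \<le> n\<close> that by linarith
    qed
  qed
  have "pcompose (cyclotomic_poly (p * q)) (X_pow r) * (\<Sum>m<p. X_pow m) * (1 - X_pow q)
      = (\<Sum>i\<in>I. Polynomial.smult (of_int (c i)) (\<Sum>m<p. X_pow (r * v i + m) - X_pow (r * v i + (m + q))))"
    unfolding f by (simp add: pcompose_sum pcompose_smult pcompose_X_pow sum_distrib_right sum_distrib_left
        algebra_simps mult_monom sum_subtractf Polynomial.smult_diff_right)
  then have "poly.coeff (cyclotomic_poly (p * q * r)) n
      = (\<Sum>i\<in>I. of_int (c i) * (\<Sum>m<p. of_bool (r * v i + m \<le> n \<and> [r * v i + m = n] (mod p * q))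
          - of_bool (r * v i + (m + q) \<le> n \<and> [r * v i + (m + q) = n] (mod p * q))))"
    by (simp add: coeff_eq_res_sum[OF pq] cyclotomic_poly_quotient res_sum_sum res_sum_smult res_sum_diff res_sum_X_pow)
  also have "\<dots> = (\<Sum>i\<in>I. of_int (c i) * (\<Sum>m<p. of_bool (v i \<le> n div r \<and> [r * v i + m = n] (mod p * q))
          - of_bool (v i \<le> n div r \<and> [r * v i + (m + q) = n] (mod p * q))))"
  proof (intro sum.cong refl arg_cong2[where f = "(*)"])
    fix i m assume "m \<in> {..<p}"
    then have "m < p * q" "m + q < p * q" using lt[of m] by auto
    then show "(of_bool (r * v i + m \<le> n \<and> [r * v i + m = n] (mod p * q)) :: complex)
          - of_bool (r * v i + (m + q) \<le> n \<and> [r * v i + (m + q) = n] (mod p * q))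
        = of_bool (v i \<le> n div r \<and> [r * v i + m = n] (mod p * q))
          - of_bool (v i \<le> n div r \<and> [r * v i + (m + q) = n] (mod p * q))"
      by (simp only: le_iff)
  qed
  also have "\<dots> = of_int (\<Sum>i\<in>I. c i * (of_bool (v i \<le> n div r) * tally n (v i)))"
    by (simp add: tally_def of_bool_conj flip: sum_distrib_left right_diff_distrib)
  finally show ?thesis .
qed

text \<open>Multiplication by \<open>W\<close> clears the exponents lowered by \<open>p * q\<close>,
  and multiplication by \<open>(Y - 1) * (Z - 1)\<close> sums the four geometric series. The
  identity that remains rests only on \<open>Y ^ \<mu> * Z ^ \<nu> = X_pow 1 * W\<close>, which is
  the relation between \<open>\<mu>\<close> and \<open>\<nu>\<close>.\<close>

lemma cyclotomic_poly_two_primes_region: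
  fixes \<mu> \<nu> :: nat
  assumes inv: "\<mu> * p + \<nu> * q = p * q + 1" and le: "\<mu> \<le> q" "\<nu> \<le> p"
  defines "c \<equiv> \<lambda>(\<alpha>, \<beta>). of_bool (\<alpha> < \<mu> \<and> \<beta> < \<nu>) - of_bool (\<mu> \<le> \<alpha> \<and> \<nu> \<le> \<beta>) :: int"
    and "v \<equiv> \<lambda>(\<alpha>, \<beta>). if \<alpha> < \<mu> then \<alpha> * p + \<beta> * q else \<alpha> * p + \<beta> * q - p * q"
  shows "cyclotomic_poly (p * q) = (\<Sum>i\<in>{..<q} \<times> {..<p}. Polynomial.smult (of_int (c i)) (X_pow (v i)))"
proof -
  define Y Z W where "Y = X_pow p" and "Z = X_pow q" and "W = X_pow (p * q)"
  define F where "F = (\<Sum>i\<in>{..<q} \<times> {..<p}. Polynomial.smult (of_int (c i)) (X_pow (v i)))"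
  define S1 S2 T1 T2 where "S1 = (\<Sum>\<alpha><\<mu>. Y ^ \<alpha>)" and "S2 = (\<Sum>\<beta><\<nu>. Z ^ \<beta>)"
    and "T1 = (\<Sum>\<alpha>\<in>{\<mu>..<q}. Y ^ \<alpha>)" and "T2 = (\<Sum>\<beta>\<in>{\<nu>..<p}. Z ^ \<beta>)"
  have geo: "(x - 1) * (\<Sum>i\<in>{a..<b}. x ^ i) = x ^ b - x ^ a" if "a \<le> b" for x :: "complex poly" and a b
  proof -
    have "(\<Sum>i<b. x ^ i) = (\<Sum>i<a. x ^ i) + (\<Sum>i\<in>{a..<b}. x ^ i)"
      using sum.atLeastLessThan_concat[of 0 a b "\<lambda>i. x ^ i"] that by (simp add: atLeast0LessThan)
    then have "(x - 1) * (\<Sum>i<b. x ^ i) = (x - 1) * (\<Sum>i<a. x ^ i) + (x - 1) * (\<Sum>i\<in>{a..<b}. x ^ i)"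
      by (simp only: distrib_left)
    then show ?thesis by (simp only: power_diff_1_eq[symmetric]) (simp add: algebra_simps)
  qed
  have pw: "Y ^ q = W" "Z ^ p = W" "Y ^ \<mu> * Z ^ \<nu> = X_pow 1 * W"
    using inv by (simp_all add: Y_def Z_def W_def monom_power mult_monom mult.commute add.commute)
  have WF: "W * F = W * (S1 * S2) - T1 * T2"
  proof -
    have "W * Polynomial.smult (of_int (c (\<alpha>, \<beta>))) (X_pow (v (\<alpha>, \<beta>)))
        = of_bool (\<alpha> < \<mu> \<and> \<beta> < \<nu>) * (W * (Y ^ \<alpha> * Z ^ \<beta>)) - of_bool (\<mu> \<le> \<alpha> \<and> \<nu> \<le> \<beta>) * (Y ^ \<alpha> * Z ^ \<beta>)"
      for \<alpha> \<beta>
    proof (cases "\<mu> \<le> \<alpha> \<and> \<nu> \<le> \<beta>")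
      case True
      \<comment> \<open>At a negative coefficient the natural subtraction in \<open>v\<close> is
        exact.\<close>
      then have "\<mu> * p + \<nu> * q \<le> \<alpha> * p + \<beta> * q" by (intro add_mono mult_le_mono) auto
      then have "p * q \<le> \<alpha> * p + \<beta> * q" using inv by simp
      with True show ?thesis
        by (simp add: c_def v_def Y_def Z_def W_def monom_power mult_monom mult.commute)
    qed (auto simp: c_def v_def Y_def Z_def W_def monom_power mult_monom mult.commute)
    then have "W * F = (\<Sum>\<alpha><q. \<Sum>\<beta><p. of_bool (\<alpha> < \<mu> \<and> \<beta> < \<nu>) * (W * (Y ^ \<alpha> * Z ^ \<beta>))
        - of_bool (\<mu> \<le> \<alpha> \<and> \<nu> \<le> \<beta>) * (Y ^ \<alpha> * Z ^ \<beta>))"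
      unfolding F_def sum_distrib_left sum.cartesian_product by (intro sum.cong) auto
    also have "\<dots> = (\<Sum>\<alpha><q. \<Sum>\<beta><p. of_bool (\<alpha> < \<mu> \<and> \<beta> < \<nu>) * (W * (Y ^ \<alpha> * Z ^ \<beta>)))
        - (\<Sum>\<alpha><q. \<Sum>\<beta><p. of_bool (\<mu> \<le> \<alpha> \<and> \<nu> \<le> \<beta>) * (Y ^ \<alpha> * Z ^ \<beta>))"
      by (simp add: sum_subtractf)
    also have "(\<Sum>\<alpha><q. \<Sum>\<beta><p. of_bool (\<alpha> < \<mu> \<and> \<beta> < \<nu>) * (W * (Y ^ \<alpha> * Z ^ \<beta>))) = W * (S1 * S2)"
    proof -
      have "(\<Sum>\<alpha><q. \<Sum>\<beta><p. of_bool (\<alpha> < \<mu> \<and> \<beta> < \<nu>) * (W * (Y ^ \<alpha> * Z ^ \<beta>)))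
          = (\<Sum>\<alpha>\<in>{..<\<mu>}. \<Sum>\<beta>\<in>{..<\<nu>}. W * (Y ^ \<alpha> * Z ^ \<beta>))"
        unfolding sum.cartesian_product by (rule sum.mono_neutral_cong_right) (use le in auto)
      also have "\<dots> = W * (S1 * S2)" unfolding S1_def S2_def sum_product by (simp only: sum_distrib_left)
      finally show ?thesis .
    qed
    also have "(\<Sum>\<alpha><q. \<Sum>\<beta><p. of_bool (\<mu> \<le> \<alpha> \<and> \<nu> \<le> \<beta>) * (Y ^ \<alpha> * Z ^ \<beta>)) = T1 * T2"
    proof -
      have "(\<Sum>\<alpha><q. \<Sum>\<beta><p. of_bool (\<mu> \<le> \<alpha> \<and> \<nu> \<le> \<beta>) * (Y ^ \<alpha> * Z ^ \<beta>))
          = (\<Sum>\<alpha>\<in>{\<mu>..<q}. \<Sum>\<beta>\<in>{\<nu>..<p}. Y ^ \<alpha> * Z ^ \<beta>)"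
        unfolding sum.cartesian_product by (rule sum.mono_neutral_cong_right) (use le in auto)
      also have "\<dots> = T1 * T2" by (simp add: T1_def T2_def sum_product)
      finally show ?thesis .
    qed
    finally show ?thesis .
  qed
  have "W * F * ((Y - 1) * (Z - 1)) = W * (((Y - 1) * S1) * ((Z - 1) * S2)) - ((Y - 1) * T1) * ((Z - 1) * T2)"
    unfolding WF by (simp add: algebra_simps)
  also have "\<dots> = W * ((Y ^ \<mu> - 1) * (Z ^ \<nu> - 1)) - (W - Y ^ \<mu>) * (W - Z ^ \<nu>)"
    using geo[of 0 \<mu> Y] geo[of 0 \<nu> Z] geo[OF le(1), of Y] geo[OF le(2), of Z]
    by (simp add: S1_def S2_def T1_def T2_def atLeast0LessThan pw)
  also have "\<dots> = W * (X_pow 1 - 1) * (W - 1)"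
  proof -
    have "W * ((y - 1) * (z - 1)) - (W - y) * (W - z) = W * (x - 1) * (W - 1)" if "y * z = x * W"
      for x y z :: "complex poly"
    proof -
      have "W * ((y - 1) * (z - 1)) - (W - y) * (W - z) = W * (y * z) + W - W * W - y * z"
        by (simp add: algebra_simps)
      then show ?thesis unfolding that by (simp add: algebra_simps)
    qed
    then show ?thesis using pw(3) .
  qed
  also have "\<dots> = W * cyclotomic_poly (p * q) * ((Y - 1) * (Z - 1))"
    using arg_cong[OF cyclotomic_poly_two_primes, of "(*) W"] by (simp only: W_def Y_def Z_def mult_ac)
  finally have "F = cyclotomic_poly (p * q)"
    using unity_poly_nonzero pos by (simp add: W_def Y_def Z_def)
  then show ?thesis by (simp add: F_def)
qed

end

section \<open>Diagonal sums\<close>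

lemma sum_shift_telescope:
  fixes g :: "nat \<Rightarrow> int"
  shows "(\<Sum>m<k. g m - g (m + d)) = (\<Sum>m<d. g m) - (\<Sum>m<d. g (k + m))"
proof -
  have "(\<Sum>m<k. g m) + (\<Sum>m<d. g (k + m)) = (\<Sum>m<d. g m) + (\<Sum>m<k. g (d + m))"
    using sum_lessThan_add[of g k d] sum_lessThan_add[of g d k] by (simp add: add.commute)
  then show ?thesis by (simp add: sum_subtractf add.commute)
qed

lemma inj_on_shift_mod: "inj_on (\<lambda>m. (int m + c) mod int p) {..<p}"
proof (rule inj_onI)
  fix x y assume "x \<in> {..<p}" "y \<in> {..<p}" "(int x + c) mod int p = (int y + c) mod int p"
  then have "int p dvd (int x + c) - (int y + c)" by (simp add: mod_eq_dvd_iff)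
  then have "int p dvd int x - int y" by simp
  with \<open>x \<in> {..<p}\<close> \<open>y \<in> {..<p}\<close> show "x = y"
    using zdvd_imp_le[of "int p" "int x - int y"] zdvd_imp_le[of "int p" "int y - int x"]
    by (cases x y rule: linorder_cases) (auto simp: dvd_diff_commute)
qed

lemma sum_of_bool_le_1:
  assumes "inj_on b {..<p}"
  shows "(\<Sum>m<(p::nat). of_bool (P m) * of_bool (b m = e)) \<in> {0, 1 :: int}"
proof -
  define A where "A = {m. m < p \<and> P m \<and> b m = e}"
  have "(\<Sum>m<p. of_bool (P m) * of_bool (b m = e)) = (\<Sum>m\<in>A. 1 :: int)"
    by (rule sum.mono_neutral_cong_right) (auto simp: A_def)
  moreover have "card A \<le> 1"
  proof (rule card_le_Suc0_iff_eq[THEN iffD2, unfolded One_nat_def[symmetric]])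
    show "finite A" by (rule finite_subset[of _ "{..<p}"]) (auto simp: A_def)
    show "\<forall>a1\<in>A. \<forall>a2\<in>A. a1 = a2" using assms by (auto simp: A_def inj_on_def)
  qed
  ultimately show ?thesis by (cases "card A") auto
qed

text \<open>A jump of the rows at \<open>k\<close> contributes a telescoping sum bounded by \<open>d\<close>, and a defect in the
  single column \<open>e\<close> contributes at most 1.\<close>

lemma shifted_diagonal_bound:
  fixes \<rho> :: "nat \<Rightarrow> int \<Rightarrow> int" and c :: int
  assumes p: "p > 0" and k: "k \<le> p"
    and \<rho>: "\<And>m b. m < p \<Longrightarrow> 0 \<le> b \<Longrightarrow> b < int p \<Longrightarrow>
      \<rho> m b = C m + P b + of_bool (m < k) * f b + \<sigma> * (of_bool (R m) * of_bool (b = e))"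
    and f: "\<And>b. f b \<in> {0, 1}" and \<sigma>: "\<bar>\<sigma>\<bar> \<le> 1"
  shows "\<bar>\<Sum>m<p. \<rho> m ((int m + c) mod int p) - \<rho> m ((int (m + d) + c) mod int p)\<bar> \<le> int d + 1"
proof -
  define b where "b m = (int m + c) mod int p" for m
  have b: "0 \<le> b m" "b m < int p" for m using p by (auto simp: b_def)
  have per: "b (p + m) = b m" for m by (simp add: b_def add.assoc)
  have "(\<Sum>m<p. \<rho> m (b m) - \<rho> m (b (m + d))) = (\<Sum>m<p. (P (b m) - P (b (m + d)))
      + of_bool (m < k) * (f (b m) - f (b (m + d)))
      + \<sigma> * (of_bool (R m) * of_bool (b m = e) - of_bool (R m) * of_bool (b (m + d) = e)))"
    using b by (intro sum.cong) (auto simp: \<rho> algebra_simps)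
  also have "\<dots> = (\<Sum>m<p. P (b m) - P (b (m + d))) + (\<Sum>m<p. of_bool (m < k) * (f (b m) - f (b (m + d))))
      + \<sigma> * ((\<Sum>m<p. of_bool (R m) * of_bool (b m = e)) - (\<Sum>m<p. of_bool (R m) * of_bool (b (m + d) = e)))"
    by (simp only: sum.distrib sum_subtractf flip: sum_distrib_left)
  \<comment> \<open>A part depending on the column alone cancels over a full period of columns; the
    part \<open>C\<close> depending on the row alone has already cancelled termwise.\<close>
  also have "(\<Sum>m<p. P (b m) - P (b (m + d))) = 0"
    using sum_shift_telescope[of "\<lambda>m. P (b m)" d p] by (simp add: per)
  also have "(\<Sum>m<p. of_bool (m < k) * (f (b m) - f (b (m + d)))) = (\<Sum>m<k. f (b m) - f (b (m + d)))"
    by (rule sum.mono_neutral_cong_right) (use k in auto)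
  also have "\<dots> = (\<Sum>m<d. f (b m)) - (\<Sum>m<d. f (b (k + m)))"
    by (rule sum_shift_telescope)
  finally have eq: "(\<Sum>m<p. \<rho> m (b m) - \<rho> m (b (m + d))) = (\<Sum>m<d. f (b m)) - (\<Sum>m<d. f (b (k + m)))
      + \<sigma> * ((\<Sum>m<p. of_bool (R m) * of_bool (b m = e)) - (\<Sum>m<p. of_bool (R m) * of_bool (b (m + d) = e)))"
    by simp
  have fs: "0 \<le> (\<Sum>m<d. f (g m)) \<and> (\<Sum>m<d. f (g m)) \<le> int d" for g :: "nat \<Rightarrow> int"
  proof -
    have "0 \<le> f x" "f x \<le> 1" for x using f[of x] by auto
    then show ?thesis
      using sum_nonneg[of "{..<d}" "\<lambda>m. f (g m)"] sum_bounded_above[of "{..<d}" "\<lambda>m. f (g m)" 1] by simp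
  qed
  have i1: "inj_on b {..<p}" using inj_on_shift_mod[of c p] by (simp add: b_def[abs_def])
  have i2: "inj_on (\<lambda>m. b (m + d)) {..<p}"
    using inj_on_shift_mod[of "int d + c" p] by (simp add: b_def add.assoc)
  have y: "\<bar>(\<Sum>m<p. of_bool (R m) * of_bool (b m = e)) - (\<Sum>m<p. of_bool (R m) * of_bool (b (m + d) = e))\<bar> \<le> (1::int)"
    using sum_of_bool_le_1[OF i1, of R e] sum_of_bool_le_1[OF i2, of R e] by auto
  have "\<bar>\<sigma> * ((\<Sum>m<p. of_bool (R m) * of_bool (b m = e)) - (\<Sum>m<p. of_bool (R m) * of_bool (b (m + d) = e)))\<bar> \<le> 1 * 1"
    unfolding abs_mult using \<sigma> y by (intro mult_mono) auto
  then show ?thesis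
    unfolding eq[unfolded b_def] b_def[symmetric] using fs[of b] fs[of "\<lambda>m. b (k + m)"] eq
    by (simp only: b_def[symmetric]) linarith
qed

text \<open>The coefficient of Phi_pq belonging to \<alpha>, \<beta>, replaced by 0 if its exponent
  exceeds \<open>J\<close>. Exponents of negative coefficients are lowered by \<open>p * q\<close>,
  hence the bound \<open>J + p * q\<close>.\<close>

definition region :: "int \<Rightarrow> int \<Rightarrow> int \<Rightarrow> int \<Rightarrow> int \<Rightarrow> int \<Rightarrow> int \<Rightarrow> int" where
  "region p q \<mu> \<nu> J \<alpha> \<beta> = of_bool (\<alpha> < \<mu> \<and> \<beta> < \<nu> \<and> \<alpha> * p + \<beta> * q \<le> J)
     - of_bool (\<mu> \<le> \<alpha> \<and> \<nu> \<le> \<beta> \<and> \<alpha> * p + \<beta> * q \<le> J + p * q)"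

text \<open>Point \<open>m\<close> is the solution \<open>v\<close> of \<open>r * v + m = n\<close>
  modulo \<open>p * q\<close> in the coordinates \<alpha>, \<beta>; see
  \<open>region_residue_iff\<close>.\<close>

definition diagonal_sum :: "nat \<Rightarrow> nat \<Rightarrow> int \<Rightarrow> int \<Rightarrow> int \<Rightarrow> nat \<Rightarrow> int \<Rightarrow> int" where
  "diagonal_sum p q \<mu> \<nu> J d n = (\<Sum>m<p.
     region (int p) (int q) \<mu> \<nu> J ((n - int m) mod int q) ((int m - n) mod int p)
   - region (int p) (int q) \<mu> \<nu> J ((n - int m) mod int q) ((int (m + d) - n) mod int p))"

lemma le_div_iff: "(\<beta>::int) * q \<le> x \<longleftrightarrow> \<beta> < x div q + 1" if "q > 0"
proof
  assume "\<beta> * q \<le> x"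
  then show "\<beta> < x div q + 1" using zdiv_mono1[of "\<beta> * q" x q] that by simp
next
  assume "\<beta> < x div q + 1"
  then have "\<beta> * q \<le> x div q * q" using that by (intro mult_right_mono) auto
  also have "\<dots> \<le> x" using that pos_mod_sign[of q x] div_mult_mod_eq[of x q] by linarith
  finally show "\<beta> * q \<le> x" .
qed

lemma diagonal_sum_bound:
  assumes p: "p > 0" and q: "p * p < q" and \<mu>: "int p \<le> \<mu>" "\<mu> \<le> int q - int p" and \<nu>: "0 \<le> \<nu>" "\<nu> \<le> int p"
  shows "\<bar>diagonal_sum p q \<mu> \<nu> J d n\<bar> \<le> int d + 1"
proof -
  have q0: "q > 0" using q by simp
  define a where "a = n mod int q"
  have a: "0 \<le> a" "a < int q" using q0 by (auto simp: a_def)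
  \<comment> \<open>\<open>E \<alpha>\<close> is the first column of row \<alpha> beyond the
    truncation, negative if even column 0 lies far beyond it.\<close>
  define E where "E \<alpha> = (J - \<alpha> * int p) div int q + 1" for \<alpha>
  have E: "\<alpha> * int p + \<beta> * int q \<le> J \<longleftrightarrow> \<beta> < E \<alpha>" for \<alpha> \<beta>
    using le_div_iff[of "int q" \<beta> "J - \<alpha> * int p"] q0 by (simp add: E_def algebra_simps)
  have E_shift: "E (\<alpha> + int q) = E \<alpha> - int p" for \<alpha>
  proof -
    have "J - (\<alpha> + int q) * int p = (J - \<alpha> * int p) + (- int p) * int q" by (simp add: algebra_simps)
    then show ?thesis unfolding E_def using q0 by (simp only: div_mult_self1)
  qed
  have E': "\<alpha> * int p + \<beta> * int q \<le> J + int p * int q \<longleftrightarrow> \<beta> < E \<alpha> + int p" for \<alpha> \<beta>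
    using E[of \<alpha> "\<beta> - int p"] by (simp add: algebra_simps)
  define e0 where "e0 = E a"
  \<comment> \<open>Over the \<open>p\<close> rows \<open>\<alpha> * p\<close> varies by less than
    \<open>p * p < q\<close>, so the border is \<open>e0\<close> or \<open>e0 + 1\<close>;
    \<open>M\<close> marks the rows of the second kind.\<close>
  define M where "M m \<longleftrightarrow> E (a - int m) = e0 + 1" for m :: nat
  have Em: "E (a - int m) = e0 + of_bool (M m)" if "m < p" for m
  proof -
    define x where "x = J - a * int p"
    have "J - (a - int m) * int p = x + int m * int p" by (simp add: x_def algebra_simps)
    moreover have "0 \<le> int m * int p" "int m * int p < int q"
    proof -
      have "m * p < q" using that q mult_le_mono1[of m p p] by linarith
      then show "int m * int p < int q" by (metis of_nat_less_iff of_nat_mult)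
    qed simp
    then have "(x + int m * int p) div int q \<in> {x div int q, x div int q + 1}"
      by (smt (verit) insertCI q0 of_nat_0_less_iff zdiv_mono1 div_add_self2 add_diff_cancel_right')
    ultimately show ?thesis by (auto simp: M_def e0_def E_def x_def[symmetric])
  qed
  define \<rho> where "\<rho> m b = region (int p) (int q) \<mu> \<nu> J ((n - int m) mod int q) b" for m b
  have S: "diagonal_sum p q \<mu> \<nu> J d n
      = (\<Sum>m<p. \<rho> m ((int m + (- n)) mod int p) - \<rho> m ((int (m + d) + (- n)) mod int p))"
    by (simp add: diagonal_sum_def \<rho>_def)
  have mod1: "(n - int m) mod int q = a - int m" if "int m \<le> a" for m
  proof -
    have "(n - int m) mod int q = (a - int m) mod int q" by (simp add: a_def mod_diff_left_eq)
    then show ?thesis using that a by simp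
  qed
  have mod2: "(n - int m) mod int q = a - int m + int q" if "a < int m" "m < p" for m
  proof -
    have "p \<le> p * p" by simp
    then have "m < q" using that q by linarith
    have "(n - int m) mod int q = (a - int m) mod int q" by (simp add: a_def mod_diff_left_eq)
    also have "\<dots> = (a - int m + int q) mod int q" by simp
    also have "\<dots> = a - int m + int q" using that a \<open>m < q\<close> by (intro mod_pos_pos_trivial) auto
    finally show ?thesis .
  qed
  show ?thesis
  \<comment> \<open>The question is whether \<alpha> wraps below 0 within the \<open>p\<close> rows.
    If not, at most the line \<alpha> = \<mu> is crossed. If it does, the rows before the wrap lie
    below \<mu> and those after it above, since \<mu> keeps distance \<open>p\<close> from 0 and
    \<open>q\<close>. In both cases the shape changes at the single row \<open>k\<close>.\<close>
  proof (cases "a \<ge> int p - 1")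
    case True
    define k where "k = min p (nat (a - \<mu> + 1))"
    have k: "m < k \<longleftrightarrow> \<mu> \<le> a - int m" if "m < p" for m using that by (auto simp: k_def)
    have \<rho>_eq: "\<rho> m b = of_bool (\<not> m < k \<and> b < \<nu> \<and> b < e0 + of_bool (M m))
        - of_bool (m < k \<and> \<nu> \<le> b \<and> b < e0 + of_bool (M m) + int p)" if "m < p" for m b
    proof -
      have "int m \<le> a" using that True by linarith
      then show ?thesis
        by (simp add: \<rho>_def mod1 region_def E E' Em[OF that] k[OF that] not_le)
    qed
    show ?thesis
    \<comment> \<open>In all four decompositions \<open>P\<close> is the shape of the rows from
      \<open>k\<close> on with border \<open>e0\<close>, \<open>C\<close> and \<open>f\<close> give
      the change in the rows before \<open>k\<close>, and \<open>e\<close> is the column affected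
      where \<open>M\<close> holds. For \<open>e0 \<ge> 0\<close> the border does not cut the
      negative rows; for \<open>e0 < 0\<close> the positive rows are empty.\<close>
    proof (cases "e0 \<ge> 0")
      case e0: True
      show ?thesis unfolding S
      proof (rule shifted_diagonal_bound[OF p, where k = k and C = "\<lambda>m. - of_bool (m < k)"
            and P = "\<lambda>b. of_bool (b < min \<nu> e0)" and f = "\<lambda>b. of_bool (min \<nu> e0 \<le> b \<and> b < \<nu>)"
            and \<sigma> = "of_bool (e0 < \<nu>)" and R = "\<lambda>m. \<not> m < k \<and> M m" and e = e0])
        fix m b assume "m < p" "0 \<le> b" "b < int p"
        then show "\<rho> m b = - of_bool (m < k) + of_bool (b < min \<nu> e0)
            + of_bool (m < k) * of_bool (min \<nu> e0 \<le> b \<and> b < \<nu>)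
            + of_bool (e0 < \<nu>) * (of_bool (\<not> m < k \<and> M m) * of_bool (b = e0))"
          using e0 by (auto simp: \<rho>_eq of_bool_def)
      qed (auto simp: k_def)
    next
      case e0: False
      show ?thesis unfolding S
      proof (rule shifted_diagonal_bound[OF p, where k = k and C = "\<lambda>m. - of_bool (m < k)"
            and P = "\<lambda>b. 0" and f = "\<lambda>b. of_bool (\<not> (\<nu> \<le> b \<and> b < e0 + int p))"
            and \<sigma> = "- of_bool (\<nu> \<le> e0 + int p)" and R = "\<lambda>m. m < k \<and> M m" and e = "e0 + int p"])
        fix m b assume "m < p" "0 \<le> b" "b < int p"
        then show "\<rho> m b = - of_bool (m < k) + 0
            + of_bool (m < k) * of_bool (\<not> (\<nu> \<le> b \<and> b < e0 + int p))
            + - of_bool (\<nu> \<le> e0 + int p) * (of_bool (m < k \<and> M m) * of_bool (b = e0 + int p))"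
          using e0 by (auto simp: \<rho>_eq of_bool_def)
      qed (auto simp: k_def)
    qed
  next
    case False
    define k where "k = nat (a + 1)"
    have k: "m < k \<longleftrightarrow> int m \<le> a" for m using a by (auto simp: k_def)
    have kp: "k \<le> p" using False by (auto simp: k_def)
    \<comment> \<open>Wrapping raises \<alpha> by \<open>q\<close> and lowers the border by
      \<open>p\<close>, which cancels the gain from \<open>J + p * q\<close>: both types of rows see
      the same border.\<close>
    have \<rho>_eq: "\<rho> m b = of_bool (m < k \<and> b < \<nu> \<and> b < e0 + of_bool (M m))
        - of_bool (\<not> m < k \<and> \<nu> \<le> b \<and> b < e0 + of_bool (M m))" if "m < p" for m b
    proof (cases "m < k")
      case True
      then have "int m \<le> a" by (simp add: k)
      moreover have "a - int m < \<mu>" using False \<mu> by linarith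
      ultimately show ?thesis using True
        by (simp add: \<rho>_def mod1 region_def E E' Em[OF that] not_le)
    next
      case mk: False
      then have "a < int m" by (simp add: k)
      moreover have "\<mu> \<le> a - int m + int q" using a that \<mu> by linarith
      ultimately show ?thesis using mk that
        by (simp add: \<rho>_def mod2 region_def E' E_shift Em[OF that])
    qed
    show ?thesis
    \<comment> \<open>A border below \<nu> leaves the negative rows empty; a border from \<nu> on
      does not cut the positive ones.\<close>
    proof (cases "e0 < \<nu>")
      case e0: True
      show ?thesis unfolding S
      proof (rule shifted_diagonal_bound[OF p kp, where C = "\<lambda>m. 0"
            and P = "\<lambda>b. 0" and f = "\<lambda>b. of_bool (b < e0)"
            and \<sigma> = 1 and R = "\<lambda>m. m < k \<and> M m" and e = e0])
        fix m b assume "m < p" "0 \<le> b" "b < int p"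
        then show "\<rho> m b = 0 + 0 + of_bool (m < k) * of_bool (b < e0)
            + 1 * (of_bool (m < k \<and> M m) * of_bool (b = e0))"
          using e0 by (auto simp: \<rho>_eq of_bool_def)
      qed auto
    next
      case e0: False
      show ?thesis unfolding S
      proof (rule shifted_diagonal_bound[OF p kp, where C = "\<lambda>m. 0"
            and P = "\<lambda>b. - of_bool (\<nu> \<le> b \<and> b < e0)" and f = "\<lambda>b. of_bool (b < e0)"
            and \<sigma> = "-1" and R = "\<lambda>m. \<not> m < k \<and> M m" and e = e0])
        fix m b assume "m < p" "0 \<le> b" "b < int p"
        then show "\<rho> m b = 0 + - of_bool (\<nu> \<le> b \<and> b < e0) + of_bool (m < k) * of_bool (b < e0)
            + (-1) * (of_bool (\<not> m < k \<and> M m) * of_bool (b = e0))"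
          using e0 by (auto simp: \<rho>_eq of_bool_def)
      qed auto
    qed
  qed
qed

section \<open>From coefficients to diagonal sums\<close>

lemma dvd_diff_iff_eq_mod: "0 \<le> x \<Longrightarrow> x < k \<Longrightarrow> k dvd x - y \<longleftrightarrow> x = y mod k" for x y k :: int
  using mod_eq_dvd_iff[of x k y] by simp

lemma sum_Times_of_bool_eq:
  fixes f :: "nat \<Rightarrow> nat \<Rightarrow> int"
  assumes "A < q" "B < p"
  shows "(\<Sum>(\<alpha>, \<beta>)\<in>{..<q} \<times> {..<p}. f \<alpha> \<beta> * of_bool (\<alpha> = A \<and> \<beta> = B)) = f A B"
proof -
  have "(\<Sum>(\<alpha>, \<beta>)\<in>{..<q} \<times> {..<p}. f \<alpha> \<beta> * of_bool (\<alpha> = A \<and> \<beta> = B))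
      = (\<Sum>x\<in>{..<q} \<times> {..<p}. if x = (A, B) then f A B else 0)"
    by (intro sum.cong) auto
  then show ?thesis using assms by simp
qed

context three_primes
begin

text \<open>By the choice of \<open>r\<close>, the number \<open>r * v\<close> is \<alpha> modulo
  \<open>q\<close> and -\<beta> modulo \<open>p\<close>; the Chinese remainder theorem combines the
  two. The integer \<epsilon> covers both signs of the region.\<close>

lemma region_residue_iff:
  assumes rp: "[r * p = 1] (mod q)" and rq: "p dvd r * q + 1"
    and \<alpha>\<beta>: "\<alpha> < q" "\<beta> < p" and v: "int v = int \<alpha> * int p + int \<beta> * int q - \<epsilon> * (int p * int q)"
  shows "[r * v + e = n] (mod p * q) \<longleftrightarrow>
    int \<alpha> = (int n - int e) mod int q \<and> int \<beta> = (int e - int n) mod int p"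
proof -
  define X where "X = int (r * v + e) - int n"
  obtain t where t: "int r * int p = 1 + int q * t"
    using rp by (metis cong_iff_lin cong_int_iff cong_sym of_nat_1 of_nat_mult)
  obtain s where s: "int r * int q + 1 = int p * s"
    using rq by (metis dvdE int_dvd_int_iff of_nat_1 of_nat_add of_nat_mult)
  have "X = (int \<alpha> - (int n - int e)) + int q * (t * int \<alpha> + int r * (int \<beta> - \<epsilon> * int p))"
  proof -
    have "X = (int r * int p) * int \<alpha> + int q * (int r * (int \<beta> - \<epsilon> * int p)) + int e - int n"
      unfolding X_def by (simp add: v algebra_simps)
    then show ?thesis unfolding t by (simp add: algebra_simps)
  qed
  then have "int q dvd X \<longleftrightarrow> int q dvd int \<alpha> - (int n - int e)"
    using dvd_add_left_iff[OF dvd_triv_left] by metis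
  also have "\<dots> \<longleftrightarrow> int \<alpha> = (int n - int e) mod int q"
    using \<alpha>\<beta> by (intro dvd_diff_iff_eq_mod) auto
  finally have 1: "int q dvd X \<longleftrightarrow> int \<alpha> = (int n - int e) mod int q" .
  have "X = - (int \<beta> - (int e - int n)) + int p * (s * int \<beta> + int r * (int \<alpha> - \<epsilon> * int q))"
  proof -
    have "X = (int r * int q + 1) * int \<beta> - int \<beta> + int p * (int r * (int \<alpha> - \<epsilon> * int q)) + int e - int n"
      unfolding X_def by (simp add: v algebra_simps)
    then show ?thesis unfolding s by (simp add: algebra_simps)
  qed
  then have "int p dvd X \<longleftrightarrow> int p dvd - (int \<beta> - (int e - int n))"
    using dvd_add_left_iff[OF dvd_triv_left] by metis
  also have "\<dots> \<longleftrightarrow> int \<beta> = (int e - int n) mod int p"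
    unfolding dvd_minus_iff using \<alpha>\<beta> by (intro dvd_diff_iff_eq_mod) auto
  finally have 2: "int p dvd X \<longleftrightarrow> int \<beta> = (int e - int n) mod int p" .
  have "[r * v + e = n] (mod p * q) \<longleftrightarrow> int (p * q) dvd X"
    unfolding X_def by (metis cong_iff_dvd_diff cong_int_iff)
  also have "\<dots> \<longleftrightarrow> int p dvd X \<and> int q dvd X"
    using coprimes(1) by (metis coprime_int_iff divides_mult dvd_mult_left dvd_mult_right of_nat_mult)
  finally show ?thesis using 1 2 by blast
qed

lemma cyclotomic_coeff_diagonal:
  fixes \<mu> \<nu> d :: nat
  assumes rp: "[r * p = 1] (mod q)" and rq: "p dvd r * q + 1"
    and inv: "\<mu> * p + \<nu> * q = p * q + 1" and le: "\<mu> \<le> q" "\<nu> \<le> p" and d: "[q = d] (mod p)"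
  shows "poly.coeff (cyclotomic_poly (p * q * r)) n
       = of_int (diagonal_sum p q (int \<mu>) (int \<nu>) (int (n div r)) d (int n))"
proof -
  define J where "J = n div r"
  define c where "c = (\<lambda>(\<alpha>, \<beta>). of_bool (\<alpha> < \<mu> \<and> \<beta> < \<nu>) - of_bool (\<mu> \<le> \<alpha> \<and> \<nu> \<le> \<beta>) :: int)"
  define v where "v = (\<lambda>(\<alpha>, \<beta>). if \<alpha> < \<mu> then \<alpha> * p + \<beta> * q else \<alpha> * p + \<beta> * q - p * q)"
  define F where "F \<alpha> \<beta> = region (int p) (int q) (int \<mu>) (int \<nu>) (int J) (int \<alpha>) (int \<beta>)" for \<alpha> \<beta>
  define A where "A m = nat ((int n - int m) mod int q)" for m
  define B where "B m = nat ((int m - int n) mod int p)" for m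
  have AB: "A m < q" "B m < p" "int (A m) = (int n - int m) mod int q" "int (B m) = (int m - int n) mod int p" for m
    using pos by (auto simp: A_def B_def nat_less_iff)
  \<comment> \<open>The factor 1 - x^q adds \<open>q\<close> to the offset: the row is unchanged
    modulo \<open>q\<close>, and the column moves by \<open>d\<close> modulo
    \<open>p\<close>.\<close>
  have A_q: "A (m + q) = A m" for m
    using minus_mod_self2[of "int n - int m" "int q"] by (simp add: A_def algebra_simps)
  have B_q: "B (m + q) = B (m + d)" for m
  proof -
    have "[int q = int d] (mod int p)" using d by (simp add: cong_int_iff)
    then have "[int m + int q - int n = int m + int d - int n] (mod int p)"
      by (intro cong_diff cong_add) auto
    then show ?thesis by (simp add: B_def unique_euclidean_semiring_class.cong_def)
  qed
  have eq: "c (\<alpha>, \<beta>) * (of_bool (v (\<alpha>, \<beta>) \<le> J) * tally n (v (\<alpha>, \<beta>)))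
      = (\<Sum>m<p. F \<alpha> \<beta> * of_bool (\<alpha> = A m \<and> \<beta> = B m) - F \<alpha> \<beta> * of_bool (\<alpha> = A m \<and> \<beta> = B (m + d)))"
    if \<alpha>\<beta>: "\<alpha> < q" "\<beta> < p" for \<alpha> \<beta>
  proof (cases "\<alpha> < \<mu> \<longleftrightarrow> \<beta> < \<nu>")
    case False
    then show ?thesis by (auto simp: c_def F_def region_def)
  next
    case True
    have ge: "p * q \<le> \<alpha> * p + \<beta> * q" if "\<not> \<alpha> < \<mu>"
    proof -
      have "\<mu> * p + \<nu> * q \<le> \<alpha> * p + \<beta> * q" using True that by (intro add_mono mult_le_mono) auto
      then show ?thesis using inv by simp
    qed
    have v: "int (v (\<alpha>, \<beta>)) = int \<alpha> * int p + int \<beta> * int q - of_bool (\<not> \<alpha> < \<mu>) * (int p * int q)"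
      using ge by (auto simp: v_def of_nat_diff)
    have F: "c (\<alpha>, \<beta>) * of_bool (v (\<alpha>, \<beta>) \<le> J) = F \<alpha> \<beta>"
    proof -
      have "v (\<alpha>, \<beta>) \<le> J \<longleftrightarrow> int (v (\<alpha>, \<beta>)) \<le> int J" by simp
      then show ?thesis unfolding v using True
        by (auto simp: c_def F_def region_def of_bool_def algebra_simps)
    qed
    have iff: "[r * v (\<alpha>, \<beta>) + e = n] (mod p * q) \<longleftrightarrow> \<alpha> = A e \<and> \<beta> = B e" for e
      using region_residue_iff[OF rp rq \<alpha>\<beta> v, of e n] unfolding AB(3,4)[symmetric] by simp
    have "tally n (v (\<alpha>, \<beta>)) = (\<Sum>m<p. of_bool (\<alpha> = A m \<and> \<beta> = B m) - of_bool (\<alpha> = A m \<and> \<beta> = B (m + d)))"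
      unfolding tally_def iff A_q B_q ..
    then show ?thesis
      by (simp only: mult.assoc[symmetric] F) (simp only: sum_distrib_left right_diff_distrib)
  qed
  have "(\<Sum>i\<in>{..<q} \<times> {..<p}. c i * (of_bool (v i \<le> J) * tally n (v i)))
      = (\<Sum>i\<in>{..<q} \<times> {..<p}. \<Sum>m<p. case i of (\<alpha>, \<beta>) \<Rightarrow>
          F \<alpha> \<beta> * of_bool (\<alpha> = A m \<and> \<beta> = B m) - F \<alpha> \<beta> * of_bool (\<alpha> = A m \<and> \<beta> = B (m + d)))"
  proof (intro sum.cong refl)
    fix i assume "i \<in> {..<q} \<times> {..<p}"
    then obtain \<alpha> \<beta> where "i = (\<alpha>, \<beta>)" "\<alpha> < q" "\<beta> < p" by auto
    then show "c i * (of_bool (v i \<le> J) * tally n (v i)) = (\<Sum>m<p. case i of (\<alpha>, \<beta>) \<Rightarrow>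
          F \<alpha> \<beta> * of_bool (\<alpha> = A m \<and> \<beta> = B m) - F \<alpha> \<beta> * of_bool (\<alpha> = A m \<and> \<beta> = B (m + d)))"
      by (simp only: eq prod.case)
  qed
  also have "\<dots> = (\<Sum>m<p. \<Sum>(\<alpha>, \<beta>)\<in>{..<q} \<times> {..<p}.
      F \<alpha> \<beta> * of_bool (\<alpha> = A m \<and> \<beta> = B m) - F \<alpha> \<beta> * of_bool (\<alpha> = A m \<and> \<beta> = B (m + d)))"
    by (rule sum.swap)
  also have "\<dots> = (\<Sum>m<p. F (A m) (B m) - F (A m) (B (m + d)))"
  proof (rule sum.cong)
    fix m
    have "(\<Sum>(\<alpha>, \<beta>)\<in>{..<q} \<times> {..<p}. F \<alpha> \<beta> * of_bool (\<alpha> = A m \<and> \<beta> = B m) - F \<alpha> \<beta> * of_bool (\<alpha> = A m \<and> \<beta> = B (m + d)))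
      = (\<Sum>(\<alpha>, \<beta>)\<in>{..<q} \<times> {..<p}. F \<alpha> \<beta> * of_bool (\<alpha> = A m \<and> \<beta> = B m))
      - (\<Sum>(\<alpha>, \<beta>)\<in>{..<q} \<times> {..<p}. F \<alpha> \<beta> * of_bool (\<alpha> = A m \<and> \<beta> = B (m + d)))"
      unfolding case_prod_unfold by (rule sum_subtractf)
    then show "(\<Sum>(\<alpha>, \<beta>)\<in>{..<q} \<times> {..<p}. F \<alpha> \<beta> * of_bool (\<alpha> = A m \<and> \<beta> = B m) - F \<alpha> \<beta> * of_bool (\<alpha> = A m \<and> \<beta> = B (m + d)))
      = F (A m) (B m) - F (A m) (B (m + d))"
      by (simp only: sum_Times_of_bool_eq[OF AB(1,2)])
  qed auto
  also have "\<dots> = diagonal_sum p q (int \<mu>) (int \<nu>) (int J) d (int n)"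
    unfolding diagonal_sum_def F_def AB(3,4) ..
  finally show ?thesis
    using cyclotomic_coeff_tally[OF _ cyclotomic_poly_two_primes_region[OF inv le], of n]
    by (simp add: c_def v_def J_def)
qed

end

section \<open>Extremal diagonals\<close>

lemma mod_wrap: "x mod k = (if 0 \<le> x then x else x + k)" if "- k \<le> x" "x < k" for x k :: int
proof (cases "0 \<le> x")
  case False
  have "x mod k = (x + k) mod k" by simp
  also have "\<dots> = x + k" using that False by (intro mod_pos_pos_trivial) auto
  finally show ?thesis using False by simp
qed (use that in simp)

text \<open>The points \<open>(d - m, m)\<close> with \<open>m \<le> d\<close> lie in the positive
  part. Their largest exponent \<open>d * q\<close>, at \<open>m = d\<close>, is taken as
  \<open>J\<close>, so they all count, while the shifted points \<open>(d - m, m + d)\<close> are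
  cut off. For \<open>m > d\<close> the row wraps into the range above \<mu> and nothing is
  counted.\<close>

lemma diagonal_sum_witness_1:
  assumes d: "0 < d" "2 * d < p" and q: "p * p < q" and \<mu>: "int p \<le> \<mu>" "\<mu> \<le> int q - int p" and \<nu>: "int d < \<nu>"
    and n: "n mod int q = int d" "n mod int p = 0"
  shows "diagonal_sum p q \<mu> \<nu> (int (d * q)) d n = int d + 1"
proof -
  have "p \<le> p * p" by simp
  then have pq: "p < q" using q by linarith
  have pos: "0 < p" "0 < q" using d pq by auto
  have m1: "(n - int m) mod int q = (if m \<le> d then int d - int m else int d - int m + int q)" if "m < p" for m
  proof -
    have "(n - int m) mod int q = (int d - int m) mod int q" by (metis n(1) mod_diff_left_eq)
    then show ?thesis using that pq d mod_wrap[of "int q" "int d - int m"] by auto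
  qed
  have m2: "(int m - n) mod int p = int m mod int p" for m
    using n(2) by (metis diff_zero mod_diff_right_eq)
  have "diagonal_sum p q \<mu> \<nu> (int (d * q)) d n = (\<Sum>m<p. of_bool (m \<le> d))"
    unfolding diagonal_sum_def
  proof (rule sum.cong)
    fix m assume "m \<in> {..<p}"
    then have m: "m < p" by simp
    have md: "(int (m + d) - n) mod int p = (if m + d < p then int m + int d else int m + int d - int p)"
    proof -
      have "int (m + d) mod int p = (int m + int d - int p) mod int p" by simp
      then show ?thesis unfolding m2 using m d mod_wrap[of "int p" "int m + int d - int p"] by auto
    qed
    have mm: "(int m - n) mod int p = int m" unfolding m2 using m by simp
    show "region (int p) (int q) \<mu> \<nu> (int (d * q)) ((n - int m) mod int q) ((int m - n) mod int p) -
        region (int p) (int q) \<mu> \<nu> (int (d * q)) ((n - int m) mod int q) ((int (m + d) - n) mod int p)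
        = of_bool (m \<le> d)"
    proof (cases "m \<le> d")
      case True
      have 1: "(int d - int m) * int p + int m * int q \<le> int d * int q"
      proof -
        have "(int d - int m) * int p \<le> (int d - int m) * int q" using True pq by (intro mult_left_mono) auto
        then show ?thesis by (simp add: algebra_simps)
      qed
      have 2: "\<not> (int d - int m) * int p + (int m + int d) * int q \<le> int d * int q"
      proof -
        have "0 < (int d - int m) * int p + int m * int q"
        proof (cases "m = 0")
          case False
          then show ?thesis using True pos by (intro add_nonneg_pos) auto
        qed (use d pos in simp)
        then show ?thesis by (simp add: algebra_simps)
      qed
      show ?thesis using True 1 2 d \<mu> \<nu> m unfolding m1[OF m] mm md region_def by simp
    next
      case False
      have lt: "(int m - int d) * int p < (int m - int d) * int q"
        using False pq by (intro mult_strict_left_mono) auto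
      have 1: "\<not> (int d - int m + int q) * int p + int m * int q \<le> int d * int q + int p * int q"
        using lt by (simp add: algebra_simps)
      have 2: "\<not> (int d - int m + int q) * int p + (int m + int d) * int q \<le> int d * int q + int p * int q"
      proof -
        have "int m * int q + (int d - int m + int q) * int p
            \<le> (int d - int m + int q) * int p + (int m + int d) * int q"
          by (simp add: algebra_simps)
        moreover have "int m * int p \<le> int m * int q" using pq by (intro mult_left_mono) auto
        moreover have "0 < int d * int p" using d pos by simp
        ultimately show ?thesis by (simp add: algebra_simps)
      qed
      have 3: "\<mu> \<le> int d - int m + int q" using \<mu> m by linarith
      have 4: "int m + int d - int p < \<nu>" using \<nu> m by linarith
      show ?thesis using False 1 2 3 4 unfolding m1[OF m] mm md region_def by simp
    qed
  qed auto
  also have "\<dots> = (\<Sum>m<Suc d. 1)"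
    by (rule sum.mono_neutral_cong_right) (use d in auto)
  finally show ?thesis by simp
qed

text \<open>For \<nu> \<le> d one part alone is too small, so both contribute with the same sign:
  the shifted diagonal meets the positive part for \<open>m < \<nu>\<close>, the unshifted one the
  negative part for \<open>d + \<nu> \<le> m \<le> 2 * d\<close>. The truncation is exactly the
  exponent at \<open>m = 2 * d\<close>, and the counts \<nu> and d - \<nu> + 1 add up to d +
  1.\<close>

lemma diagonal_sum_witness_2:
  assumes d: "0 < d" "2 * d < p" and q: "p * p < q" and \<mu>: "int p \<le> \<mu>" "\<mu> \<le> int q - int p"
    and \<nu>: "\<nu> \<le> d" and n: "n mod int q = int d - 1" "n mod int p = int d"
  shows "diagonal_sum p q \<mu> (int \<nu>) (int d * int q - (int d + 1) * int p) d n = - (int d + 1)"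
proof -
  define J where "J = int d * int q - (int d + 1) * int p"
  have "p \<le> p * p" by simp
  then have pq: "p < q" using q by linarith
  have pos: "0 < p" "0 < q" using d pq by auto
  have m1: "(n - int m) mod int q = (if m < d then int d - 1 - int m else int d - 1 - int m + int q)" if "m < p" for m
  proof -
    have "(n - int m) mod int q = (int d - 1 - int m) mod int q" by (metis n(1) mod_diff_left_eq)
    then show ?thesis using that pq d mod_wrap[of "int q" "int d - 1 - int m"] by auto
  qed
  have m2: "(x - n) mod int p = (x - int d) mod int p" for x
    using n(2) by (metis mod_diff_right_eq)
  have "diagonal_sum p q \<mu> (int \<nu>) J d n
      = (\<Sum>m<p. - of_bool (d + \<nu> \<le> m \<and> m \<le> 2 * d) - of_bool (m < \<nu>))"
    unfolding diagonal_sum_def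
  proof (rule sum.cong)
    fix m assume "m \<in> {..<p}"
    then have m: "m < p" by simp
    have md: "(int (m + d) - n) mod int p = int m" unfolding m2 using m by simp
    have mm: "(int m - n) mod int p = (if m < d then int m - int d + int p else int m - int d)"
      unfolding m2 using m d mod_wrap[of "int p" "int m - int d"] by auto
    show "region (int p) (int q) \<mu> (int \<nu>) J ((n - int m) mod int q) ((int m - n) mod int p) -
        region (int p) (int q) \<mu> (int \<nu>) J ((n - int m) mod int q) ((int (m + d) - n) mod int p)
        = - of_bool (d + \<nu> \<le> m \<and> m \<le> 2 * d) - of_bool (m < \<nu>)"
    proof (cases "m < d")
      case True
      have "(int d - 1 - int m) * int p + int m * int q \<le> J"
      proof -
        have "2 * d * p \<le> p * p" using d by (intro mult_le_mono1) auto
        then have "2 * d * p \<le> q" using q by linarith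
        then have "2 * int d * int p \<le> int q" by (metis of_nat_le_iff of_nat_mult of_nat_numeral)
        moreover have "int m * int q \<le> (int d - 1) * int q" using True by (intro mult_right_mono) auto
        ultimately have "int m * int q + 2 * int d * int p \<le> int d * int q" by (simp add: algebra_simps)
        also have "\<dots> \<le> int d * int q + int m * int p" by simp
        finally show ?thesis by (simp add: J_def algebra_simps)
      qed
      moreover have "int d - 1 - int m < \<mu>" using d \<mu> by linarith
      moreover have "\<not> int m - int d + int p < int \<nu>" using d \<nu> by linarith
      ultimately show ?thesis using True \<nu> d unfolding m1[OF m] mm md region_def by simp
    next
      case False
      have 3: "\<mu> \<le> int d - 1 - int m + int q" using \<mu> m d by linarith
      have 1: "(int d - 1 - int m + int q) * int p + (int m - int d) * int q \<le> J + int p * int q \<longleftrightarrow> m \<le> 2 * d"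
      proof -
        have "(int d - 1 - int m + int q) * int p + (int m - int d) * int q \<le> J + int p * int q
            \<longleftrightarrow> 0 \<le> (2 * int d - int m) * (int q - int p)"
          by (simp add: J_def algebra_simps)
        also have "\<dots> \<longleftrightarrow> m \<le> 2 * d" using pq by (auto simp: zero_le_mult_iff)
        finally show ?thesis .
      qed
      have 2: "\<not> (int d - 1 - int m + int q) * int p + int m * int q \<le> J + int p * int q"
      proof -
        have "(int m - int d) * int p \<le> (int m - int d) * int q"
          using False pq by (intro mult_left_mono) auto
        moreover have "0 < int d * int p" using d pos by simp
        ultimately show ?thesis by (simp add: J_def algebra_simps)
      qed
      show ?thesis using False 1 2 3 \<nu> unfolding m1[OF m] mm md region_def by (auto simp: of_bool_def)
    qed
  qed auto
  also have "\<dots> = - (\<Sum>m<p. of_bool (d + \<nu> \<le> m \<and> m \<le> 2 * d)) - (\<Sum>m<p. of_bool (m < \<nu>))"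
    by (simp add: sum_subtractf sum_negf)
  also have "(\<Sum>m<p. of_bool (d + \<nu> \<le> m \<and> m \<le> 2 * d)) = (\<Sum>m\<in>{d + \<nu>..2 * d}. 1 :: int)"
    by (rule sum.mono_neutral_cong_right) (use d in auto)
  also have "(\<Sum>m<p. of_bool (m < \<nu>)) = (\<Sum>m<\<nu>. 1 :: int)"
    by (rule sum.mono_neutral_cong_right) (use d \<nu> in auto)
  finally show ?thesis using \<nu> by (simp add: J_def)
qed

section \<open>The flat case, \<open>r\<close> congruent to 1 modulo \<open>p * q\<close>\<close>

definition representable :: "nat \<Rightarrow> nat \<Rightarrow> int \<Rightarrow> int" where
  "representable p q x = of_bool (\<exists>a b :: nat. x = int a * int p + int b * int q)"

lemma representable_cases: "representable p q x \<in> {0, 1}"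
proof (cases "\<exists>a b :: nat. x = int a * int p + int b * int q")
  case True
  then show ?thesis unfolding representable_def of_bool_def by (simp only: if_True) simp
next
  case False
  then show ?thesis unfolding representable_def of_bool_def by (simp only: if_False) simp
qed

lemma representable_neg: "x < 0 \<Longrightarrow> representable p q x = 0"
  by (auto simp: representable_def not_le[symmetric])

lemma representable_mono:
  "representable p q (x - int p) \<le> representable p q x"
  "representable p q (x - int q) \<le> representable p q x"
proof -
  have "\<exists>a b :: nat. x = int a * int p + int b * int q" if "x - int p = int a * int p + int b * int q" for a b :: nat
    using that by (intro exI[of _ "Suc a"] exI[of _ b]) (simp add: algebra_simps)
  then show "representable p q (x - int p) \<le> representable p q x" by (auto simp: representable_def)
  have "\<exists>a b :: nat. x = int a * int p + int b * int q" if "x - int q = int a * int p + int b * int q" for a b :: nat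
    using that by (intro exI[of _ a] exI[of _ "Suc b"]) (simp add: algebra_simps)
  then show "representable p q (x - int q) \<le> representable p q x" by (auto simp: representable_def)
qed

text \<open>If the representation of \<open>x\<close> obtained from \<open>x - p\<close> did not use
  \<open>q\<close>, comparison with the one from \<open>x - q\<close> would make \<open>p\<close>
  divide \<open>b' + 1\<close> and force \<open>x \<ge> p * q\<close>.\<close>

lemma representable_both:
  assumes "coprime p q" and x: "x < int p * int q"
    and "representable p q (x - int p) = 1" "representable p q (x - int q) = 1"
  shows "representable p q (x - int q - int p) = 1"
proof -
  obtain a b :: nat where ab: "x - int p = int a * int p + int b * int q"
    using assms(3) by (auto simp: representable_def)
  obtain a' b' :: nat where ab': "x - int q = int a' * int p + int b' * int q"
    using assms(4) by (auto simp: representable_def)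
  have "b \<noteq> 0"
  proof
    assume "b = 0"
    then have "(int b' + 1) * int q = int p * (int a + 1 - int a')"
      using ab ab' by (simp add: algebra_simps)
    then have "int p dvd (int b' + 1) * int q" by simp
    then have "int p dvd int b' + 1"
      using assms(1) by (simp add: coprime_dvd_mult_left_iff)
    then have "int p \<le> int b' + 1" by (rule zdvd_imp_le) simp
    then have "int p * int q \<le> (int b' + 1) * int q" by (rule mult_right_mono) simp
    moreover have "0 \<le> int a' * int p" by simp
    ultimately show False using ab' x by (simp add: algebra_simps)
  qed
  then obtain c where "b = Suc c" by (cases b) auto
  then have "x - int q - int p = int a * int p + int c * int q" using ab by (simp add: algebra_simps)
  then show ?thesis by (auto simp: representable_def)
qed

text \<open>Arguments above \<open>J\<close> share the value at \<open>J\<close>. The delicate case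
  is \<open>x - p \<le> J < x\<close>: both negative terms may be 1 while the value at
  \<open>J\<close> is 0, and \<open>representable_both\<close> then supplies the compensating fourth
  term.\<close>

lemma representable_difference_bound:
  fixes J :: int
  assumes "coprime p q" "x < int p * int q" "p < q"
  defines "G \<equiv> \<lambda>x. representable p q (min x J)"
  shows "\<bar>G x - G (x - int p) - G (x - int q) + G (x - int q - int p)\<bar> \<le> 1"
proof -
  note c = representable_cases[of p q x] representable_cases[of p q "x - int p"]
    representable_cases[of p q "x - int q"] representable_cases[of p q "x - int q - int p"]
    representable_cases[of p q J]
  note m = representable_mono[where p = p and q = q and x = x]
    representable_mono(1)[of p q "x - int q"] representable_mono(2)[of p q "x - int p"]
  have e: "x - int p - int q = x - int q - int p" by simp
  note b = representable_both[OF assms(1,2)]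
  consider "x \<le> J" | "x - int p \<le> J" "J < x" | "x - int q \<le> J" "J < x - int p"
    | "x - int q - int p \<le> J" "J < x - int q" | "J < x - int q - int p" by linarith
  then show ?thesis
    by cases (use c m[unfolded e] b assms(3) in \<open>auto simp: G_def min_def split: if_splits\<close>)
qed

context three_primes
begin

text \<open>As a power series, Phi_pq is 1 - x times the sum of x^s over the semigroup generated by
  \<open>p\<close> and \<open>q\<close>. The division by 1 - x^p is carried out by
  \<open>coeff_eq_res_sum\<close>.\<close>

lemma coeff_cyclotomic_poly_two_primes:
  "poly.coeff (cyclotomic_poly (p * q)) v
     = of_int (representable p q (int v) - representable p q (int v - 1))"
proof -
  define R where "R v = (\<Sum>\<beta><p. of_bool (q * \<beta> \<le> v \<and> [q * \<beta> = v] (mod p)) :: complex)" for v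
  have R: "R v = of_int (representable p q (int v))" for v
  proof -
    \<comment> \<open>A representation can be normalized to \<beta> < p, and two normalized \<beta>
      agree modulo \<open>p\<close>; so the cardinality of \<open>B\<close> is the indicator of
      representability.\<close>
    define B where "B = {\<beta>. \<beta> < p \<and> q * \<beta> \<le> v \<and> [q * \<beta> = v] (mod p)}"
    have "finite B" by (rule finite_subset[of _ "{..<p}"]) (auto simp: B_def)
    have "R v = (\<Sum>\<beta>\<in>B. 1)"
      unfolding R_def by (rule sum.mono_neutral_cong_right) (auto simp: B_def)
    moreover have "card B \<le> 1"
    proof (rule card_le_Suc0_iff_eq[THEN iffD2, unfolded One_nat_def[symmetric], OF \<open>finite B\<close>], safe)
      fix x y assume "x \<in> B" "y \<in> B"
      then have "[q * x = q * y] (mod p)" "x < p" "y < p"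
        by (auto simp: B_def intro: cong_trans cong_sym)
      then show "x = y"
        using coprimes(1) by (simp add: cong_mult_lcancel_nat coprime_commute) (simp add: unique_euclidean_semiring_class.cong_def)
    qed
    moreover have "B \<noteq> {} \<longleftrightarrow> (\<exists>a b :: nat. int v = int a * int p + int b * int q)"
    proof
      assume "B \<noteq> {}"
      then obtain \<beta> where "q * \<beta> \<le> v" "[v = q * \<beta>] (mod p)" by (auto simp: B_def intro: cong_sym)
      then obtain a where "v = a * p + q * \<beta>" using cong_le_nat by blast
      then have "int v = int a * int p + int \<beta> * int q" by simp
      then show "\<exists>a b :: nat. int v = int a * int p + int b * int q" by blast
    next
      assume "\<exists>a b :: nat. int v = int a * int p + int b * int q"
      then obtain a b where "int v = int a * int p + int b * int q" by blast
      then have v: "v = a * p + b * q" by (metis of_nat_add of_nat_eq_iff of_nat_mult)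
      have "q * (b mod p) \<le> q * b" "q * b \<le> v" by (simp_all add: v mult.commute)
      then have "q * (b mod p) \<le> v" by (rule order_trans)
      moreover have "[q * (b mod p) = v] (mod p)"
        by (simp add: v unique_euclidean_semiring_class.cong_def mod_mult_right_eq mult.commute)
      ultimately have "b mod p \<in> B" using pos by (simp add: B_def)
      then show "B \<noteq> {}" by blast
    qed
    ultimately show ?thesis
      using \<open>finite B\<close> by (cases "card B") (auto simp: representable_def)
  qed
  have "cyclotomic_poly (p * q) * (1 - X_pow p) * (1 - X_pow q)
      = (1 - X_pow 1) * (\<Sum>\<beta><p. X_pow (q * \<beta>)) * (1 - X_pow q)"
  proof -
    have geo: "unity_poly (p * q) = unity_poly q * (\<Sum>\<beta><p. X_pow (q * \<beta>))"
      using power_diff_1_eq[of "X_pow q" p] by (simp add: monom_power mult.commute)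
    have "cyclotomic_poly (p * q) * (1 - X_pow p) * (1 - X_pow q)
        = cyclotomic_poly (p * q) * (unity_poly p * unity_poly q)"
      by (simp add: algebra_simps)
    also have "\<dots> = unity_poly 1 * (unity_poly q * (\<Sum>\<beta><p. X_pow (q * \<beta>)))"
      using cyclotomic_poly_two_primes geo by simp
    finally show ?thesis by (simp add: algebra_simps)
  qed
  then have "cyclotomic_poly (p * q) * (1 - X_pow p) = (1 - X_pow 1) * (\<Sum>\<beta><p. X_pow (q * \<beta>))"
    using unity_poly_nonzero[of q] pos by simp
  also have "\<dots> = (\<Sum>\<beta><p. X_pow (q * \<beta>) - X_pow (q * \<beta> + 1))"
    by (simp add: sum_distrib_left algebra_simps mult_monom sum_subtractf)
  finally have "poly.coeff (cyclotomic_poly (p * q)) v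
      = R v - (\<Sum>\<beta><p. of_bool (q * \<beta> + 1 \<le> v \<and> [q * \<beta> + 1 = v] (mod p)))"
    by (simp add: coeff_eq_res_sum[OF pos(1)] res_sum_sum res_sum_diff res_sum_X_pow R_def sum_subtractf)
  also have "(\<Sum>\<beta><p. of_bool (q * \<beta> + 1 \<le> v \<and> [q * \<beta> + 1 = v] (mod p)))
      = (of_int (representable p q (int v - 1)) :: complex)"
  proof (cases v)
    case 0
    then show ?thesis by (simp add: representable_neg)
  next
    case (Suc w)
    have "[q * \<beta> + 1 = Suc w] (mod p) \<longleftrightarrow> [q * \<beta> = w] (mod p)" for \<beta>
      using cong_add_rcancel_nat[of "q * \<beta>" 1 w p] by simp
    then show ?thesis using R[of w] by (simp add: Suc R_def)
  qed
  finally show ?thesis by (simp add: R)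
qed

text \<open>The progression now consists of consecutive exponents. With
  \<open>u = n mod (p * q)\<close> the coefficient is a truncated sum of coefficients of Phi_pq over
  the \<open>p\<close> exponents ending at \<open>u\<close>, minus the one ending at
  \<open>u - q\<close>. These coefficients are differences of \<open>representable\<close>, so each
  sum telescopes.\<close>

lemma cyclotomic_coeff_flat:
  assumes r1: "[r = 1] (mod p * q)"
  shows "\<exists>k. poly.coeff (cyclotomic_poly (p * q * r)) n = of_int k \<and> \<bar>k\<bar> \<le> 1"
proof (cases "n \<le> totient (p * q * r)")
  case False
  then have "poly.coeff (cyclotomic_poly (p * q * r)) n = 0"
    by (intro Polynomial.coeff_eq_0) (simp add: degree_cyclotomic_poly)
  then show ?thesis by (intro exI[of _ 0]) simp
next
  case True
  define J where "J = n div r"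
  define u where "u = n mod (p * q)"
  have tot: "totient (p * q) = (p - 1) * (q - 1)" "totient (p * q * r) = (p - 1) * (q - 1) * (r - 1)"
    using coprimes p q r by (simp_all add: totient_mult_coprime totient_prime)
  have J: "J < (p - 1) * (q - 1)"
  proof -
    have "0 < (p - 1) * (q - 1)" using p2 lt by simp
    then have "(p - 1) * (q - 1) * (r - 1) < (p - 1) * (q - 1) * r" using pos by simp
    then have "n < (p - 1) * (q - 1) * r" using True tot by linarith
    then show ?thesis by (simp add: J_def less_mult_imp_div_less)
  qed
  define c where "c v = representable p q (int v) - representable p q (int v - 1)" for v
  have "cyclotomic_poly (p * q) = (\<Sum>v<p * q. Polynomial.smult (of_int (c v)) (X_pow v))"
  proof (rule poly_eqI)
    fix v
    have "(\<Sum>w<p * q. of_int (c w) * of_bool (w = v)) = (of_bool (v < p * q) * of_int (c v) :: complex)"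
    proof -
      have "(\<Sum>w<p * q. of_int (c w) * of_bool (w = v)) = (\<Sum>w<p * q. if w = v then of_int (c v) else (0::complex))"
        by (intro sum.cong) auto
      then show ?thesis by simp
    qed
    moreover have "poly.coeff (cyclotomic_poly (p * q)) v = 0" if "\<not> v < p * q"
    proof -
      have "totient (p * q) < p * q"
        unfolding tot using pos by (intro mult_strict_mono) auto
      then show ?thesis using that by (intro Polynomial.coeff_eq_0) (simp add: degree_cyclotomic_poly)
    qed
    ultimately show "poly.coeff (cyclotomic_poly (p * q)) v
        = poly.coeff (\<Sum>v<p * q. Polynomial.smult (of_int (c v)) (X_pow v)) v"
      using coeff_cyclotomic_poly_two_primes[of v]
      by (auto simp: Polynomial.coeff_sum c_def of_bool_def)
  qed
  then have coeff: "poly.coeff (cyclotomic_poly (p * q * r)) n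
      = of_int (\<Sum>v<p * q. c v * (of_bool (v \<le> J) * tally n v))"
    unfolding J_def by (intro cyclotomic_coeff_tally) auto
  define g where "g x = (if 0 \<le> x \<and> x \<le> int J then representable p q x - representable p q (x - 1) else 0)" for x
  define G where "G x = representable p q (min x (int J))" for x
  have gG: "g x = G x - G (x - 1)" for x
    by (auto simp: g_def G_def min_def representable_neg intro!: arg_cong[where f = "representable p q"])
  have tally: "tally n v = (\<Sum>m<p. of_bool (v + m = u) - of_bool (v + (m + q) = u))" if "v \<le> J" for v
    unfolding tally_def
  proof (rule sum.cong)
    fix m assume m: "m \<in> {..<p}"
    \<comment> \<open>From \<open>v < (p - 1) * (q - 1)\<close> and \<open>m \<le> p - 1\<close> no
      offset reaches \<open>p * q\<close>, so the congruences become equations. Restricting to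
      \<open>n\<close> up to the degree is what bounds \<open>J\<close>.\<close>
    have bd: "v + (m + q) < p * q"
    proof -
      have "(p - 1) * (q - 1) + p + q = p * q + 1" using pos by (cases p; cases q) auto
      then show ?thesis using m J that by simp
    qed
    have "[r * v + e = n] (mod p * q) \<longleftrightarrow> v + e = u" if "v + e < p * q" for e
    proof -
      have "[r * v + e = 1 * v + e] (mod p * q)" using r1 by (intro cong_add cong_mult) auto
      then have "[r * v + e = n] (mod p * q) \<longleftrightarrow> [v + e = n] (mod p * q)"
        by (simp add: unique_euclidean_semiring_class.cong_def)
      then show ?thesis using that by (simp add: unique_euclidean_semiring_class.cong_def u_def)
    qed
    from this[of m] this[of "m + q"]
    show "of_bool [r * v + m = n] (mod p * q) - of_bool [r * v + (m + q) = n] (mod p * q)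
        = (of_bool (v + m = u) - of_bool (v + (m + q) = u) :: int)"
      using bd by simp
  qed auto
  have "(\<Sum>v<p * q. c v * (of_bool (v \<le> J) * tally n v))
      = (\<Sum>v<p * q. \<Sum>m<p. g (int v) * of_bool (v + m = u) - g (int v) * of_bool (v + (m + q) = u))"
  proof (rule sum.cong)
    fix v
    show "c v * (of_bool (v \<le> J) * tally n v)
        = (\<Sum>m<p. g (int v) * of_bool (v + m = u) - g (int v) * of_bool (v + (m + q) = u))"
      by (cases "v \<le> J") (simp_all add: tally g_def c_def sum_distrib_left right_diff_distrib)
  qed auto
  also have "\<dots> = (\<Sum>m<p. \<Sum>v<p * q. g (int v) * of_bool (v + m = u) - g (int v) * of_bool (v + (m + q) = u))"
    by (rule sum.swap)
  also have "\<dots> = (\<Sum>m<p. g (int u - int m) - g (int u - int (m + q)))"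
  proof (rule sum.cong)
    fix m
    have "(\<Sum>v<p * q. g (int v) * of_bool (v + e = u)) = g (int u - int e)" for e
    proof (cases "e \<le> u")
      case True
      have "(\<Sum>v<p * q. g (int v) * of_bool (v + e = u)) = (\<Sum>v<p * q. if v = u - e then g (int (u - e)) else 0)"
        using True by (intro sum.cong) auto
      also have "u - e < p * q" using pos by (simp add: u_def less_imp_diff_less)
      then have "(\<Sum>v<p * q. if v = u - e then g (int (u - e)) else 0) = g (int (u - e))" by simp
      finally show ?thesis using True by (simp add: of_nat_diff)
    next
      case False
      then have "(\<Sum>v<p * q. g (int v) * of_bool (v + e = u)) = 0" by (intro sum.neutral) auto
      then show ?thesis using False by (simp add: g_def)
    qed
    then show "(\<Sum>v<p * q. g (int v) * of_bool (v + m = u) - g (int v) * of_bool (v + (m + q) = u))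
        = g (int u - int m) - g (int u - int (m + q))"
      by (simp only: sum_subtractf)
  qed auto
  also have "\<dots> = (\<Sum>m<p. g (int u - int m)) - (\<Sum>m<p. g (int u - int q - int m))"
    by (simp add: sum_subtractf algebra_simps)
  also have "(\<Sum>m<p. g (x - int m)) = G x - G (x - int p)" for x
    by (induction p) (auto simp: gG algebra_simps)
  also have "(\<Sum>m<p. g (x - int m)) = G x - G (x - int p)" for x
    by (induction p) (auto simp: gG algebra_simps)
  finally have sum: "(\<Sum>v<p * q. c v * (of_bool (v \<le> J) * tally n v))
      = G (int u) - G (int u - int p) - (G (int u - int q) - G (int u - int q - int p))" .
  have "\<bar>G (int u) - G (int u - int p) - G (int u - int q) + G (int u - int q - int p)\<bar> \<le> 1"
    unfolding G_def
  proof (rule representable_difference_bound[OF coprimes(1) _ lt(1)])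
    have "u < p * q" using pos by (simp add: u_def)
    then show "int u < int p * int q" by (metis of_nat_less_iff of_nat_mult)
  qed
  moreover have "G (int u) - G (int u - int p) - (G (int u - int q) - G (int u - int q - int p))
      = G (int u) - G (int u - int p) - G (int u - int q) + G (int u - int q - int p)" by simp
  ultimately show ?thesis unfolding coeff sum by metis
qed

end

section \<open>Heights\<close>

lemma cyclotomic_height_eqI:
  assumes le: "\<And>n. \<exists>k. poly.coeff (cyclotomic_poly N) n = of_int k \<and> \<bar>k\<bar> \<le> h"
    and eq: "poly.coeff (cyclotomic_poly N) n = of_int k" "\<bar>k\<bar> = h" and h: "h \<ge> 1"
  shows "cyclotomic_height N = real_of_int h"
  unfolding cyclotomic_height_def
proof (rule Max_eqI)
  fix y assume "y \<in> (\<lambda>m. cmod (poly.coeff (cyclotomic_poly N) m)) ` {0..totient N}"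
  then obtain m where y: "y = cmod (poly.coeff (cyclotomic_poly N) m)" by auto
  obtain k where "poly.coeff (cyclotomic_poly N) m = of_int k" "\<bar>k\<bar> \<le> h" using le by blast
  then show "y \<le> real_of_int h" unfolding y by (simp flip: of_int_abs)
next
  \<comment> \<open>A coefficient of modulus \<open>h \<ge> 1\<close> is nonzero, so its index is in
    the range of the maximum.\<close>
  have "n \<le> totient N"
  proof (rule ccontr)
    assume "\<not> n \<le> totient N"
    then have "poly.coeff (cyclotomic_poly N) n = 0"
      by (intro Polynomial.coeff_eq_0) (simp add: degree_cyclotomic_poly)
    with eq h show False by simp
  qed
  moreover have "real_of_int h = cmod (poly.coeff (cyclotomic_poly N) n)"
    using eq by (simp flip: of_int_abs)
  ultimately show "real_of_int h \<in> (\<lambda>m. cmod (poly.coeff (cyclotomic_poly N) m)) ` {0..totient N}" by auto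
qed simp

section \<open>Choice of residues and primes\<close>

lemma exists_prime_cong_gt:
  fixes a n B :: nat
  assumes "squarefree n" "coprime a n"
  obtains p where "prime p" "[p = a] (mod n)" "p > B"
proof -
  have "\<not> {p. prime p \<and> [p = a] (mod n)} \<subseteq> {..B}"
    using infinite_primes_cong[OF assms] finite_subset by blast
  then obtain p where "prime p" "[p = a] (mod n)" "\<not> p \<le> B" by blast
  then show ?thesis using that by simp
qed

text \<open>\<nu> is the inverse of \<open>q\<close> modulo \<open>p\<close>. Writing
  \<open>\<nu> * q = j * p + 1\<close>, the relation forces \<open>\<mu> = q - j\<close>, and
  \<open>q > p * p\<close> keeps \<open>j\<close> at distance at least \<open>p\<close> from 0 and
  \<open>q\<close>, as \<open>diagonal_sum_bound\<close> requires of \<mu>.\<close>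

lemma inverse_pair:
  fixes p q :: nat
  assumes p: "p > 1" and "coprime p q" and q: "p * p < q"
  obtains \<mu> \<nu> where "\<mu> * p + \<nu> * q = p * q + 1" "p \<le> \<mu>" "\<mu> + p \<le> q" "0 < \<nu>" "\<nu> < p"
proof -
  obtain x where x: "[q * x = 1] (mod p)" using cong_solve_coprime_nat[of q p] assms by (auto simp: coprime_commute)
  define \<nu> where "\<nu> = x mod p"
  have c: "[\<nu> * q = 1] (mod p)" 
  proof -
    have "[\<nu> * q = x * q] (mod p)" unfolding \<nu>_def by (intro cong_mult) auto
    then show ?thesis using x by (metis cong_trans mult.commute)
  qed
  have \<nu>: "0 < \<nu>" "\<nu> < p" using c p by (auto simp: \<nu>_def unique_euclidean_semiring_class.cong_def intro!: Nat.gr0I)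
  have "1 \<le> \<nu> * q" using \<nu> q by (cases q) auto
  then obtain j where j: "\<nu> * q = j * p + 1" using c cong_le_nat[of 1 "\<nu> * q" p] by (auto simp: mult.commute)
  have "1 * q \<le> \<nu> * q" using \<nu> by (intro mult_le_mono1) auto
  then have "p * p \<le> j * p" using q j by linarith
  then have jp: "p \<le> j" using p by simp
  have "\<nu> * q + q \<le> p * q" using mult_le_mono1[of "Suc \<nu>" p q] \<nu> by simp
  then have "(j + p) * p \<le> q * p" using q j by (simp add: algebra_simps)
  then have jq: "j + p \<le> q" using p by simp
  have "(q - j) * p + \<nu> * q = p * q + 1" 
  proof -
    have "(q - j) * p + j * p = ((q - j) + j) * p" by (simp only: add_mult_distrib)
    also have "\<dots> = p * q" using jq by simp
    finally show ?thesis using j by simp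
  qed
  then show ?thesis using that[of "q - j" \<nu>] jp jq \<nu> by simp
qed

text \<open>The block of all \<open>n\<close> with \<open>n div r = J\<close> has length
  \<open>r > p * q\<close> and meets every class modulo \<open>p * q\<close>.\<close>

lemma exists_nat_div_mod:
  fixes p q r J a b :: nat
  assumes "coprime p q" "p * q < r" "p > 0" "q > 0"
  obtains n where "n div r = J" "[n = a] (mod q)" "[n = b] (mod p)"
proof -
  obtain x where x: "[x = a] (mod q)" "[x = b] (mod p)"
    using binary_chinese_remainder_nat[of q p a b] assms(1) by (auto simp: coprime_commute)
  define s where "s = nat ((int x - int (r * J)) mod int (p * q))"
  have s: "s < r" "int s = (int x - int (r * J)) mod int (p * q)"
  proof -
    have "(int x - int (r * J)) mod int (p * q) < int (p * q)"
      using assms by (intro pos_mod_bound) (auto simp del: of_nat_mult)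
    moreover have "0 \<le> (int x - int (r * J)) mod int (p * q)"
      using assms by (intro pos_mod_sign) (auto simp del: of_nat_mult)
    ultimately show "s < r" "int s = (int x - int (r * J)) mod int (p * q)"
      using assms(2) unfolding s_def by linarith+
  qed
  define n where "n = r * J + s"
  have "[int n = int x] (mod int (p * q))"
    unfolding n_def by (simp add: s(2) unique_euclidean_semiring_class.cong_def mod_simps)
  then have "[n = x] (mod p * q)" by (simp only: cong_int_iff)
  then have "[n = x] (mod q)" "[n = x] (mod p)"
    by (auto intro: cong_dvd_modulus_nat)
  moreover have "n div r = J" using s(1) by (simp add: n_def)
  ultimately show ?thesis using that[of n] cong_trans[OF _ x(1)] cong_trans[OF _ x(2)] by blast
qed

context three_primes
begin

lemma height_flat:
  assumes "[r = 1] (mod p * q)"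
  shows "cyclotomic_height (p * q * r) = 1"
  using cyclotomic_height_eqI[of "p * q * r" 1 "totient (p * q * r)" 1] cyclotomic_coeff_flat[OF assms]
    lead_coeff_cyclotomic_poly[of "p * q * r"]
  by (simp add: degree_cyclotomic_poly)

lemma height_eq:
  fixes d \<mu> \<nu> :: nat
  assumes d: "0 < d" "2 * d < p" "[q = d] (mod p)" and q_gt: "p * p < q" and r_gt: "p * q < r"
    and inv: "\<mu> * p + \<nu> * q = p * q + 1" and \<mu>: "p \<le> \<mu>" "\<mu> + p \<le> q" and \<nu>: "\<nu> < p"
    and rp: "[r * p = 1] (mod q)" and rq: "p dvd r * q + 1"
  shows "cyclotomic_height (p * q * r) = real d + 1"
proof -
  note coeff = cyclotomic_coeff_diagonal[OF rp rq inv _ _ d(3)]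
  have \<mu>': "int p \<le> int \<mu>" "int \<mu> \<le> int q - int p" using \<mu> by auto
  have bound: "\<exists>k. poly.coeff (cyclotomic_poly (p * q * r)) n = of_int k \<and> \<bar>k\<bar> \<le> int d + 1" for n
    using coeff[of n] diagonal_sum_bound[OF pos(1) q_gt \<mu>', of "int \<nu>"] \<mu> \<nu> by auto
  have "\<exists>n k. poly.coeff (cyclotomic_poly (p * q * r)) n = of_int k \<and> \<bar>k\<bar> = int d + 1"
  proof (cases "d < \<nu>")
    case True
    obtain n where n: "n div r = d * q" "[n = d] (mod q)" "[n = 0] (mod p)"
      using exists_nat_div_mod[OF coprimes(1) r_gt pos(1,2)] by blast
    have "d < q" using d(2) lt by linarith
    then have "int n mod int q = int d" "int n mod int p = 0"
      using n(2,3) by (simp_all add: unique_euclidean_semiring_class.cong_def flip: of_nat_mod)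
    then have "diagonal_sum p q (int \<mu>) (int \<nu>) (int (d * q)) d (int n) = int d + 1"
      using True by (intro diagonal_sum_witness_1 d q_gt \<mu>') auto
    then show ?thesis using coeff[of n] \<mu> \<nu> n(1) by (intro exI[of _ n] exI[of _ "int d + 1"]) simp
  next
    case False
    \<comment> \<open>Makes the natural subtraction in the choice of \<open>n div r\<close> below
      exact.\<close>
    have le: "(d + 1) * p \<le> d * q"
    proof -
      have "(d + 1) * p \<le> p * p" using d by (intro mult_le_mono1) auto
      also have "\<dots> \<le> 1 * q" using q_gt by simp
      also have "\<dots> \<le> d * q" using d by (intro mult_le_mono1) auto
      finally show ?thesis .
    qed
    obtain n where n: "n div r = d * q - (d + 1) * p" "[n = d - 1] (mod q)" "[n = d] (mod p)"
      using exists_nat_div_mod[OF coprimes(1) r_gt pos(1,2)] by blast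
    have "d - 1 < q" "d < p" using d(2) lt by linarith+
    then have "int n mod int q = int (d - 1)" "int n mod int p = int d"
      using n(2,3) by (simp_all add: unique_euclidean_semiring_class.cong_def flip: of_nat_mod)
    moreover have "int (n div r) = int d * int q - (int d + 1) * int p"
      unfolding n(1) using le by (simp add: of_nat_diff algebra_simps)
    ultimately have "diagonal_sum p q (int \<mu>) (int \<nu>) (int (n div r)) d (int n) = - (int d + 1)"
      using False d by (simp only:) (intro diagonal_sum_witness_2 d q_gt \<mu>', auto simp: of_nat_diff)
    then show ?thesis using coeff[of n] \<mu> \<nu> by (intro exI[of _ n] exI[of _ "- (int d + 1)"]) simp
  qed
  then obtain n k where "poly.coeff (cyclotomic_poly (p * q * r)) n = of_int k" "\<bar>k\<bar> = int d + 1" by blast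
  from cyclotomic_height_eqI[OF bound this] show ?thesis by simp
qed

end

lemma exists_primes_height_one:
  assumes "prime p"
  obtains q r where "prime q" "prime r" "q > N" "q > p" "r > q" "cyclotomic_height (p * q * r) = 1"
proof -
  obtain q where q: "prime q" "q > max N p" using bigger_prime by blast
  have "squarefree (p * q)"
    using assms q by (intro squarefree_mult_coprime primes_coprime squarefree_prime) auto
  then obtain r where r: "prime r" "[r = 1] (mod p * q)" "r > q"
    using exists_prime_cong_gt[of "p * q" 1 q] by auto
  interpret T: three_primes p q r using assms q r by unfold_locales auto
  from that[of q r] q r(1,3) T.height_flat[OF r(2)] show ?thesis by simp
qed

lemma exists_primes_height:
  assumes p: "prime p" and d: "0 < d" "2 * d < p"
  obtains q r where "prime q" "prime r" "q > N" "q > p" "r > q" "cyclotomic_height (p * q * r) = real d + 1"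
proof -
  have sp: "squarefree p" using p by (intro squarefree_prime) auto
  have "coprime d p"
    using p d by (metis coprime_commute prime_imp_coprime nat_dvd_not_less less_trans less_add_same_cancel1 mult_2)
  then obtain q where q: "prime q" "[q = d] (mod p)" "q > max N (p * p)"
    using exists_prime_cong_gt[OF sp] by blast
  have "p \<le> p * p" by simp
  then have pq: "p < q" "p * p < q" using q by linarith+
  have cop: "coprime p q" using p q pq by (intro primes_coprime) auto
  obtain \<mu> \<nu> where inv: "\<mu> * p + \<nu> * q = p * q + 1" "p \<le> \<mu>" "\<mu> + p \<le> q" "0 < \<nu>" "\<nu> < p"
    using inverse_pair[OF prime_gt_1_nat[OF p] cop pq(2)] .
  \<comment> \<open>\<mu> inverts \<open>p\<close> modulo \<open>q\<close> and \<nu> inverts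
    \<open>q\<close> modulo \<open>p\<close>; \<open>p - \<nu>\<close> stands for -\<nu>. So
    \<open>t * p\<close> is 1 modulo \<open>q\<close> and \<open>t * q\<close> is -1 modulo
    \<open>p\<close>.\<close>
  obtain t where t: "[t = \<mu>] (mod q)" "[t = p - \<nu>] (mod p)"
    using binary_chinese_remainder_nat[of q p \<mu> "p - \<nu>"] cop by (auto simp: coprime_commute)
  have \<mu>p: "[\<mu> * p = 1] (mod q)"
  proof -
    have "\<mu> * p mod q = (\<mu> * p + \<nu> * q) mod q" by simp
    also have "\<dots> = (1 + p * q) mod q" using inv(1) by (simp only: add.commute)
    also have "\<dots> = 1 mod q" by (rule mod_mult_self1)
    finally show ?thesis by (simp only: unique_euclidean_semiring_class.cong_def)
  qed
  have \<nu>q: "p dvd (p - \<nu>) * q + 1"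
  proof -
    have "(p - \<nu>) * q + 1 + (\<nu> * q) = p * q + 1"
      using inv mult_le_mono1[of \<nu> p q] by (simp add: diff_mult_distrib)
    then have "(p - \<nu>) * q + 1 = \<mu> * p" using inv(1) by linarith
    then show ?thesis by simp
  qed
  have res: "[x * p = 1] (mod q)" "p dvd x * q + 1" if "[x = t] (mod p * q)" for x
  proof -
    have "[x = \<mu>] (mod q)" "[x = p - \<nu>] (mod p)"
      using that t by (meson cong_dvd_modulus_nat cong_trans dvd_triv_left dvd_triv_right)+
    then have "[x * p = \<mu> * p] (mod q)" "[x * q + 1 = (p - \<nu>) * q + 1] (mod p)"
      by (auto intro!: cong_scalar_right cong_add simp del: One_nat_def add_Suc_right)
    then show "[x * p = 1] (mod q)" "p dvd x * q + 1"
      using \<mu>p \<nu>q cong_dvd_iff by (blast intro: cong_trans)+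
  qed
  have "coprime t (p * q)"
  proof -
    have "coprime (t * p) q" using res(1)[of t] by (metis cong_imp_coprime cong_refl cong_sym coprime_1_left)
    moreover have "coprime t p"
    proof (rule ccontr)
      assume "\<not> coprime t p"
      then have "p dvd t" using p by (metis coprime_commute prime_imp_coprime)
      then have "p dvd t * q" by simp
      then have "p dvd 1" using res(2)[of t] by (metis cong_refl dvd_add_right_iff)
      then show False using prime_gt_1_nat[OF p] by simp
    qed
    ultimately show ?thesis by simp
  qed
  moreover have "squarefree (p * q)"
    using p q cop by (intro squarefree_mult_coprime squarefree_prime) auto
  ultimately obtain r where r: "prime r" "[r = t] (mod p * q)" "r > p * q"
    using exists_prime_cong_gt[of "p * q" t "p * q"] by blast
  have "1 * q \<le> p * q" using prime_gt_0_nat[OF p] by (intro mult_le_mono1) auto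
  then have "q < r" using r(3) by linarith
  interpret T: three_primes p q r using p q r pq \<open>q < r\<close> by unfold_locales auto
  have "cyclotomic_height (p * q * r) = real d + 1"
    using T.height_eq[OF d q(2) pq(2) r(3) inv(1,2,3,5) res[OF r(2)]] .
  then show ?thesis using that[of q r] q r pq \<open>q < r\<close> by simp
qed

theorem theorem2:
  fixes p :: nat and h :: int
  assumes "prime p" and "odd p"
    and "1 \<le> h" and "real_of_int h \<le> (real p + 1) / 2"
  shows "\<forall>N::nat. \<exists>q r::nat. prime q \<and> prime r \<and> q > N \<and> q > p \<and> r > q
           \<and> cyclotomic_height (p * q * r) = real_of_int h"
proof
  fix N
  show "\<exists>q r::nat. prime q \<and> prime r \<and> q > N \<and> q > p \<and> r > q
           \<and> cyclotomic_height (p * q * r) = real_of_int h"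
  proof (cases "h = 1")
    case True
    then show ?thesis using exists_primes_height_one[OF assms(1), of N] by (metis of_int_1)
  next
    case False
    define d where "d = nat (h - 1)"
    have h: "real_of_int h = real d + 1" using assms(3) by (simp add: d_def)
    have "0 < d" using False assms(3) by (simp add: d_def)
    moreover have "2 * d < p"
    proof -
      have "real (2 * d) \<le> real (p - 1)" using h assms(4) prime_gt_0_nat[OF assms(1)] by (simp add: of_nat_diff)
      then show ?thesis using prime_gt_0_nat[OF assms(1)] by linarith
    qed
    ultimately show ?thesis
      using exists_primes_height[OF assms(1), of d N] unfolding h by metis
  qed
qed

end
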